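(* Let $k$ be a field of characteristic zero and set $q=1+\hbar$, where $\hbar$ is a variable. Then $W_1[[\hbar]]$ and $W_q[[\hbar]]$ are isomorphic as algebras over $k[[\hbar]]$. The cohomology groups $H^n(W_q[[\hbar]],W_q[[\hbar]])$ vanish for all $n>0$, as do those of $W_1$. Consequently all classes of positive dimension of $W_q$ are fragile at the specialization $q=1$, and the resilient cohomology of $W_q$ at this specialization is reduced to the constants (the scalars, in dimension zero).
   Context: The Weyl algebra is $W_1=k\{x,y\}/(xy-yx-1)$, where $k\{x,y\}$ is the free unital associative algebra. $W_1[[\hbar]]$ is the $k[[\hbar]]$-algebra of formal power series in the central variable $\hbar$ with coefficients in $W_1$. With $q=1+\hbar$, the $q$-Weyl algebra $W_q$ is the $k[\hbar]$-algebra $k[\hbar]\{x,y\}/(qxy-yx-1)$; it is free as a $k[\hbar]$-module on the monomials $x^iy^j$, $i,j\ge 0$. $W_q[[\hbar]]$ denotes its $\hbar$-adic completion, a $k[[\hbar]]$-algebra. Its elements are the formal power series in $\hbar$ whose coefficients are $k$-linear combinations of the monomials $x^iy^j$, with multiplication determined by $qxy-yx=1$. Cohomology of an algebra means Hochschild cohomology with coefficients in the algebra itself, taken over the indicated ground ring ($k$ for $W_1$, $k[\hbar]$ for $W_q$, $k[[\hbar]]$ for $W_1[[\hbar]]$ and $W_q[[\hbar]]$). A class in $H^*(W_q,W_q)$ is called fragile at the specialization $q=1$ (that is, $\hbar=0$) if its image in $H^*(W_q[[\hbar]],W_q[[\hbar]])$, obtained by extending cochains to the completion, is an $\hbar$-torsion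 class, i.e. vanishes once $\hbar^{-1}$ is adjoined to the coefficients. The fragile classes form an ideal of $H^*(W_q,W_q)$, and the resilient cohomology at this specialization is the quotient of $H^*(W_q,W_q)$ by this ideal. *)

theory Defs
  imports
    "HOL-Library.Poly_Mapping"
    "HOL-Computational_Algebra.Computational_Algebra"
    "HOL-Algebra.Algebraic_Closure_Type"
begin

text \<open>
  An algebra over a commutative ring is represented by a type of class \<open>ring_1\<close> together with
  its structure map \<open>\<eta>\<close> from the ground ring into the centre of the algebra.
\<close>

section \<open>Free algebras on two generators\<close>

datatype gen = GX | GY

datatype word = Word (letters: "gen list")

instantiation word :: monoid_add
begin
definition zero_word :: word where "zero_word = Word []"
definition plus_word :: "word \<Rightarrow> word \<Rightarrow> word" where "plus_word u v = Word (letters u @ letters v)"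
instance by standard (auto simp: zero_word_def plus_word_def)
end

text \<open>Multiplication in this type is the convolution product, i.e. concatenation of words.\<close>

type_synonym 'r free_alg = "word \<Rightarrow>\<^sub>0 'r"

definition free_x :: "'r::comm_ring_1 free_alg" where
  "free_x = Poly_Mapping.single (Word [GX]) 1"

definition free_y :: "'r::comm_ring_1 free_alg" where
  "free_y = Poly_Mapping.single (Word [GY]) 1"

definition free_scalar :: "'r::comm_ring_1 \<Rightarrow> 'r free_alg" where
  "free_scalar c = Poly_Mapping.single 0 c"

definition weyl_ideal :: "'r::comm_ring_1 \<Rightarrow> 'r free_alg set" where
  "weyl_ideal q =
     Idl\<^bsub>ring_of_type_algebra\<^esub> {free_scalar q * free_x * free_y - free_y * free_x - 1}"

definition weyl_rel :: "'r::comm_ring_1 \<Rightarrow> 'r free_alg \<Rightarrow> 'r free_alg \<Rightarrow> bool" where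
  "weyl_rel q a b \<longleftrightarrow> a - b \<in> weyl_ideal q"

lemma ring_of_type: "ring (ring_of_type_algebra :: 'a::ring_1 ring)"
proof -
  have "\<exists>y. x + y = 0" for x :: 'a
    using add.right_inverse by blast
  thus ?thesis
    unfolding ring_of_type_algebra_def using add.right_inverse
    by unfold_locales (auto simp: algebra_simps Units_def)
qed

lemma type_idealI:
  fixes I :: "'a::ring_1 set"
  assumes "0 \<in> I" "\<And>a b. a \<in> I \<Longrightarrow> b \<in> I \<Longrightarrow> a + b \<in> I"
    "\<And>a b. a \<in> I \<Longrightarrow> b * a \<in> I" "\<And>a b. a \<in> I \<Longrightarrow> a * b \<in> I"
  shows "ideal I ring_of_type_algebra"
proof (rule idealI)
  interpret R: ring "ring_of_type_algebra :: 'a ring" by (rule ring_of_type)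
  have inv: "inv\<^bsub>add_monoid ring_of_type_algebra\<^esub> a = - a" for a :: 'a
    using R.minus_equality[of "- a" a]
    by (simp add: ring_of_type_algebra_def a_inv_def)
  show "subgroup I (add_monoid ring_of_type_algebra)"
    apply (rule group.subgroupI)
        apply (rule R.a_group)
    using assms(1,2) assms(3)[of _ "-1"]
    unfolding inv by (auto simp: ring_of_type_algebra_def)
qed (use assms in \<open>auto simp: ring_of_type_algebra_def intro: ring_of_type[unfolded ring_of_type_algebra_def]\<close>)

lemma ideal_weyl_ideal: "ideal (weyl_ideal q) ring_of_type_algebra"
  unfolding weyl_ideal_def
  by (rule ring.genideal_ideal[OF ring_of_type]) (simp add: ring_of_type_algebra_def)

lemma weyl_ideal_gen: "free_scalar q * free_x * free_y - free_y * free_x - 1 \<in> weyl_ideal q"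
  unfolding weyl_ideal_def
  by (rule ring.genideal_self'[OF ring_of_type]) (simp add: ring_of_type_algebra_def)

lemma weyl_ideal_0: "0 \<in> weyl_ideal q"
  and weyl_ideal_add: "a \<in> weyl_ideal q \<Longrightarrow> b \<in> weyl_ideal q \<Longrightarrow> a + b \<in> weyl_ideal q"
  and weyl_ideal_mult_left: "a \<in> weyl_ideal q \<Longrightarrow> b * a \<in> weyl_ideal q"
  and weyl_ideal_mult_right: "a \<in> weyl_ideal q \<Longrightarrow> a * b \<in> weyl_ideal q"
proof -
  interpret ideal "weyl_ideal q" ring_of_type_algebra by (rule ideal_weyl_ideal)
  show "0 \<in> weyl_ideal q"
    using additive_subgroup.zero_closed[OF is_additive_subgroup] by (simp add: ring_of_type_algebra_def)
  show "a \<in> weyl_ideal q \<Longrightarrow> b \<in> weyl_ideal q \<Longrightarrow> a + b \<in> weyl_ideal q"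
    using additive_subgroup.a_closed[OF is_additive_subgroup, of a b] by (simp add: ring_of_type_algebra_def)
  show "a \<in> weyl_ideal q \<Longrightarrow> b * a \<in> weyl_ideal q"
    using I_l_closed[of a b] by (simp add: ring_of_type_algebra_def)
  show "a \<in> weyl_ideal q \<Longrightarrow> a * b \<in> weyl_ideal q"
    using I_r_closed[of a b] by (simp add: ring_of_type_algebra_def)
qed

lemma weyl_ideal_minus: "a \<in> weyl_ideal q \<Longrightarrow> - a \<in> weyl_ideal q"
  using weyl_ideal_mult_left[of a q "-1"] by simp

lemma weyl_ideal_diff: "a \<in> weyl_ideal q \<Longrightarrow> b \<in> weyl_ideal q \<Longrightarrow> a - b \<in> weyl_ideal q"
  using weyl_ideal_add[of a q "- b"] weyl_ideal_minus[of b q] by simp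

lemma equivp_weyl_rel: "equivp (weyl_rel q)"
proof (rule equivpI)
  show "reflp (weyl_rel q)" by (simp add: reflp_def weyl_rel_def weyl_ideal_0)
  show "symp (weyl_rel q)"
    unfolding symp_def weyl_rel_def using weyl_ideal_minus by fastforce
  show "transp (weyl_rel q)"
    unfolding transp_def weyl_rel_def using weyl_ideal_add by fastforce
qed

lemma weyl_rel_add: "weyl_rel q a b \<Longrightarrow> weyl_rel q c d \<Longrightarrow> weyl_rel q (a + c) (b + d)"
  unfolding weyl_rel_def using weyl_ideal_add[of "a - b" q "c - d"] by (simp add: algebra_simps)

lemma weyl_rel_diff: "weyl_rel q a b \<Longrightarrow> weyl_rel q c d \<Longrightarrow> weyl_rel q (a - c) (b - d)"
  unfolding weyl_rel_def using weyl_ideal_diff[of "a - b" q "c - d"] by (simp add: algebra_simps)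

lemma weyl_rel_uminus: "weyl_rel q a b \<Longrightarrow> weyl_rel q (- a) (- b)"
  unfolding weyl_rel_def using weyl_ideal_minus[of "a - b" q] by (simp add: algebra_simps)

lemma weyl_rel_mult:
  assumes "weyl_rel q a b" "weyl_rel q c d"
  shows "weyl_rel q (a * c) (b * d)"
proof -
  have "a * c - b * d = (a - b) * c + b * (c - d)" by (simp add: algebra_simps)
  thus ?thesis using assms unfolding weyl_rel_def
    by (simp add: weyl_ideal_add weyl_ideal_mult_left weyl_ideal_mult_right)
qed

text \<open>
  A representation on sequences, in which x acts as the right shift; it shows that the quotients
  below are non-trivial, as class \<open>ring_1\<close> requires.
\<close>

fun qcoeff :: "'r::comm_ring_1 \<Rightarrow> nat \<Rightarrow> 'r" where
  "qcoeff q 0 = - 1"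
| "qcoeff q (Suc n) = q * qcoeff q n - 1"

fun gen_act :: "'r::comm_ring_1 \<Rightarrow> gen \<Rightarrow> (nat \<Rightarrow> 'r) \<Rightarrow> nat \<Rightarrow> 'r" where
  "gen_act q GX v n = (case n of 0 \<Rightarrow> 0 | Suc m \<Rightarrow> v m)"
| "gen_act q GY v n = qcoeff q n * v (Suc n)"

definition word_act :: "'r::comm_ring_1 \<Rightarrow> word \<Rightarrow> (nat \<Rightarrow> 'r) \<Rightarrow> nat \<Rightarrow> 'r" where
  "word_act q w v = foldr (gen_act q) (letters w) v"

definition free_act :: "'r::comm_ring_1 \<Rightarrow> 'r free_alg \<Rightarrow> (nat \<Rightarrow> 'r) \<Rightarrow> nat \<Rightarrow> 'r" where
  "free_act q p v n = (\<Sum>w\<in>Poly_Mapping.keys p. Poly_Mapping.lookup p w * word_act q w v n)"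

lemma gen_act_lin:
  "gen_act q g (\<lambda>n. u n + v n) = (\<lambda>n. gen_act q g u n + gen_act q g v n)"
  "gen_act q g (\<lambda>n. c * v n) = (\<lambda>n. c * gen_act q g v n)"
  by (cases g; auto simp: fun_eq_iff algebra_simps split: nat.splits)+

lemma word_act_lin:
  "word_act q w (\<lambda>n. u n + v n) = (\<lambda>n. word_act q w u n + word_act q w v n)"
  "word_act q w (\<lambda>n. c * v n) = (\<lambda>n. c * word_act q w v n)"
proof -
  have "foldr (gen_act q) l (\<lambda>n. u n + v n) =
      (\<lambda>n. foldr (gen_act q) l u n + foldr (gen_act q) l v n)" for l
    by (induction l) (simp_all add: gen_act_lin)
  thus "word_act q w (\<lambda>n. u n + v n) = (\<lambda>n. word_act q w u n + word_act q w v n)"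
    by (simp add: word_act_def)
  have "foldr (gen_act q) l (\<lambda>n. c * v n) = (\<lambda>n. c * foldr (gen_act q) l v n)" for l
    by (induction l) (simp_all add: gen_act_lin)
  thus "word_act q w (\<lambda>n. c * v n) = (\<lambda>n. c * word_act q w v n)"
    by (simp add: word_act_def)
qed

lemma word_act_plus: "word_act q (u + w) v = word_act q u (word_act q w v)"
  by (simp add: word_act_def plus_word_def)

lemma free_act_superset:
  assumes "finite S" "Poly_Mapping.keys p \<subseteq> S"
  shows "free_act q p v n = (\<Sum>w\<in>S. Poly_Mapping.lookup p w * word_act q w v n)"
  unfolding free_act_def
  by (rule sum.mono_neutral_left) (use assms in \<open>auto simp: in_keys_iff\<close>)

lemma free_act_add: "free_act q (a + b) v n = free_act q a v n + free_act q b v n"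
proof -
  let ?S = "Poly_Mapping.keys a \<union> Poly_Mapping.keys b"
  have "free_act q (a + b) v n = (\<Sum>w\<in>?S. Poly_Mapping.lookup (a + b) w * word_act q w v n)"
    using keys_add[of a b] by (intro free_act_superset) auto
  also have "\<dots> = free_act q a v n + free_act q b v n"
    by (simp add: free_act_superset[of ?S] lookup_add distrib_right sum.distrib)
  finally show ?thesis .
qed

lemma free_act_single: "free_act q (Poly_Mapping.single w c) v n = c * word_act q w v n"
  by (subst free_act_superset[of "{w}"]) auto

lemma free_act_zero: "free_act q 0 v n = 0"
  by (simp add: free_act_def)

lemma free_act_lin:
  "free_act q p (\<lambda>n. u n + v n) = (\<lambda>n. free_act q p u n + free_act q p v n)"
  "free_act q p (\<lambda>n. c * v n) = (\<lambda>n. c * free_act q p v n)"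
  by (simp_all add: fun_eq_iff free_act_def word_act_lin distrib_left sum.distrib
      sum_distrib_left mult.left_commute)

lemma free_alg_induct [case_names zero single add]:
  fixes p :: "'a \<Rightarrow>\<^sub>0 'r::comm_ring_1"
  assumes "P 0" "\<And>w c. P (Poly_Mapping.single w c)" "\<And>a b. P a \<Longrightarrow> P b \<Longrightarrow> P (a + b)"
  shows "P p"
proof -
  have eq: "p = (\<Sum>w\<in>Poly_Mapping.keys p. Poly_Mapping.single w (Poly_Mapping.lookup p w))"
    by (rule poly_mapping_eqI)
      (auto simp: lookup_sum lookup_single when_def in_keys_iff)
  have "finite S \<Longrightarrow> P (\<Sum>w\<in>S. Poly_Mapping.single w (Poly_Mapping.lookup p w))" for S
    by (induction S rule: finite_induct) (auto intro: assms)
  thus ?thesis using eq by (metis finite_keys)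
qed

lemma free_act_mult: "free_act q (a * b) v = free_act q a (free_act q b v)"
proof (induction a rule: free_alg_induct)
  case (single w c)
  show ?case
  proof (induction b rule: free_alg_induct)
    case (single w' c')
    have "free_act q (Poly_Mapping.single w' c') v = (\<lambda>n. c' * word_act q w' v n)"
      by (simp add: fun_eq_iff free_act_single)
    thus ?case
      by (simp add: fun_eq_iff mult_single free_act_single word_act_plus word_act_lin mult.assoc)
  next
    case (add a b)
    have "free_act q (a + b) v = (\<lambda>n. free_act q a v n + free_act q b v n)"
      by (simp add: fun_eq_iff free_act_add)
    with add show ?case by (simp add: fun_eq_iff distrib_left free_act_add free_act_lin)
  next
    case zero
    have "free_act q 0 v = (\<lambda>n. 0 * v n)" by (simp add: fun_eq_iff free_act_zero)
    thus ?case by (simp only: free_act_lin) (simp add: fun_eq_iff free_act_zero)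
  qed
qed (simp_all add: fun_eq_iff distrib_right free_act_add free_act_zero)

lemma free_act_one: "free_act q 1 v = v"
  unfolding single_one[symmetric]
  by (simp add: fun_eq_iff free_act_single word_act_def zero_word_def)

lemma free_act_scalar: "free_act q (free_scalar c) v = (\<lambda>n. c * v n)"
  by (simp add: fun_eq_iff free_scalar_def free_act_single word_act_def zero_word_def)

lemma free_act_minus: "free_act q (- a) v n = - free_act q a v n"
  using free_act_add[of q a "- a" v n] by (simp add: free_act_zero add_eq_0_iff)

lemma weyl_ideal_act:
  assumes "a \<in> weyl_ideal q"
  shows "free_act q a v = (\<lambda>_. 0)"
proof -
  let ?K = "{a. \<forall>v. free_act q a v = (\<lambda>_. 0)}"
  have x: "free_act q free_x v = gen_act q GX v" for v
    by (simp add: fun_eq_iff free_x_def free_act_single word_act_def)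
  have y: "free_act q free_y v = gen_act q GY v" for v
    by (simp add: fun_eq_iff free_y_def free_act_single word_act_def)
  have zero: "free_act q b (\<lambda>_. 0) = (\<lambda>_. 0)" for b
    using free_act_lin(2)[of q b 0 "\<lambda>_. 0"] by simp
  have "ideal ?K ring_of_type_algebra"
  proof (rule type_idealI)
    fix a b :: "'a free_alg" assume "a \<in> ?K"
    hence "free_act q a v = (\<lambda>_. 0)" for v by simp
    thus "b * a \<in> ?K" "a * b \<in> ?K" by (simp_all add: free_act_mult zero)
  qed (auto simp: fun_eq_iff free_act_zero free_act_add)
  moreover have "free_scalar q * free_x * free_y - free_y * free_x - 1 \<in> ?K"
  proof safe
    fix v :: "nat \<Rightarrow> 'a"
    have "free_scalar q * free_x * free_y - free_y * free_x - (1 :: 'a free_alg) =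
        free_scalar q * free_x * free_y + (- (free_y * free_x)) + (- 1)" by simp
    thus "free_act q (free_scalar q * free_x * free_y - free_y * free_x - 1) v = (\<lambda>_. 0)"
      by (simp only: fun_eq_iff free_act_add free_act_minus free_act_mult free_act_one
          free_act_scalar x y) (auto simp: algebra_simps split: nat.splits)
  qed
  ultimately have "weyl_ideal q \<subseteq> ?K"
    unfolding weyl_ideal_def by (intro ring.genideal_minimal[OF ring_of_type]) auto
  thus ?thesis using assms by auto
qed

lemma one_notin_weyl_ideal: "1 \<notin> weyl_ideal q"
  using weyl_ideal_act[of 1 q "\<lambda>_. 1"] by (auto simp: free_act_one fun_eq_iff)

lemma minus_one_notin_weyl_ideal: "- 1 \<notin> weyl_ideal q"
  using one_notin_weyl_ideal[of q] weyl_ideal_minus[of "- 1" q] by auto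

lemma free_scalar_add: "free_scalar (a + b) = free_scalar a + free_scalar b"
  and free_scalar_mult: "free_scalar (a * b) = free_scalar a * free_scalar b"
  and free_scalar_one: "free_scalar 1 = 1"
  and free_scalar_zero: "free_scalar 0 = 0"
  by (simp_all add: free_scalar_def single_add mult_single)

lemma free_scalar_central: "free_scalar c * p = p * free_scalar c"
  by (induction p rule: free_alg_induct)
    (auto simp: free_scalar_def mult_single algebra_simps)

section \<open>The Weyl algebra and the q-Weyl algebra\<close>

quotient_type (overloaded) 'k weyl = "'k::comm_ring_1 free_alg" / "weyl_rel 1"
  by (rule equivp_weyl_rel)

instantiation weyl :: (comm_ring_1) ring_1
begin
lift_definition zero_weyl :: "'a weyl" is 0 .
lift_definition one_weyl :: "'a weyl" is 1 .
lift_definition plus_weyl :: "'a weyl \<Rightarrow> 'a weyl \<Rightarrow> 'a weyl" is "(+)" by (rule weyl_rel_add)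
lift_definition minus_weyl :: "'a weyl \<Rightarrow> 'a weyl \<Rightarrow> 'a weyl" is "(-)" by (rule weyl_rel_diff)
lift_definition uminus_weyl :: "'a weyl \<Rightarrow> 'a weyl" is uminus by (rule weyl_rel_uminus)
lift_definition times_weyl :: "'a weyl \<Rightarrow> 'a weyl \<Rightarrow> 'a weyl" is "(*)" by (rule weyl_rel_mult)
instance
  by (standard; transfer)
    (simp_all add: weyl_rel_def algebra_simps weyl_ideal_0 minus_one_notin_weyl_ideal)
end

definition weyl_scalar :: "'k::comm_ring_1 \<Rightarrow> 'k weyl" where
  "weyl_scalar c = abs_weyl (free_scalar c)"
lift_definition weyl_x :: "'k::comm_ring_1 weyl" is free_x .
lift_definition weyl_y :: "'k::comm_ring_1 weyl" is free_y .

lemma weyl_relation: "weyl_x * weyl_y - weyl_y * weyl_x = 1"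
  by transfer (use weyl_ideal_gen[of 1] in \<open>simp add: weyl_rel_def free_scalar_one\<close>)

text \<open>The ground ring is \<open>k[\<hbar>]\<close>, with \<open>q = 1 + \<hbar>\<close>.\<close>

quotient_type (overloaded) 'k qweyl = "'k::comm_ring_1 poly free_alg" / "weyl_rel [:1, 1:]"
  by (rule equivp_weyl_rel)

instantiation qweyl :: (comm_ring_1) ring_1
begin
lift_definition zero_qweyl :: "'a qweyl" is 0 .
lift_definition one_qweyl :: "'a qweyl" is 1 .
lift_definition plus_qweyl :: "'a qweyl \<Rightarrow> 'a qweyl \<Rightarrow> 'a qweyl" is "(+)" by (rule weyl_rel_add)
lift_definition minus_qweyl :: "'a qweyl \<Rightarrow> 'a qweyl \<Rightarrow> 'a qweyl" is "(-)" by (rule weyl_rel_diff)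
lift_definition uminus_qweyl :: "'a qweyl \<Rightarrow> 'a qweyl" is uminus by (rule weyl_rel_uminus)
lift_definition times_qweyl :: "'a qweyl \<Rightarrow> 'a qweyl \<Rightarrow> 'a qweyl" is "(*)" by (rule weyl_rel_mult)
instance
  by (standard; transfer)
    (simp_all add: weyl_rel_def algebra_simps weyl_ideal_0 minus_one_notin_weyl_ideal)
end

definition qweyl_scalar :: "'k::comm_ring_1 poly \<Rightarrow> 'k qweyl" where
  "qweyl_scalar c = abs_qweyl (free_scalar c)"
lift_definition qweyl_x :: "'k::comm_ring_1 qweyl" is free_x .
lift_definition qweyl_y :: "'k::comm_ring_1 qweyl" is free_y .

lemma qweyl_relation: "qweyl_scalar [:1, 1:] * qweyl_x * qweyl_y - qweyl_y * qweyl_x = 1"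
  unfolding qweyl_scalar_def qweyl_x_def qweyl_y_def one_qweyl_def times_qweyl.abs_eq
    minus_qweyl.abs_eq qweyl.abs_eq_iff weyl_rel_def
  by (rule weyl_ideal_gen)

lemma qweyl_scalar_add: "qweyl_scalar (a + b) = qweyl_scalar a + qweyl_scalar b"
  by (simp add: qweyl_scalar_def free_scalar_add plus_qweyl.abs_eq)

lemma qweyl_scalar_mult: "qweyl_scalar (a * b) = qweyl_scalar a * qweyl_scalar b"
  by (simp add: qweyl_scalar_def free_scalar_mult times_qweyl.abs_eq)

lemma qweyl_scalar_one: "qweyl_scalar 1 = 1"
  by (simp add: qweyl_scalar_def free_scalar_one one_qweyl_def)

lemma qweyl_scalar_central: "qweyl_scalar c * a = a * qweyl_scalar c"
  by (induction a rule: qweyl.abs_induct)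
    (simp add: qweyl_scalar_def times_qweyl.abs_eq free_scalar_central)

lifting_forget weyl.lifting
lifting_forget qweyl.lifting

section \<open>Formal power series over the Weyl algebra\<close>

text \<open>
  The type \<open>'k weyl fps\<close> carries the Cauchy product, so the series variable is central.
\<close>

definition weyl_fps_scalar :: "'k::comm_ring_1 fps \<Rightarrow> 'k weyl fps" where
  "weyl_fps_scalar s = Abs_fps (\<lambda>n. weyl_scalar (fps_nth s n))"

section \<open>The adic completion of the q-Weyl algebra\<close>

instance qweyl :: (comm_ring_1) Rings.dvd ..

definition hbar :: "'k::comm_ring_1 qweyl" where
  "hbar = qweyl_scalar [:0, 1:]"

definition hbar_null :: "(nat \<Rightarrow> 'k::comm_ring_1 qweyl) \<Rightarrow> bool" where
  "hbar_null s \<longleftrightarrow> (\<forall>N. \<exists>m. \<forall>i\<ge>m. hbar ^ N dvd s i)"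

definition hbar_Cauchy :: "(nat \<Rightarrow> 'k::comm_ring_1 qweyl) \<Rightarrow> bool" where
  "hbar_Cauchy s \<longleftrightarrow> (\<forall>N. \<exists>m. \<forall>i\<ge>m. \<forall>j\<ge>m. hbar ^ N dvd s i - s j)"

definition hbar_rel ::
  "(nat \<Rightarrow> 'k::comm_ring_1 qweyl) \<Rightarrow> (nat \<Rightarrow> 'k qweyl) \<Rightarrow> bool" where
  "hbar_rel s t \<longleftrightarrow> hbar_Cauchy s \<and> hbar_Cauchy t \<and> hbar_null (\<lambda>n. s n - t n)"

lemma hbar_power_central: "hbar ^ N * a = a * hbar ^ N"
proof (induction N)
  case (Suc N)
  have "hbar ^ Suc N * a = hbar * (hbar ^ N * a)" by (simp add: mult.assoc)
  also have "\<dots> = hbar * a * hbar ^ N" by (simp only: Suc mult.assoc)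
  also have "hbar * a = a * hbar" unfolding hbar_def by (rule qweyl_scalar_central)
  also have "\<dots> * hbar ^ N = a * hbar ^ Suc N" by (simp add: mult.assoc)
  finally show ?case .
qed simp

lemma hbar_dvd_add: "hbar ^ N dvd a \<Longrightarrow> hbar ^ N dvd b \<Longrightarrow> hbar ^ N dvd a + b"
  unfolding dvd_def by (elim exE) (simp flip: distrib_left, blast)

lemma hbar_dvd_minus: "hbar ^ N dvd a \<Longrightarrow> hbar ^ N dvd - a"
  unfolding dvd_def by (elim exE) (simp flip: mult_minus_right, blast)

lemma hbar_dvd_mult_left: "hbar ^ N dvd a \<Longrightarrow> hbar ^ N dvd b * a"
proof (elim dvdE)
  fix c assume "a = hbar ^ N * c"
  hence "b * a = hbar ^ N * (b * c)" by (simp add: hbar_power_central mult.assoc)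
  thus "hbar ^ N dvd b * a" by (simp only: dvd_def) blast
qed

lemma hbar_dvd_mult_right: "hbar ^ N dvd a \<Longrightarrow> hbar ^ N dvd a * b"
  unfolding dvd_def by (elim exE) (simp add: mult.assoc, blast)

lemma hbar_dvd_0: "hbar ^ N dvd (0 :: 'k::comm_ring_1 qweyl)"
  unfolding dvd_def by (rule exI[of _ 0]) simp

lemma hbar_not_dvd_1: "\<not> hbar ^ 1 dvd (1 :: 'k::comm_ring_1 qweyl)"
proof
  assume "hbar ^ 1 dvd (1 :: 'k qweyl)"
  then obtain c :: "'k qweyl" where c: "1 = hbar * c" by (auto simp: dvd_def)
  obtain d where d: "c = abs_qweyl d" by (induction c rule: qweyl.abs_induct) blast
  let ?q = "[:1, 1:] :: 'k poly"
  have "free_scalar [:0, 1:] * d - 1 \<in> weyl_ideal ?q"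
    using c[symmetric] by (simp add: d hbar_def qweyl_scalar_def one_qweyl_def times_qweyl.abs_eq
        qweyl.abs_eq_iff weyl_rel_def)
  from weyl_ideal_act[OF this, of "\<lambda>_. 1"]
  have "free_act ?q (free_scalar [:0, 1:] * d + - 1) (\<lambda>_. 1) 0 = 0" by simp
  hence "[:0, 1:] * free_act ?q d (\<lambda>_. 1) 0 - 1 = 0"
    by (simp only: free_act_add free_act_minus free_act_mult free_act_one free_act_scalar) simp
  from arg_cong[OF this, of "\<lambda>p. poly p 0"] show False by simp
qed

lemma hbar_null_add: "hbar_null s \<Longrightarrow> hbar_null t \<Longrightarrow> hbar_null (\<lambda>n. s n + t n)"
  unfolding hbar_null_def
proof
  fix N
  assume "\<forall>N. \<exists>m. \<forall>i\<ge>m. hbar ^ N dvd s i" "\<forall>N. \<exists>m. \<forall>i\<ge>m. hbar ^ N dvd t i"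
  then obtain m1 m2 where "\<forall>i\<ge>m1. hbar ^ N dvd s i" "\<forall>i\<ge>m2. hbar ^ N dvd t i"
    by blast
  hence "\<forall>i\<ge>max m1 m2. hbar ^ N dvd s i + t i" by (simp add: hbar_dvd_add)
  thus "\<exists>m. \<forall>i\<ge>m. hbar ^ N dvd s i + t i" ..
qed

lemma hbar_null_minus: "hbar_null s \<Longrightarrow> hbar_null (\<lambda>n. - s n)"
  unfolding hbar_null_def by (blast intro: hbar_dvd_minus)

lemma hbar_null_mult_left: "hbar_null s \<Longrightarrow> hbar_null (\<lambda>n. t n * s n)"
  unfolding hbar_null_def by (blast intro: hbar_dvd_mult_left)

lemma hbar_null_mult_right: "hbar_null s \<Longrightarrow> hbar_null (\<lambda>n. s n * t n)"
  unfolding hbar_null_def by (blast intro: hbar_dvd_mult_right)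

lemma hbar_null_0: "hbar_null (\<lambda>n. 0)"
  by (simp add: hbar_null_def hbar_dvd_0)

lemma hbar_Cauchy_const: "hbar_Cauchy (\<lambda>n. a)"
  by (simp add: hbar_Cauchy_def hbar_dvd_0)

lemma hbar_Cauchy_add:
  assumes "hbar_Cauchy s" "hbar_Cauchy t"
  shows "hbar_Cauchy (\<lambda>n. s n + t n)"
  unfolding hbar_Cauchy_def
proof
  fix N
  obtain m1 m2 where m: "\<forall>i\<ge>m1. \<forall>j\<ge>m1. hbar ^ N dvd s i - s j"
    "\<forall>i\<ge>m2. \<forall>j\<ge>m2. hbar ^ N dvd t i - t j"
    using assms unfolding hbar_Cauchy_def by blast
  have "hbar ^ N dvd s i + t i - (s j + t j)" if "i \<ge> max m1 m2" "j \<ge> max m1 m2" for i j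
    using hbar_dvd_add[of N "s i - s j" "t i - t j"] m that by (simp add: algebra_simps)
  thus "\<exists>m. \<forall>i\<ge>m. \<forall>j\<ge>m. hbar ^ N dvd s i + t i - (s j + t j)" by blast
qed

lemma hbar_Cauchy_minus: "hbar_Cauchy s \<Longrightarrow> hbar_Cauchy (\<lambda>n. - s n)"
  unfolding hbar_Cauchy_def minus_diff_minus by (blast intro: hbar_dvd_minus)

lemma hbar_Cauchy_mult:
  assumes "hbar_Cauchy s" "hbar_Cauchy t"
  shows "hbar_Cauchy (\<lambda>n. s n * t n)"
  unfolding hbar_Cauchy_def
proof
  fix N
  obtain m1 m2 where m: "\<forall>i\<ge>m1. \<forall>j\<ge>m1. hbar ^ N dvd s i - s j"
    "\<forall>i\<ge>m2. \<forall>j\<ge>m2. hbar ^ N dvd t i - t j"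
    using assms unfolding hbar_Cauchy_def by blast
  have "hbar ^ N dvd s i * t i - s j * t j" if "i \<ge> max m1 m2" "j \<ge> max m1 m2" for i j
  proof -
    have "hbar ^ N dvd (s i - s j) * t i + s j * (t i - t j)"
      using m that by (intro hbar_dvd_add hbar_dvd_mult_left hbar_dvd_mult_right) auto
    thus ?thesis by (simp add: algebra_simps)
  qed
  thus "\<exists>m. \<forall>i\<ge>m. \<forall>j\<ge>m. hbar ^ N dvd s i * t i - s j * t j" by blast
qed

lemma hbar_rel_refl: "hbar_Cauchy s \<Longrightarrow> hbar_rel s s"
  by (simp add: hbar_rel_def hbar_null_0)

lemma part_equivp_hbar_rel:
  "part_equivp (hbar_rel :: (nat \<Rightarrow> 'a::comm_ring_1 qweyl) \<Rightarrow> _)"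
proof (rule part_equivpI)
  show "\<exists>s :: nat \<Rightarrow> 'a qweyl. hbar_rel s s"
    using hbar_rel_refl[OF hbar_Cauchy_const] by blast
  show "symp (hbar_rel :: (nat \<Rightarrow> 'a qweyl) \<Rightarrow> _)"
  proof (rule sympI)
    fix s t :: "nat \<Rightarrow> 'a qweyl" assume "hbar_rel s t"
    thus "hbar_rel t s" unfolding hbar_rel_def using hbar_null_minus[of "\<lambda>n. s n - t n"] by simp
  qed
  show "transp (hbar_rel :: (nat \<Rightarrow> 'a qweyl) \<Rightarrow> _)"
  proof (rule transpI)
    fix s t u :: "nat \<Rightarrow> 'a qweyl" assume "hbar_rel s t" "hbar_rel t u"
    thus "hbar_rel s u" unfolding hbar_rel_def
      using hbar_null_add[of "\<lambda>n. s n - t n" "\<lambda>n. t n - u n"] by simp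
  qed
qed

quotient_type (overloaded) 'k qweyl_hat = "nat \<Rightarrow> 'k::comm_ring_1 qweyl" / partial: hbar_rel
  by (rule part_equivp_hbar_rel)

instantiation qweyl_hat :: (comm_ring_1) ring_1
begin
lift_definition zero_qweyl_hat :: "'a qweyl_hat" is "\<lambda>_. 0"
  by (intro hbar_rel_refl hbar_Cauchy_const)
lift_definition one_qweyl_hat :: "'a qweyl_hat" is "\<lambda>_. 1"
  by (intro hbar_rel_refl hbar_Cauchy_const)
lift_definition plus_qweyl_hat :: "'a qweyl_hat \<Rightarrow> 'a qweyl_hat \<Rightarrow> 'a qweyl_hat"
  is "\<lambda>s t n. s n + t n"
  unfolding hbar_rel_def add_diff_add by (simp add: hbar_Cauchy_add hbar_null_add)
lift_definition uminus_qweyl_hat :: "'a qweyl_hat \<Rightarrow> 'a qweyl_hat" is "\<lambda>s n. - s n"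
  unfolding hbar_rel_def
  by (simp only: minus_diff_minus hbar_Cauchy_minus hbar_null_minus simp_thms)
lift_definition times_qweyl_hat :: "'a qweyl_hat \<Rightarrow> 'a qweyl_hat \<Rightarrow> 'a qweyl_hat"
  is "\<lambda>s t n. s n * t n"
  unfolding hbar_rel_def mult_diff_mult
  by (simp add: hbar_Cauchy_mult hbar_null_add hbar_null_mult_left hbar_null_mult_right)
definition minus_qweyl_hat :: "'a qweyl_hat \<Rightarrow> 'a qweyl_hat \<Rightarrow> 'a qweyl_hat" where
  "minus_qweyl_hat a b = a + - b"
instance
proof
  fix a b c :: "'a qweyl_hat"
  show "a + b + c = a + (b + c)"
    by transfer (simp add: algebra_simps hbar_rel_def hbar_Cauchy_add hbar_null_0)
  show "a + b = b + a"
    by transfer (simp add: algebra_simps hbar_rel_def hbar_Cauchy_add hbar_null_0)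
  show "0 + a = a"
    by transfer (simp add: hbar_rel_def hbar_null_0)
  show "- a + a = 0"
    by transfer (simp add: hbar_rel_def hbar_null_0 hbar_Cauchy_const)
  show "a - b = a + - b"
    by (simp add: minus_qweyl_hat_def)
  show "a * b * c = a * (b * c)"
    by transfer (simp add: mult.assoc hbar_rel_def hbar_Cauchy_mult hbar_null_0)
  show "1 * a = a" "a * 1 = a"
    by (transfer; simp add: hbar_rel_def hbar_null_0)+
  show "(a + b) * c = a * c + b * c"
    by transfer (simp add: distrib_right hbar_rel_def hbar_Cauchy_mult hbar_Cauchy_add hbar_null_0)
  show "a * (b + c) = a * b + a * c"
    by transfer (simp add: distrib_left hbar_rel_def hbar_Cauchy_mult hbar_Cauchy_add hbar_null_0)
  show "(0 :: 'a qweyl_hat) \<noteq> 1"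
  proof (transfer, rule notI)
    assume "hbar_rel (\<lambda>_. 0) (\<lambda>_. 1 :: 'a qweyl)"
    hence "hbar ^ 1 dvd (0 - 1 :: 'a qweyl)"
      unfolding hbar_rel_def hbar_null_def by blast
    from hbar_dvd_minus[OF this] show False using hbar_not_dvd_1[where 'k = 'a] by simp
  qed
qed
end

definition to_hat :: "'k::comm_ring_1 qweyl \<Rightarrow> 'k qweyl_hat" where
  "to_hat a = abs_qweyl_hat (\<lambda>_. a)"

text \<open>A power series in \<open>\<hbar>\<close> acts as the limit of its truncations, which are polynomials.\<close>

definition qweyl_hat_scalar :: "'k::comm_ring_1 fps \<Rightarrow> 'k qweyl_hat" where
  "qweyl_hat_scalar s =
     abs_qweyl_hat (\<lambda>n. qweyl_scalar (Poly (map (fps_nth s) [0..<n])))"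

section \<open>Isomorphisms of algebras\<close>

definition algebra_iso ::
  "('r \<Rightarrow> 'a::ring_1) \<Rightarrow> ('r \<Rightarrow> 'b::ring_1) \<Rightarrow> ('a \<Rightarrow> 'b) \<Rightarrow> bool" where
  "algebra_iso \<eta> \<theta> \<phi> \<longleftrightarrow>
     \<phi> \<in> ring_iso ring_of_type_algebra ring_of_type_algebra \<and> (\<forall>r. \<phi> (\<eta> r) = \<theta> r)"

section \<open>Hochschild cohomology\<close>

text \<open>
  A function on lists encodes an element of the direct sum of all cochain groups: its
  restriction to the lists of length \<open>n\<close> is the component of degree \<open>n\<close>, a function of \<open>n\<close>
  arguments that is multilinear over the ground ring.
\<close>

definition cochains :: "('r \<Rightarrow> 'a::ring_1) \<Rightarrow> ('a list \<Rightarrow> 'a) set" where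
  "cochains \<eta> = {f.
     (\<exists>N. \<forall>xs. length xs > N \<longrightarrow> f xs = 0) \<and>
     (\<forall>us vs a b. f (us @ (a + b) # vs) = f (us @ a # vs) + f (us @ b # vs)) \<and>
     (\<forall>us vs r a. f (us @ (\<eta> r * a) # vs) = \<eta> r * f (us @ a # vs))}"

definition homogeneous :: "nat \<Rightarrow> ('a list \<Rightarrow> 'a::ring_1) \<Rightarrow> bool" where
  "homogeneous n f \<longleftrightarrow> (\<forall>xs. length xs \<noteq> n \<longrightarrow> f xs = 0)"

definition coboundary :: "('a list \<Rightarrow> 'a) \<Rightarrow> 'a list \<Rightarrow> 'a::ring_1" where
  "coboundary f xs =
     (if xs = [] then 0
      else hd xs * f (tl xs)
         + (\<Sum>i<length xs - 1. (- 1) ^ (i + 1) *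
              f (take i xs @ (xs ! i * xs ! (i + 1)) # drop (i + 2) xs))
         + (- 1) ^ length xs * (f (butlast xs) * last xs))"

definition cup :: "('a list \<Rightarrow> 'a) \<Rightarrow> ('a list \<Rightarrow> 'a) \<Rightarrow> 'a list \<Rightarrow> 'a::ring_1" where
  "cup f g xs = (\<Sum>i\<le>length xs. f (take i xs) * g (drop i xs))"

definition const_cochain :: "'a \<Rightarrow> 'a list \<Rightarrow> 'a::ring_1" where
  "const_cochain a xs = (if xs = [] then a else 0)"

definition cocycle_ring :: "('r \<Rightarrow> 'a::ring_1) \<Rightarrow> ('a list \<Rightarrow> 'a) ring" where
  "cocycle_ring \<eta> =
     \<lparr>carrier = {f \<in> cochains \<eta>. coboundary f = (\<lambda>_. 0)},
      monoid.mult = cup, one = const_cochain 1,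
      ring.zero = (\<lambda>_. 0), add = (\<lambda>f g xs. f xs + g xs)\<rparr>"

definition coboundaries :: "('r \<Rightarrow> 'a::ring_1) \<Rightarrow> ('a list \<Rightarrow> 'a) set" where
  "coboundaries \<eta> = coboundary ` cochains \<eta>"

text \<open>
  The coboundary map is homogeneous of degree 1, so this quotient is the direct sum of the groups
  \<open>H\<^sup>n\<close>, and the classes of homogeneous cocycles of degree \<open>n\<close> form the summand \<open>H\<^sup>n\<close>.
\<close>

definition HH :: "('r \<Rightarrow> 'a::ring_1) \<Rightarrow> ('a list \<Rightarrow> 'a) set ring" where
  "HH \<eta> = cocycle_ring \<eta> Quot coboundaries \<eta>"

definition HH_class :: "('r \<Rightarrow> 'a::ring_1) \<Rightarrow> ('a list \<Rightarrow> 'a) \<Rightarrow> ('a list \<Rightarrow> 'a) set" where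
  "HH_class \<eta> f = coboundaries \<eta> +>\<^bsub>cocycle_ring \<eta>\<^esub> f"

definition HH_deg :: "('r \<Rightarrow> 'a::ring_1) \<Rightarrow> nat \<Rightarrow> ('a list \<Rightarrow> 'a) set set" where
  "HH_deg \<eta> n = HH_class \<eta> ` {f \<in> carrier (cocycle_ring \<eta>). homogeneous n f}"

definition HH_scalar :: "('r \<Rightarrow> 'a::ring_1) \<Rightarrow> 'r \<Rightarrow> ('a list \<Rightarrow> 'a) set" where
  "HH_scalar \<eta> r = HH_class \<eta> (const_cochain (\<eta> r))"

section \<open>Fragile classes and resilient cohomology\<close>

text \<open>
  The continuous extension of a multilinear cochain to the completion: it is applied termwise to
  Cauchy sequences representing the arguments, and multilinearity makes the result independent of
  their choice.
\<close>

definition extend_cochain ::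
  "('k::comm_ring_1 qweyl list \<Rightarrow> 'k qweyl) \<Rightarrow> 'k qweyl_hat list \<Rightarrow> 'k qweyl_hat" where
  "extend_cochain f xs = abs_qweyl_hat (\<lambda>n. f (map (\<lambda>x. rep_qweyl_hat x n) xs))"

lemma extend_cochain_abs:
  fixes f :: "'a::comm_ring_1 qweyl list \<Rightarrow> 'a qweyl"
  assumes f: "f \<in> cochains qweyl_scalar" and ss: "\<forall>s\<in>set ss. hbar_Cauchy s"
  shows "extend_cochain f (map abs_qweyl_hat ss) = abs_qweyl_hat (\<lambda>n. f (map (\<lambda>s. s n) ss))"
proof -
  have mult: "hbar ^ N = qweyl_scalar ([:0, 1:] ^ N)" for N
    by (induction N) (simp_all add: hbar_def qweyl_scalar_one qweyl_scalar_mult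
        del: mult_pCons_left)
  have step: "hbar ^ N dvd f (us @ a # vs) - f (us @ b # vs)" if dvd: "hbar ^ N dvd a - b"
    for us vs a b N
  proof -
    obtain c where "a = b + hbar ^ N * c"
      using dvd by (auto simp: dvd_def algebra_simps)
    hence "f (us @ a # vs) - f (us @ b # vs) = hbar ^ N * f (us @ c # vs)"
      using f by (simp add: cochains_def mult)
    thus ?thesis unfolding dvd_def by blast
  qed
  have close: "hbar ^ N dvd f (us @ xs) - f (us @ ys)"
    if "list_all2 (\<lambda>x y. hbar ^ N dvd x - y) xs ys" for us xs ys N
    using that
  proof (induction arbitrary: us rule: list_all2_induct)
    case Nil
    show ?case by (simp add: hbar_dvd_0)
  next
    case (Cons x xs y ys)
    have "hbar ^ N dvd (f (us @ x # xs) - f (us @ y # xs)) + (f ((us @ [y]) @ xs) - f ((us @ [y]) @ ys))"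
      by (intro hbar_dvd_add step Cons)
    thus ?case by simp
  qed
  have close0: "hbar ^ N dvd f xs - f ys" if "list_all2 (\<lambda>x y. hbar ^ N dvd x - y) xs ys" for xs ys N
    using close[OF that, of "[]"] by simp
  have ev: "\<exists>m. \<forall>i\<ge>m. \<forall>j\<ge>m. list_all2 (\<lambda>x y. hbar ^ N dvd x - y) (map (\<lambda>s. u s i) ts) (map (\<lambda>s. v s j) ts)"
    if "\<forall>s\<in>set ts. \<exists>m. \<forall>i\<ge>m. \<forall>j\<ge>m. hbar ^ N dvd u s i - v s j"
    for N ts and u v :: "(nat \<Rightarrow> 'a qweyl) \<Rightarrow> nat \<Rightarrow> 'a qweyl"
    using that
  proof (induction ts)
    case (Cons t ts)
    obtain m1 where "\<forall>i\<ge>m1. \<forall>j\<ge>m1. list_all2 (\<lambda>x y. hbar ^ N dvd x - y)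
        (map (\<lambda>s. u s i) ts) (map (\<lambda>s. v s j) ts)"
      using Cons by auto
    moreover obtain m2 where "\<forall>i\<ge>m2. \<forall>j\<ge>m2. hbar ^ N dvd u t i - v t j"
      using Cons.prems by auto
    ultimately show ?case by (intro exI[of _ "max m1 m2"]) simp
  qed simp
  let ?r = "\<lambda>s. rep_qweyl_hat (abs_qweyl_hat s)"
  have r: "hbar_rel (?r s) s" if "s \<in> set ss" for s
  proof -
    have "hbar_Cauchy s" using ss that by blast
    thus ?thesis using Quotient3_rep_abs[OF Quotient3_qweyl_hat] hbar_rel_refl by blast
  qed
  have cross: "\<exists>m. \<forall>i\<ge>m. \<forall>j\<ge>m. hbar ^ N dvd u i - v j" if "hbar_rel u v" for u v :: "nat \<Rightarrow> 'a qweyl" and N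
  proof -
    from that obtain m1 m2 where "\<forall>i\<ge>m1. hbar ^ N dvd u i - v i"
      "\<forall>i\<ge>m2. \<forall>j\<ge>m2. hbar ^ N dvd v i - v j"
      unfolding hbar_rel_def hbar_null_def hbar_Cauchy_def by blast
    hence "hbar ^ N dvd (u i - v i) + (v i - v j)" if "i \<ge> max m1 m2" "j \<ge> max m1 m2" for i j
      using that by (intro hbar_dvd_add) auto
    thus ?thesis by (intro exI[of _ "max m1 m2"]) simp
  qed
  have C: "hbar_Cauchy (\<lambda>n. f (map (\<lambda>s. u s n) ss))" if u: "\<And>s. s \<in> set ss \<Longrightarrow> hbar_Cauchy (u s)" for u
    unfolding hbar_Cauchy_def
  proof
    fix N
    have "\<forall>s\<in>set ss. \<exists>m. \<forall>i\<ge>m. \<forall>j\<ge>m. hbar ^ N dvd u s i - u s j"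
      using u unfolding hbar_Cauchy_def by blast
    from ev[OF this] show "\<exists>m. \<forall>i\<ge>m. \<forall>j\<ge>m. hbar ^ N dvd f (map (\<lambda>s. u s i) ss) - f (map (\<lambda>s. u s j) ss)"
      using close0 by blast
  qed
  have "hbar_null (\<lambda>n. f (map (\<lambda>s. ?r s n) ss) - f (map (\<lambda>s. s n) ss))"
    unfolding hbar_null_def
  proof
    fix N
    have "\<forall>s\<in>set ss. \<exists>m. \<forall>i\<ge>m. \<forall>j\<ge>m. hbar ^ N dvd ?r s i - s j"
      using cross r by blast
    from ev[OF this] show "\<exists>m. \<forall>i\<ge>m. hbar ^ N dvd f (map (\<lambda>s. ?r s i) ss) - f (map (\<lambda>s. s i) ss)"
      using close0 by blast
  qed
  moreover have "hbar_Cauchy (\<lambda>n. f (map (\<lambda>s. ?r s n) ss))"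
    by (rule C) (use r in \<open>auto simp: hbar_rel_def\<close>)
  moreover have "hbar_Cauchy (\<lambda>n. f (map (\<lambda>s. s n) ss))"
    by (rule C) (use ss in auto)
  ultimately have "hbar_rel (\<lambda>n. f (map (\<lambda>s. ?r s n) ss)) (\<lambda>n. f (map (\<lambda>s. s n) ss))"
    by (simp add: hbar_rel_def)
  thus ?thesis
    using Quotient3_rel_abs[OF Quotient3_qweyl_hat] by (simp add: extend_cochain_def o_def)
qed

lemma extend_cochain_to_hat:
  assumes "f \<in> cochains qweyl_scalar"
  shows "extend_cochain f (map to_hat xs) = to_hat (f xs)"
  using extend_cochain_abs[OF assms, of "map (\<lambda>a _. a) xs"]
  by (simp add: to_hat_def[abs_def] o_def hbar_Cauchy_const)

text \<open>The map on cohomology classes (cosets of cocycles) induced by extending cochains.\<close>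

definition HH_extend ::
  "('k::comm_ring_1 qweyl list \<Rightarrow> 'k qweyl) set \<Rightarrow> ('k qweyl_hat list \<Rightarrow> 'k qweyl_hat) set" where
  "HH_extend c = (\<Union>f\<in>c. HH_class qweyl_hat_scalar (extend_cochain f))"

definition fragile :: "('k::comm_ring_1 qweyl list \<Rightarrow> 'k qweyl) set set" where
  "fragile = {c \<in> carrier (HH qweyl_scalar).
     \<exists>m. HH_scalar qweyl_hat_scalar (fps_X ^ m) \<otimes>\<^bsub>HH qweyl_hat_scalar\<^esub> HH_extend c
       = \<zero>\<^bsub>HH qweyl_hat_scalar\<^esub>}"

definition resilient :: "('k::comm_ring_1 qweyl list \<Rightarrow> 'k qweyl) set set ring" where
  "resilient = HH qweyl_scalar Quot fragile"

definition resilient_scalar :: "'k::comm_ring_1 poly \<Rightarrow> ('k qweyl list \<Rightarrow> 'k qweyl) set set" where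
  "resilient_scalar r = fragile +>\<^bsub>HH qweyl_scalar\<^esub> HH_scalar qweyl_scalar r"

end

theory Submission
  imports Defs
begin

text \<open>
  With \<open>q = 1 + \<hbar>\<close>, the \<open>q\<close>-difference operator expands as a power series in \<open>\<hbar>\<close> with
  coefficients in \<open>W\<^sub>1\<close>; sending \<open>y\<close> to (minus) this series embeds \<open>W\<^sub>q\<close> into \<open>W\<^sub>1[[\<hbar>]]\<close>. Modulo \<open>\<hbar>\<close> it is the
  reduction \<open>W\<^sub>q \<rightarrow> W\<^sub>1\<close>, whose kernel is \<open>\<hbar> W\<^sub>q\<close> by the monomial bases, so it becomes an isomorphism
  on completions.

  For the vanishing, a cocycle on \<open>W\<^sub>1\<close> is a derivation of its first argument into cochains, hence
  it is zero once it is normalised and vanishes when the first argument is \<open>x\<close> or \<open>y\<close>. Coboundaries,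
  defined by recursion on the basis \<open>x\<^sup>i y\<^sup>j\<close> in the first argument, achieve this first for \<open>x\<close> and
  then for \<open>y\<close>. This step needs characteristic zero for the solvability of \<open>[x, r] = u\<close> in \<open>W\<^sub>1\<close>, and
  of \<open>[y, g] = u\<close> within the centralizer of \<open>x\<close>. As cochains over \<open>k[[\<hbar>]]\<close> are determined by their
  coefficients on \<open>W\<^sub>1\<close>, the vanishing passes to \<open>W\<^sub>1[[\<hbar>]]\<close>.

  Consequently a class of \<open>W\<^sub>q\<close> is fragile exactly if its component in degree zero vanishes, and that
  component is a central element of \<open>W\<^sub>q\<close>, i.e. a scalar.
\<close>

text \<open>The bar complex is used as it stands, without a smaller resolution. Functions on lists
  hold all degrees at once, so there is no induction on the degree: a primitive is written down for
  a whole cochain, with the first argument expanded in the basis and the other arguments carried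
  along as parameters.

  The obstacle is the second generator. Once a cocycle f vanishes at x, only cochains g whose
  coboundary also vanishes at x may be used. With g (x, ...) = 0 this forces g (x b, ...) = x g (b,
  ...), so only the values at the powers of y are free, while F = f (y, ...) has to be matched at
  every monomial. The way out is the choice of r = g (y, ...): its commutator with x is prescribed
  to be - F (x, ...). Then F and the corresponding part of the coboundary of g agree at x and at all
  powers of y, and as their difference commutes with x, they agree at every monomial.\<close>

section \<open>The Hochschild complex\<close>

text \<open>
  A cocycle \<open>f\<close> of degree \<open>n + 1\<close> is a derivation \<open>a \<mapsto> f (a # _)\<close> into the cochains of degree \<open>n\<close>,
  made a bimodule by \<open>(a \<cdot> f) bs = a * f bs\<close> and \<open>(f \<cdot> a) bs = rmul f (a # bs)\<close>. Under this view the
  Hochschild differential of a cochain \<open>f\<close> is the inner derivation \<open>a \<mapsto> a \<cdot> f - f \<cdot> a\<close>.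
\<close>

fun rmul :: "('a list \<Rightarrow> 'a) \<Rightarrow> 'a list \<Rightarrow> 'a::ring_1" where
  "rmul f [] = 0"
| "rmul f [a] = f [] * a"
| "rmul f (a # b # cs) = f ((a * b) # cs) - rmul (\<lambda>xs. f (a # xs)) (b # cs)"

lemma coboundary_Nil [simp]: "coboundary f [] = 0"
  by (simp add: coboundary_def)

lemma coboundary_Cons: "coboundary f (a # bs) = a * f bs - rmul f (a # bs)"
proof -
  have "rmul f (a # bs) = - ((\<Sum>i<length bs. (- 1) ^ (i + 1) *
              f (take i (a # bs) @ ((a # bs) ! i * (a # bs) ! (i + 1)) # drop (i + 2) (a # bs)))
         + (- 1) ^ length (a # bs) * (f (butlast (a # bs)) * last (a # bs)))"
  proof (induction bs arbitrary: f a)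
    case (Cons b cs)
    show ?case
      by (simp add: Cons.IH sum.lessThan_Suc_shift sum_negf algebra_simps del: sum.lessThan_Suc)
  qed simp
  thus ?thesis by (simp add: coboundary_def algebra_simps)
qed

lemma rmul_add: "rmul (\<lambda>xs. f xs + g xs) xs = rmul f xs + rmul g xs"
  by (induction xs arbitrary: f g rule: induct_list012) (simp_all add: algebra_simps)

lemma rmul_lmult: "rmul (\<lambda>xs. c * f xs) xs = c * rmul f xs"
  by (induction xs arbitrary: f rule: induct_list012) (simp_all add: algebra_simps)

lemma rmul_uminus: "rmul (\<lambda>xs. - f xs) xs = - rmul f xs"
  using rmul_lmult[of "- 1" f xs] by simp

lemma rmul_diff: "rmul (\<lambda>xs. f xs - g xs) xs = rmul f xs - rmul g xs"
  using rmul_add[of f "\<lambda>xs. - g xs" xs] by (simp add: rmul_uminus)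

lemma rmul_0 [simp]: "rmul (\<lambda>_. 0) xs = 0"
  using rmul_lmult[of 0 "\<lambda>_. 0" xs] by simp

text \<open>The right action is associative. This, its linearity and its commuting with left
  multiplication are what the vanishing of the square of the differential rests on.\<close>

lemma rmul_rmul: "rmul (\<lambda>bs. rmul f (a # bs)) (b # cs) = rmul f ((a * b) # cs)"
proof (induction cs arbitrary: f a b)
  case (Cons c ds)
  have "rmul (\<lambda>bs. rmul f (a # bs)) (b # c # ds) = rmul f (a # (b * c) # ds)
      - rmul (\<lambda>xs. f ((a * b) # xs) - rmul (\<lambda>xs. f (a # xs)) (b # xs)) (c # ds)"
    by simp
  also have "\<dots> = rmul f ((a * b) # c # ds)"
    by (simp only: rmul_diff Cons.IH) (simp add: mult.assoc)
  finally show ?case .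
qed (simp add: mult.assoc)

lemma coboundary_add: "coboundary (\<lambda>xs. f xs + g xs) xs = coboundary f xs + coboundary g xs"
  by (cases xs) (simp_all add: coboundary_Cons rmul_add algebra_simps)

lemma coboundary_uminus: "coboundary (\<lambda>xs. - f xs) xs = - coboundary f xs"
  by (cases xs) (simp_all add: coboundary_Cons rmul_uminus)

lemma coboundary_diff: "coboundary (\<lambda>xs. f xs - g xs) xs = coboundary f xs - coboundary g xs"
  by (cases xs) (simp_all add: coboundary_Cons rmul_diff algebra_simps)

lemma coboundary_0 [simp]: "coboundary (\<lambda>_. 0) = (\<lambda>_. 0)"
proof
  show "coboundary (\<lambda>_. 0) xs = 0" for xs :: "'a list"
    by (cases xs) (simp_all add: coboundary_Cons)
qed

text \<open>This is the Leibniz rule for the inner derivation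
  \<open>a \<mapsto> a \<cdot> f - f \<cdot> a\<close>; the two occurrences of
  \<open>a \<cdot> f \<cdot> b\<close> in it cancel.\<close>

lemma coboundary_coboundary [simp]: "coboundary (coboundary f) = (\<lambda>_. 0)"
proof
  fix xs :: "'a list"
  show "coboundary (coboundary f) xs = 0"
  proof (induction xs rule: induct_list012)
    case (3 a b cs)
    have "coboundary (coboundary f) (a # b # cs) = a * (b * f cs - rmul f (b # cs))
        - ((a * b) * f cs - rmul f ((a * b) # cs)
            - rmul (\<lambda>xs. a * f xs - rmul f (a # xs)) (b # cs))"
      by (simp add: coboundary_Cons)
    also have "\<dots> = 0"
      by (simp only: rmul_diff rmul_lmult rmul_rmul) (simp add: algebra_simps)
    finally show ?case .
  qed (simp_all add: coboundary_Cons)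
qed

lemma cocycle_mult:
  assumes "coboundary f = (\<lambda>_. 0)"
  shows "f ((a * b) # cs) = a * f (b # cs) + rmul (\<lambda>xs. f (a # xs)) (b # cs)"
  using fun_cong[OF assms, of "a # b # cs"] by (simp add: coboundary_Cons algebra_simps)

section \<open>The cup product and the graded Leibniz rule\<close>

lemma cup_Nil [simp]: "cup f g [] = f [] * g []"
  by (simp add: cup_def)

lemma cup_Cons [simp]: "cup f g (a # as) = f [] * g (a # as) + cup (\<lambda>xs. f (a # xs)) g as"
  by (simp add: cup_def sum.atMost_Suc_shift del: sum.atMost_Suc)

lemma cup_add_left: "cup (\<lambda>xs. f xs + g xs) h xs = cup f h xs + cup g h xs"
  by (induction xs arbitrary: f g) (simp_all add: algebra_simps)

lemma cup_add_right: "cup f (\<lambda>xs. g xs + h xs) xs = cup f g xs + cup f h xs"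
  by (induction xs arbitrary: f) (simp_all add: algebra_simps)

lemma cup_lmult: "cup (\<lambda>xs. c * f xs) g xs = c * cup f g xs"
  by (induction xs arbitrary: f) (simp_all add: algebra_simps)

lemma cup_uminus_left: "cup (\<lambda>xs. - f xs) h xs = - cup f h xs"
  using cup_lmult[of "- 1" f h xs] by simp

lemma cup_diff_left: "cup (\<lambda>xs. f xs - g xs) h xs = cup f h xs - cup g h xs"
  using cup_add_left[of f "\<lambda>xs. - g xs" h xs] by (simp add: cup_uminus_left)

lemma cup_0_left [simp]: "cup (\<lambda>_. 0) g = (\<lambda>_. 0)"
  using cup_lmult[of 0 "\<lambda>_. 0" g] by fastforce

lemma cup_0_right [simp]: "cup g (\<lambda>_. 0) = (\<lambda>_. 0)"
proof
  show "cup g (\<lambda>_. 0) xs = 0" for xs by (induction xs arbitrary: g) simp_all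
qed

lemma cup_assoc: "cup (cup f g) h xs = cup f (cup g h) xs"
proof (induction xs arbitrary: f g)
  case (Cons a as)
  have "cup (cup f g) h (a # as) = f [] * g [] * h (a # as)
      + cup (\<lambda>xs. f [] * g (a # xs) + cup (\<lambda>xs. f (a # xs)) g xs) h as"
    by simp
  also have "\<dots> = cup f (cup g h) (a # as)"
    by (simp only: cup_add_left cup_lmult Cons.IH) (simp add: algebra_simps)
  finally show ?case .
qed (simp add: mult.assoc)

lemma cup_one_left [simp]: "cup (const_cochain 1) f = f"
proof
  show "cup (const_cochain 1) f xs = f xs" for xs
    by (cases xs) (simp_all add: const_cochain_def)
qed

lemma cup_one_right [simp]: "cup f (const_cochain 1) = f"
proof
  show "cup f (const_cochain 1) xs = f xs" for xs
    by (induction xs arbitrary: f) (simp_all add: const_cochain_def)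
qed

text \<open>The sign of the graded Leibniz rule. A cochain mixes all degrees here, so the sign
  cannot be a number; it is an operator that reads the degree off the list.\<close>

definition parity_twist :: "('a list \<Rightarrow> 'a) \<Rightarrow> 'a list \<Rightarrow> 'a::ring_1" where
  "parity_twist f xs = (- 1) ^ length xs * f xs"

lemma parity_twist_Nil [simp]: "parity_twist f [] = f []"
  by (simp add: parity_twist_def)

lemma parity_twist_Cons: "parity_twist f (a # xs) = - parity_twist (\<lambda>xs. f (a # xs)) xs"
  by (simp add: parity_twist_def)

lemma parity_twist_twice [simp]: "parity_twist (parity_twist f) = f"
proof
  show "parity_twist (parity_twist f) xs = f xs" for xs
    by (cases "even (length xs)") (simp_all add: parity_twist_def)
qed

lemma rmul_parity_twist: "rmul (parity_twist f) xs = - parity_twist (rmul f) xs"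
proof (induction xs arbitrary: f rule: induct_list012)
  case (3 a b cs)
  have "rmul (parity_twist f) (a # b # cs) = parity_twist f ((a * b) # cs)
      - rmul (\<lambda>xs. - parity_twist (\<lambda>xs. f (a # xs)) xs) (b # cs)"
    by (simp add: parity_twist_Cons)
  also have "\<dots> = - parity_twist (rmul f) (a # b # cs)"
    by (simp only: rmul_uminus 3) (simp add: parity_twist_def algebra_simps)
  finally show ?case .
qed (simp_all add: parity_twist_def)

lemma coboundary_parity_twist: "coboundary (parity_twist f) xs = - parity_twist (coboundary f) xs"
proof (cases xs)
  case (Cons a bs)
  have "a * ((- 1) ^ length bs * f bs) = (- 1) ^ length bs * (a * f bs)"
    by (cases "even (length bs)") auto
  thus ?thesis
    by (simp add: Cons coboundary_Cons rmul_parity_twist) (simp add: parity_twist_def coboundary_Cons algebra_simps)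
qed (simp add: parity_twist_def)

lemma coboundary_cup:
  "coboundary (cup f g) xs = cup (coboundary f) g xs + cup (parity_twist f) (coboundary g) xs"
proof (cases xs)
  case (Cons a bs)
  \<comment> \<open>At the junction of \<open>f\<close> and \<open>g\<close>, the last term of
    \<open>rmul f\<close> multiplies \<open>f\<close> on the right by an argument by which the first
    term of \<open>coboundary g\<close> multiplies \<open>g\<close> on the left, with opposite sign,
    so the two cancel. The split that leaves \<open>f\<close> no argument but \<open>a\<close> has
    no such partner; its surplus \<open>f [] * a * g bs\<close> is subtracted.\<close>
  have *: "rmul (cup f g) (a # bs) = cup (\<lambda>xs. rmul f (a # xs)) g bs - f [] * a * g bs
      + f [] * rmul g (a # bs) + cup (parity_twist (\<lambda>xs. f (a # xs))) (coboundary g) bs"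
    for f g :: "'a list \<Rightarrow> 'a" and a bs
  proof (induction bs arbitrary: f a)
    case (Cons b cs)
    have "rmul (cup f g) (a # b # cs) = f [] * g ((a * b) # cs) + cup (\<lambda>xs. f ((a * b) # xs)) g cs
        - rmul (\<lambda>xs. f [] * g (a # xs) + cup (\<lambda>xs. f (a # xs)) g xs) (b # cs)"
      by simp
    also have "\<dots> = f [] * g ((a * b) # cs) + cup (\<lambda>xs. f ((a * b) # xs)) g cs
        - f [] * rmul (\<lambda>xs. g (a # xs)) (b # cs)
        - (cup (\<lambda>xs. rmul (\<lambda>xs. f (a # xs)) (b # xs)) g cs - f [a] * b * g cs
      + f [a] * rmul g (b # cs) + cup (parity_twist (\<lambda>xs. f (a # b # xs))) (coboundary g) cs)"
      by (simp only: rmul_add rmul_lmult Cons.IH) (simp add: algebra_simps)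
    also have "\<dots> = cup (\<lambda>xs. rmul f (a # xs)) g (b # cs) - f [] * a * g (b # cs)
        + f [] * rmul g (a # b # cs) + cup (parity_twist (\<lambda>xs. f (a # xs))) (coboundary g) (b # cs)"
      by (simp add: cup_diff_left cup_uminus_left parity_twist_Cons coboundary_Cons)
        (simp add: algebra_simps)
    finally show ?case .
  qed (simp add: mult.assoc)
  show ?thesis
    by (simp add: Cons coboundary_Cons * parity_twist_Cons cup_uminus_left cup_diff_left cup_lmult)
      (simp add: algebra_simps)
qed simp

section \<open>Multilinear cochains of bounded degree\<close>

definition bounded_cochain :: "nat \<Rightarrow> ('a list \<Rightarrow> 'a::ring_1) \<Rightarrow> bool" where
  "bounded_cochain N f \<longleftrightarrow> (\<forall>xs. length xs > N \<longrightarrow> f xs = 0)"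

definition multilinear :: "('r \<Rightarrow> 'a::ring_1) \<Rightarrow> ('a list \<Rightarrow> 'a) \<Rightarrow> bool" where
  "multilinear \<eta> f \<longleftrightarrow>
     (\<forall>us vs a b. f (us @ (a + b) # vs) = f (us @ a # vs) + f (us @ b # vs)) \<and>
     (\<forall>us vs r a. f (us @ (\<eta> r * a) # vs) = \<eta> r * f (us @ a # vs))"

lemma cochains_iff: "f \<in> cochains \<eta> \<longleftrightarrow> (\<exists>N. bounded_cochain N f) \<and> multilinear \<eta> f"
  by (auto simp: cochains_def bounded_cochain_def multilinear_def)

lemma multilinearI:
  assumes "\<And>us vs a b. f (us @ (a + b) # vs) = f (us @ a # vs) + f (us @ b # vs)"
    and "\<And>us vs r a. f (us @ (\<eta> r * a) # vs) = \<eta> r * f (us @ a # vs)"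
  shows "multilinear \<eta> f"
  using assms by (simp add: multilinear_def)

lemma multilinear_app:
  assumes "multilinear \<eta> f"
  shows "f (us @ (a + b) # vs) = f (us @ a # vs) + f (us @ b # vs)"
    and "f (us @ (\<eta> r * a) # vs) = \<eta> r * f (us @ a # vs)"
  using assms by (simp_all add: multilinear_def)

lemma multilinear_hd:
  assumes "multilinear \<eta> f"
  shows "f ((a + b) # vs) = f (a # vs) + f (b # vs)"
    and "f ((\<eta> r * a) # vs) = \<eta> r * f (a # vs)"
  using multilinear_app[OF assms, of "[]"] by simp_all

lemma multilinear_tl: "multilinear \<eta> f \<Longrightarrow> multilinear \<eta> (\<lambda>xs. f (a # xs))"
  unfolding multilinear_def by (metis append_Cons)

lemma multilinear_zero_hd:
  assumes "multilinear \<eta> f"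
  shows "f (0 # vs) = 0"
  using multilinear_hd(1)[OF assms, of 0 0] by simp

lemma multilinear_uminus_hd:
  assumes "multilinear \<eta> f"
  shows "f ((- a) # vs) = - f (a # vs)"
  using multilinear_hd(1)[OF assms, of a "- a" vs] multilinear_zero_hd[OF assms]
  by (simp add: eq_neg_iff_add_eq_0 add.commute)

lemma multilinear_diff_hd:
  assumes "multilinear \<eta> f"
  shows "f ((a - b) # vs) = f (a # vs) - f (b # vs)"
  using multilinear_hd(1)[OF assms, of a "- b" vs] multilinear_uminus_hd[OF assms] by simp

lemma multilinear_sum_hd:
  assumes "multilinear \<eta> f"
  shows "f ((\<Sum>i\<in>I. h i) # vs) = (\<Sum>i\<in>I. f (h i # vs))"
  by (induction I rule: infinite_finite_induct)
    (simp_all add: multilinear_zero_hd[OF assms] multilinear_hd[OF assms])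

lemma multilinear_add: "multilinear \<eta> f \<Longrightarrow> multilinear \<eta> g \<Longrightarrow> multilinear \<eta> (\<lambda>xs. f xs + g xs)"
  by (simp add: multilinear_def algebra_simps)

lemma multilinear_uminus: "multilinear \<eta> f \<Longrightarrow> multilinear \<eta> (\<lambda>xs. - f xs)"
  by (simp add: multilinear_def)

lemma multilinear_0: "multilinear \<eta> (\<lambda>_. 0)"
  by (simp add: multilinear_def)

lemma multilinear_rmul:
  assumes f: "multilinear \<eta> f" and central: "\<And>r a. \<eta> r * a = a * \<eta> r"
  shows "multilinear \<eta> (rmul f)"
proof (rule multilinearI)
  have hd_add: "rmul f ((a + b) # vs) = rmul f (a # vs) + rmul f (b # vs)"
    if "multilinear \<eta> f" for f a b vs
    using that by (cases vs) (simp_all add: algebra_simps multilinear_hd rmul_add)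
  have hd_scale: "rmul f ((\<eta> r * a) # vs) = \<eta> r * rmul f (a # vs)"
    if "multilinear \<eta> f" for f a r vs
  proof (cases vs)
    case Nil
    show ?thesis by (simp add: Nil central mult.assoc)
  next
    case (Cons v vs')
    show ?thesis using that
      by (simp add: Cons algebra_simps multilinear_hd rmul_lmult)
  qed
  show "rmul f (us @ (a + b) # vs) = rmul f (us @ a # vs) + rmul f (us @ b # vs)" for us vs a b
    using f
  proof (induction us arbitrary: f rule: induct_list012)
    case (2 c)
    thus ?case by (simp add: hd_add multilinear_tl distrib_left multilinear_hd)
  next
    case (3 c d us)
    from 3(2)[OF multilinear_tl[OF 3(3)]] multilinear_app(1)[OF 3(3), of "(c * d) # us"]
    show ?case by simp
  qed (simp add: hd_add)
  show "rmul f (us @ (\<eta> r * a) # vs) = \<eta> r * rmul f (us @ a # vs)" for us vs r a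
    using f
  proof (induction us arbitrary: f rule: induct_list012)
    case (2 c)
    have "c * (\<eta> r * a) = \<eta> r * (c * a)" by (metis central mult.assoc)
    with 2 show ?case by (simp add: hd_scale multilinear_tl multilinear_hd right_diff_distrib)
  next
    case (3 c d us)
    from 3(2)[OF multilinear_tl[OF 3(3)]] multilinear_app(2)[OF 3(3), of "(c * d) # us"]
    show ?case by (simp add: right_diff_distrib)
  qed (simp add: hd_scale)
qed

lemma multilinear_cup:
  assumes f: "multilinear \<eta> f" and g: "multilinear \<eta> g" and central: "\<And>r a. \<eta> r * a = a * \<eta> r"
  shows "multilinear \<eta> (cup f g)"
proof (rule multilinearI)
  show "cup f g (us @ (a + b) # vs) = cup f g (us @ a # vs) + cup f g (us @ b # vs)" for us vs a b
    using f
  proof (induction us arbitrary: f)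
    case (Cons c us)
    from Cons(1)[OF multilinear_tl[OF Cons(2)]] multilinear_app(1)[OF g, of "c # us"]
    show ?case by (simp add: algebra_simps)
  qed (simp add: multilinear_hd[OF g] multilinear_hd cup_add_left algebra_simps)
  show "cup f g (us @ (\<eta> r * a) # vs) = \<eta> r * cup f g (us @ a # vs)" for us vs r a
    using f
  proof (induction us arbitrary: f)
    case (Cons c us)
    have "f [] * (\<eta> r * b) = \<eta> r * (f [] * b)" for b by (metis central mult.assoc)
    with Cons(1)[OF multilinear_tl[OF Cons(2)]] multilinear_app(2)[OF g, of "c # us"]
    show ?case by (simp add: distrib_left)
  next
    case Nil
    have "f [] * (\<eta> r * b) = \<eta> r * (f [] * b)" for b by (metis central mult.assoc)
    with Nil show ?case by (simp add: multilinear_hd[OF g] multilinear_hd cup_lmult distrib_left)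
  qed
qed

lemma bounded_rmul:
  assumes "bounded_cochain N f"
  shows "bounded_cochain (Suc N) (rmul f)"
proof -
  have "length xs > Suc N \<Longrightarrow> bounded_cochain N f \<Longrightarrow> rmul f xs = 0" for xs
  proof (induction xs arbitrary: f N rule: induct_list012)
    case (3 a b cs)
    show ?case
    proof (cases N)
      case 0
      have "(\<lambda>xs. f (a # xs)) = (\<lambda>_. 0)"
        using 3(4) by (auto simp: bounded_cochain_def 0)
      thus ?thesis using 3(3,4) by (simp add: bounded_cochain_def 0)
    next
      case (Suc M)
      from 3 show ?thesis by (simp add: bounded_cochain_def Suc)
    qed
  qed auto
  thus ?thesis using assms by (auto simp: bounded_cochain_def)
qed

lemma bounded_coboundary:
  assumes "bounded_cochain N f"
  shows "bounded_cochain (Suc N) (coboundary f)"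
  unfolding bounded_cochain_def
proof (intro allI impI)
  fix xs :: "'a list" assume "length xs > Suc N"
  with bounded_rmul[OF assms] assms show "coboundary f xs = 0"
    by (cases xs) (simp_all add: coboundary_Cons bounded_cochain_def)
qed

lemma cochains_add: "f \<in> cochains \<eta> \<Longrightarrow> g \<in> cochains \<eta> \<Longrightarrow> (\<lambda>xs. f xs + g xs) \<in> cochains \<eta>"
  unfolding cochains_iff
proof (elim conjE exE, intro conjI)
  fix N M assume "bounded_cochain N f" "bounded_cochain M g"
  thus "\<exists>N. bounded_cochain N (\<lambda>xs. f xs + g xs)"
    by (intro exI[of _ "max N M"]) (simp add: bounded_cochain_def)
qed (simp add: multilinear_add)

lemma cochains_uminus: "f \<in> cochains \<eta> \<Longrightarrow> (\<lambda>xs. - f xs) \<in> cochains \<eta>"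
  by (auto simp: cochains_iff multilinear_uminus bounded_cochain_def)

lemma cochains_diff: "f \<in> cochains \<eta> \<Longrightarrow> g \<in> cochains \<eta> \<Longrightarrow> (\<lambda>xs. f xs - g xs) \<in> cochains \<eta>"
  using cochains_add[of f \<eta> "\<lambda>xs. - g xs"] by (simp add: cochains_uminus)

lemma cochains_0: "(\<lambda>_. 0) \<in> cochains \<eta>"
  by (simp add: cochains_iff multilinear_0 bounded_cochain_def)

lemma cochains_const: "const_cochain c \<in> cochains \<eta>"
  by (auto simp: cochains_iff multilinear_def bounded_cochain_def const_cochain_def)

section \<open>The ring of cocycles and its ideal of coboundaries\<close>

locale central_scalars =
  fixes \<eta> :: "'r \<Rightarrow> 'a::ring_1"
  assumes central: "\<eta> r * a = a * \<eta> r"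
begin

lemma cochains_coboundary:
  assumes "f \<in> cochains \<eta>"
  shows "coboundary f \<in> cochains \<eta>"
proof -
  have f: "multilinear \<eta> f" using assms by (simp add: cochains_iff)
  note rmul = multilinear_rmul[OF f central]
  have "multilinear \<eta> (coboundary f)"
  proof (rule multilinearI)
    show "coboundary f (us @ (a + b) # vs) = coboundary f (us @ a # vs) + coboundary f (us @ b # vs)"
      for us vs a b
      using multilinear_app(1)[OF rmul, of us] multilinear_app(1)[OF f, of "tl us"]
      by (cases us) (simp_all add: coboundary_Cons algebra_simps)
    show "coboundary f (us @ (\<eta> r * a) # vs) = \<eta> r * coboundary f (us @ a # vs)" for us vs r a
    proof -
      have "c * (\<eta> r * b) = \<eta> r * (c * b)" for b c by (metis central mult.assoc)
      thus ?thesis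
        using multilinear_app(2)[OF rmul, of us] multilinear_app(2)[OF f, of "tl us"]
        by (cases us) (simp_all add: coboundary_Cons right_diff_distrib mult.assoc)
    qed
  qed
  thus ?thesis using assms bounded_coboundary by (auto simp: cochains_iff)
qed

lemma cochains_cup:
  assumes "f \<in> cochains \<eta>" "g \<in> cochains \<eta>"
  shows "cup f g \<in> cochains \<eta>"
proof -
  obtain N M where NM: "bounded_cochain N f" "bounded_cochain M g"
    using assms by (auto simp: cochains_iff)
  have "bounded_cochain (N + M) (cup f g)"
    unfolding bounded_cochain_def cup_def
  proof (intro allI impI sum.neutral ballI)
    fix xs :: "'a list" and i
    assume "length xs > N + M" "i \<in> {..length xs}"
    hence "length (take i xs) > N \<or> length (drop i xs) > M" by auto
    thus "f (take i xs) * g (drop i xs) = 0" using NM by (auto simp: bounded_cochain_def)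
  qed
  thus ?thesis using assms multilinear_cup[OF _ _ central] by (auto simp: cochains_iff)
qed

lemma cochains_parity_twist:
  assumes "f \<in> cochains \<eta>"
  shows "parity_twist f \<in> cochains \<eta>"
proof -
  have "(- 1) ^ n * (\<eta> r * b) = \<eta> r * ((- 1) ^ n * b)" for n r b
    by (cases "even n") auto
  hence "multilinear \<eta> (parity_twist f)" using assms
    by (simp add: cochains_iff parity_twist_def multilinear_def distrib_left)
  moreover have "bounded_cochain N f \<Longrightarrow> bounded_cochain N (parity_twist f)" for N
    by (simp add: bounded_cochain_def parity_twist_def)
  ultimately show ?thesis using assms by (auto simp: cochains_iff)
qed

abbreviation cocycles :: "('a list \<Rightarrow> 'a) set" where
  "cocycles \<equiv> {f \<in> cochains \<eta>. coboundary f = (\<lambda>_. 0)}"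

lemma cocycles_cup: "f \<in> cocycles \<Longrightarrow> g \<in> cocycles \<Longrightarrow> cup f g \<in> cocycles"
  by (auto simp: cochains_cup coboundary_cup intro!: ext)

lemma ring_cocycle_ring: "ring (cocycle_ring \<eta>)"
proof (rule ringI)
  show "abelian_group (cocycle_ring \<eta>)"
  proof (rule abelian_groupI)
    fix f assume f: "f \<in> carrier (cocycle_ring \<eta>)"
    show "\<exists>g\<in>carrier (cocycle_ring \<eta>). g \<oplus>\<^bsub>cocycle_ring \<eta>\<^esub> f = \<zero>\<^bsub>cocycle_ring \<eta>\<^esub>"
      using f cochains_uminus
      by (intro bexI[of _ "\<lambda>xs. - f xs"])
        (auto simp: cocycle_ring_def fun_eq_iff coboundary_uminus)
  qed (auto simp: cocycle_ring_def cochains_add cochains_0 coboundary_add algebra_simps fun_eq_iff)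
  show "monoid (cocycle_ring \<eta>)"
  proof (rule monoidI)
    have "coboundary (const_cochain 1) xs = (0::'a)" for xs
      by (induction xs rule: induct_list012) (simp_all add: coboundary_Cons const_cochain_def)
    thus "\<one>\<^bsub>cocycle_ring \<eta>\<^esub> \<in> carrier (cocycle_ring \<eta>)"
      by (auto simp: cocycle_ring_def cochains_const)
  qed (use cocycles_cup in \<open>auto simp: cocycle_ring_def fun_eq_iff cup_assoc\<close>)
qed (auto simp: cocycle_ring_def fun_eq_iff cup_add_left cup_add_right)

lemma coboundaries_subset: "coboundaries \<eta> \<subseteq> carrier (cocycle_ring \<eta>)"
  by (auto simp: coboundaries_def cocycle_ring_def cochains_coboundary)

lemma a_inv_cocycle_ring:
  assumes "f \<in> carrier (cocycle_ring \<eta>)"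
  shows "\<ominus>\<^bsub>cocycle_ring \<eta>\<^esub> f = (\<lambda>xs. - f xs)"
proof -
  interpret ring "cocycle_ring \<eta>" by (rule ring_cocycle_ring)
  have "(\<lambda>xs. - f xs) \<in> carrier (cocycle_ring \<eta>)"
    using assms by (auto simp: cocycle_ring_def cochains_uminus fun_eq_iff coboundary_uminus)
  thus ?thesis using assms by (intro minus_equality) (auto simp: cocycle_ring_def)
qed

lemma ideal_cocycle_ringI:
  assumes "I \<subseteq> carrier (cocycle_ring \<eta>)" "(\<lambda>_. 0) \<in> I"
    "\<And>f g. f \<in> I \<Longrightarrow> g \<in> I \<Longrightarrow> (\<lambda>xs. f xs + g xs) \<in> I"
    "\<And>f. f \<in> I \<Longrightarrow> (\<lambda>xs. - f xs) \<in> I"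
    "\<And>f g. f \<in> I \<Longrightarrow> g \<in> carrier (cocycle_ring \<eta>) \<Longrightarrow> cup f g \<in> I"
    "\<And>f g. f \<in> I \<Longrightarrow> g \<in> carrier (cocycle_ring \<eta>) \<Longrightarrow> cup g f \<in> I"
  shows "ideal I (cocycle_ring \<eta>)"
proof (rule idealI[OF ring_cocycle_ring])
  interpret ring "cocycle_ring \<eta>" by (rule ring_cocycle_ring)
  show "subgroup I (add_monoid (cocycle_ring \<eta>))"
  proof (rule group.subgroupI[OF a_group])
    fix f assume "f \<in> I"
    thus "inv\<^bsub>add_monoid (cocycle_ring \<eta>)\<^esub> f \<in> I"
      using a_inv_cocycle_ring[of f] assms(1,4) by (auto simp: a_inv_def)
  qed (use assms in \<open>auto simp: cocycle_ring_def\<close>)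
qed (use assms in \<open>auto simp: cocycle_ring_def\<close>)

lemma coboundaries_0: "(\<lambda>_. 0) \<in> coboundaries \<eta>"
  using cochains_0 coboundary_0 by (force simp: coboundaries_def)

lemma ideal_coboundaries: "ideal (coboundaries \<eta>) (cocycle_ring \<eta>)"
proof (rule ideal_cocycle_ringI[OF coboundaries_subset coboundaries_0])
  show "(\<lambda>xs. f xs + g xs) \<in> coboundaries \<eta>"
    if "f \<in> coboundaries \<eta>" "g \<in> coboundaries \<eta>" for f g
    using that cochains_add by (force simp: coboundaries_def coboundary_add[symmetric])
  show "(\<lambda>xs. - f xs) \<in> coboundaries \<eta>" if "f \<in> coboundaries \<eta>" for f
    using that cochains_uminus by (force simp: coboundaries_def coboundary_uminus[symmetric])
  fix f g assume "f \<in> coboundaries \<eta>" "g \<in> carrier (cocycle_ring \<eta>)"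
  then obtain h where h: "h \<in> cochains \<eta>" "f = coboundary h"
    and g: "g \<in> cochains \<eta>" "coboundary g = (\<lambda>_. 0)"
    by (auto simp: coboundaries_def cocycle_ring_def)
  have "cup f g = coboundary (cup h g)" by (simp add: fun_eq_iff coboundary_cup h g)
  thus "cup f g \<in> coboundaries \<eta>" using cochains_cup h g by (auto simp: coboundaries_def)
  \<comment> \<open>The twisted \<open>g\<close> is again a cocycle, and the Leibniz rule for its
    product with \<open>h\<close> twists it a second time, back to \<open>g\<close>.\<close>
  have "coboundary (parity_twist g) = (\<lambda>_. 0)"
    by (rule ext, simp add: coboundary_parity_twist g) (simp add: parity_twist_def)
  hence "cup g f = coboundary (cup (parity_twist g) h)"
    by (intro ext) (simp add: coboundary_cup h)
  thus "cup g f \<in> coboundaries \<eta>"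
    using cochains_cup[OF cochains_parity_twist] h g by (auto simp: coboundaries_def)
qed

end

subsection \<open>Normalisation\<close>

definition normalised_below :: "nat \<Rightarrow> ('a list \<Rightarrow> 'a::ring_1) \<Rightarrow> bool" where
  "normalised_below i f \<longleftrightarrow> (\<forall>us vs. length us < i \<longrightarrow> f (us @ 1 # vs) = 0)"

definition normalised :: "('a list \<Rightarrow> 'a::ring_1) \<Rightarrow> bool" where
  "normalised f \<longleftrightarrow> (\<forall>us vs. f (us @ 1 # vs) = 0)"

text \<open>The codegeneracy at position \<open>i\<close>. In a list shorter than \<open>i\<close>
  the unit lands at the end, where a cochain that is normalised below \<open>i\<close> vanishes, so
  this default value does no harm.\<close>

definition insert_one :: "nat \<Rightarrow> ('a list \<Rightarrow> 'a) \<Rightarrow> 'a list \<Rightarrow> 'a::ring_1" where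
  "insert_one i f as = f (take i as @ 1 # drop i as)"

lemma insert_one_simps [simp]:
  "insert_one 0 f = (\<lambda>as. f (1 # as))"
  "insert_one (Suc i) f (a # as) = insert_one i (\<lambda>xs. f (a # xs)) as"
  by (simp_all add: insert_one_def fun_eq_iff)

lemma normalised_below_tl: "normalised_below (Suc i) f \<Longrightarrow> normalised_below i (\<lambda>xs. f (a # xs))"
  unfolding normalised_below_def by (metis append_Cons length_Cons Suc_less_eq)

lemma normalised_belowD: "normalised_below i f \<Longrightarrow> length us < i \<Longrightarrow> f (us @ 1 # vs) = 0"
  by (simp add: normalised_below_def)

lemma normalised_below_mono: "normalised_below i f \<Longrightarrow> j \<le> i \<Longrightarrow> normalised_below j f"
  by (simp add: normalised_below_def)

text \<open>The right action is not unital on all cochains. It is so here because every term but the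
  first keeps the leading unit as an argument of \<open>f\<close>.\<close>

lemma rmul_one:
  assumes "normalised_below (Suc 0) f"
  shows "rmul f (1 # vs) = f vs"
proof (cases vs)
  case (Cons b cs)
  have "(\<lambda>xs. f (1 # xs)) = (\<lambda>_. 0)"
    using normalised_belowD[OF assms, of "[]"] by simp
  thus ?thesis by (simp add: Cons)
qed simp

text \<open>The two terms that merge the unit with its left neighbour and with what stands to its
  right cancel; every other term still has a unit among its first \<open>i\<close>
  arguments.\<close>

lemma rmul_normalised_below:
  assumes "normalised_below i f" "length us < i" "us \<noteq> []"
  shows "rmul f (us @ 1 # vs) = 0"
  using assms
proof (induction us arbitrary: f i)
  case (Cons a us)
  then obtain j where i: "i = Suc j" by (cases i) auto
  show ?case
  proof (cases us)
    case Nil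
    with Cons obtain l where "j = Suc l" using i by (cases j) auto
    hence "normalised_below (Suc 0) (\<lambda>xs. f (a # xs))"
      using normalised_below_tl[of j f a] Cons(2) i by (auto intro: normalised_below_mono)
    thus ?thesis by (simp add: Nil rmul_one)
  next
    case (Cons b us')
    have "f ((a * b) # us' @ 1 # vs) = 0"
      using normalised_belowD[OF Cons.prems(1), of "(a * b) # us'"] Cons.prems(2) Cons by simp
    moreover have "rmul (\<lambda>xs. f (a # xs)) (us @ 1 # vs) = 0"
      using Cons.prems i Cons by (intro Cons.IH[of j] normalised_below_tl) auto
    ultimately show ?thesis by (simp add: Cons)
  qed
qed simp

lemma normalised_below_coboundary:
  assumes "normalised_below i f"
  shows "normalised_below i (coboundary f)"
  unfolding normalised_below_def
proof (intro allI impI)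
  fix us vs :: "'a list" assume i: "length us < i"
  show "coboundary f (us @ 1 # vs) = 0"
  proof (cases us)
    case Nil
    have "normalised_below (Suc 0) f"
      using i assms Nil by (auto intro: normalised_below_mono)
    thus ?thesis by (simp add: Nil coboundary_Cons rmul_one)
  next
    case (Cons a us')
    thus ?thesis
      using i rmul_normalised_below[OF assms i, of vs] normalised_belowD[OF assms, of us' vs]
      by (simp add: coboundary_Cons)
  qed
qed

text \<open>Compare the products of neighbours in both lists. Those inside \<open>us\<close> leave a
  unit below position \<open>i\<close>, where \<open>f\<close> vanishes; those further right
  correspond to each other, up to one term. For \<open>i = 0\<close> nothing stands to the left of
  the unit, and the truncated exponent \<open>i - 1\<close> gives the sign \<open>+ 1\<close> that
  this case has.\<close>

lemma rmul_insert_one: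
  assumes "normalised_below i f" "length us = i"
  shows "rmul f (us @ 1 # 1 # vs) = (- 1) ^ (i - 1) * f (us @ 1 # vs) - rmul (insert_one i f) (us @ 1 # vs)"
  using assms
proof (induction us arbitrary: f i)
  case (Cons a us)
  then obtain j where i: "i = Suc j" "length us = j" by (cases i) auto
  have tl: "normalised_below j (\<lambda>xs. f (a # xs))"
    using Cons i by (simp add: normalised_below_tl)
  note IH = Cons.IH[OF tl i(2)]
  show ?case
  proof (cases us)
    case Nil
    thus ?thesis using IH i by simp
  next
    case (Cons b us')
    have "f ((a * b) # us' @ 1 # ws) = 0" for ws
      using normalised_belowD[OF Cons.prems(1), of "(a * b) # us'"] i Cons by simp
    moreover have "insert_one i f ((a * b) # us' @ 1 # vs) = 0"
    proof -
      have "i = Suc (Suc (length us'))" using i Cons by simp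
      thus ?thesis
        using normalised_belowD[OF Cons.prems(1), of "(a * b) # us'"] by (simp add: insert_one_def)
    qed
    moreover have "(- 1) ^ (i - 1) = (- ((- 1) ^ (j - 1)) :: 'a)"
      using i Cons by (cases j) auto
    moreover have "(\<lambda>xs. insert_one i f (a # xs)) = insert_one j (\<lambda>xs. f (a # xs))"
      by (simp add: fun_eq_iff i)
    ultimately show ?thesis using IH by (simp add: Cons)
  qed
qed simp

lemma cochains_insert_one:
  assumes "f \<in> cochains \<eta>"
  shows "insert_one i f \<in> cochains \<eta>"
proof -
  have f: "multilinear \<eta> f" using assms by (simp add: cochains_iff)
  have "multilinear \<eta> (insert_one i f)"
  proof (rule multilinearI)
    show "insert_one i f (us @ (a + b) # vs) = insert_one i f (us @ a # vs) + insert_one i f (us @ b # vs)"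
      for us vs a b
      using f
    proof (induction us arbitrary: i f)
      case Nil
      thus ?case using multilinear_app(1)[of \<eta> f "[1]"]
        by (cases i) (simp_all add: insert_one_def multilinear_hd)
    next
      case (Cons c us)
      thus ?case using multilinear_app(1)[of \<eta> f "1 # c # us"]
        by (cases i) (simp_all add: multilinear_tl)
    qed
    show "insert_one i f (us @ (\<eta> r * a) # vs) = \<eta> r * insert_one i f (us @ a # vs)" for us vs a r
      using f
    proof (induction us arbitrary: i f)
      case Nil
      thus ?case using multilinear_app(2)[of \<eta> f "[1]"]
        by (cases i) (simp_all add: insert_one_def multilinear_hd)
    next
      case (Cons c us)
      thus ?case using multilinear_app(2)[of \<eta> f "1 # c # us"]
        by (cases i) (simp_all add: multilinear_tl)
    qed
  qed
  moreover have "bounded_cochain N f \<Longrightarrow> bounded_cochain N (insert_one i f)" for N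
    by (simp add: bounded_cochain_def insert_one_def)
  ultimately show ?thesis using assms by (auto simp: cochains_iff)
qed

text \<open>Inserting a unit lowers the degree by one and the coboundary raises it again, so a
  correction of this form respects the degree bound. For \<open>N = 0\<close> the inserted cochain
  is zero.\<close>

lemma bounded_insert_one:
  assumes "bounded_cochain N f"
  shows "bounded_cochain N (coboundary (insert_one i f))"
proof (cases N)
  case 0
  hence "insert_one i f = (\<lambda>_. 0)"
    using assms by (auto simp: insert_one_def bounded_cochain_def)
  thus ?thesis by (simp add: bounded_cochain_def)
next
  case (Suc M)
  have "bounded_cochain M (insert_one i f)"
    using assms by (auto simp: insert_one_def bounded_cochain_def Suc)
  thus ?thesis using bounded_coboundary Suc by blast
qed

text \<open>The cocycle condition at two adjacent units expresses
  \<open>coboundary (insert_one i f)\<close>, at a unit in position \<open>i\<close>, as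
  \<open>f\<close> up to sign. The sign alternates with \<open>i\<close>, and the disjunction keeps
  it out of the iteration.\<close>

lemma normalise_step:
  assumes f: "coboundary f = (\<lambda>_. 0)" "normalised_below i f"
  shows "normalised_below (Suc i) (\<lambda>xs. f xs - coboundary (insert_one i f) xs)
    \<or> normalised_below (Suc i) (\<lambda>xs. f xs + coboundary (insert_one i f) xs)"
proof -
  let ?g = "insert_one i f"
  have "?g (us @ 1 # vs) = 0" if "length us < i" for us vs
  proof -
    have "?g (us @ 1 # vs) = f (us @ 1 # take (i - Suc (length us)) vs @ 1 # drop (i - Suc (length us)) vs)"
      using that by (simp add: insert_one_def take_Cons' drop_Cons')
    thus ?thesis using normalised_belowD[OF f(2) that] by simp
  qed
  hence "normalised_below i ?g" by (simp add: normalised_below_def)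
  note small = normalised_belowD[OF normalised_below_coboundary[OF this]] normalised_belowD[OF f(2)]
  have "coboundary ?g (us @ 1 # vs) = - ((- 1) ^ (i - 1)) * f (us @ 1 # vs)"
    if us: "length us = i" "i \<noteq> 0" for us vs
  proof -
    obtain a us' where Cons: "us = a # us'" using us by (cases us) auto
    have "f (us' @ 1 # 1 # vs) = 0" using normalised_belowD[OF f(2), of us'] us Cons by simp
    hence "rmul f (us @ 1 # 1 # vs) = 0"
      using fun_cong[OF f(1), of "us @ 1 # 1 # vs"] by (simp add: Cons coboundary_Cons)
    moreover have "?g (us' @ 1 # vs) = 0"
      using normalised_belowD[OF f(2), of us'] us Cons by (auto simp: insert_one_def)
    ultimately show ?thesis using rmul_insert_one[OF f(2) us(1), of vs] by (simp add: Cons coboundary_Cons)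
  qed
  moreover have "coboundary ?g (1 # vs) = f (1 # vs)" if "i = 0" for vs
    using rmul_insert_one[OF f(2), of "[]" vs] that fun_cong[OF f(1), of "1 # 1 # vs"]
    by (simp add: coboundary_Cons)
  ultimately have *: "coboundary ?g (us @ 1 # vs) = (if i = 0 \<or> even i then 1 else - 1) * f (us @ 1 # vs)"
    if "length us = i" for us vs
    using that by (cases "i = 0") auto
  show ?thesis
    using * small by (cases "even i") (auto simp: normalised_below_def less_Suc_eq)
qed

context central_scalars
begin

text \<open>Each step clears one more position. As the degree bound \<open>N\<close> is kept,
  \<open>Suc N\<close> steps reach all positions at which the cochain could be nonzero.\<close>

lemma normalise:
  assumes f: "f \<in> cocycles"
  obtains g where "g \<in> cochains \<eta>" "normalised (\<lambda>xs. f xs - coboundary g xs)"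
proof -
  obtain N where N: "bounded_cochain N f" using f by (auto simp: cochains_iff)
  have "\<exists>g\<in>cochains \<eta>. bounded_cochain N (\<lambda>xs. f xs - coboundary g xs) \<and>
      normalised_below i (\<lambda>xs. f xs - coboundary g xs)" for i
  proof (induction i)
    case 0
    show ?case using N cochains_0 by (intro bexI[of _ "\<lambda>_. 0"]) (simp_all add: normalised_below_def)
  next
    case (Suc i)
    then obtain g where g: "g \<in> cochains \<eta>" "bounded_cochain N (\<lambda>xs. f xs - coboundary g xs)"
      "normalised_below i (\<lambda>xs. f xs - coboundary g xs)" by auto
    let ?f = "\<lambda>xs. f xs - coboundary g xs"
    let ?h = "insert_one i ?f"
    have f': "coboundary ?f = (\<lambda>_. 0)" "?f \<in> cochains \<eta>"
      using f g cochains_diff cochains_coboundary by (auto simp: fun_eq_iff coboundary_diff)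
    have h: "?h \<in> cochains \<eta>" "bounded_cochain N (coboundary ?h)"
      using f' g cochains_insert_one bounded_insert_one by blast+
    from normalise_step[OF f'(1) g(3)] consider
      "normalised_below (Suc i) (\<lambda>xs. ?f xs - coboundary ?h xs)" |
      "normalised_below (Suc i) (\<lambda>xs. ?f xs + coboundary ?h xs)" by blast
    thus ?case
    proof cases
      case 1
      thus ?thesis using g h
        by (intro bexI[of _ "\<lambda>xs. g xs + ?h xs"])
          (simp_all add: cochains_add coboundary_add bounded_cochain_def diff_diff_eq)
    next
      case 2
      thus ?thesis using g h
        by (intro bexI[of _ "\<lambda>xs. g xs - ?h xs"])
          (simp_all add: cochains_diff coboundary_diff bounded_cochain_def diff_diff_eq2 add_diff_eq
            diff_add_eq)
    qed
  qed
  then obtain g where g: "g \<in> cochains \<eta>" "bounded_cochain N (\<lambda>xs. f xs - coboundary g xs)"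
    "normalised_below (Suc N) (\<lambda>xs. f xs - coboundary g xs)" by blast
  have "normalised (\<lambda>xs. f xs - coboundary g xs)"
    unfolding normalised_def
  proof (intro allI)
    fix us vs
    show "f (us @ 1 # vs) - coboundary g (us @ 1 # vs) = 0"
      using g(2,3) unfolding bounded_cochain_def normalised_below_def
      by (cases "length us < Suc N") auto
  qed
  thus ?thesis using that g by blast
qed

end

section \<open>The monomial basis\<close>

definition comb :: "('r::comm_ring_1 \<Rightarrow> 'a::ring_1) \<Rightarrow> ('i \<Rightarrow> 'a) \<Rightarrow> ('i \<Rightarrow>\<^sub>0 'r) \<Rightarrow> 'a" where
  "comb \<eta> T c = (\<Sum>k\<in>Poly_Mapping.keys c. \<eta> (Poly_Mapping.lookup c k) * T k)"

lemma comb_superset: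
  assumes "finite S" "Poly_Mapping.keys c \<subseteq> S" "\<eta> 0 = 0"
  shows "comb \<eta> T c = (\<Sum>k\<in>S. \<eta> (Poly_Mapping.lookup c k) * T k)"
  unfolding comb_def
  by (rule sum.mono_neutral_left) (use assms in \<open>auto simp: in_keys_iff\<close>)

lemma comb_0 [simp]: "comb \<eta> T 0 = 0"
  by (simp add: comb_def)

lemma comb_single: "\<eta> 0 = 0 \<Longrightarrow> comb \<eta> T (Poly_Mapping.single k c) = \<eta> c * T k"
  by (subst comb_superset[of "{k}"]) auto

lemma comb_add:
  assumes "\<And>a b. \<eta> (a + b) = \<eta> a + \<eta> b"
  shows "comb \<eta> T (c + d) = comb \<eta> T c + comb \<eta> T d"
proof -
  let ?S = "Poly_Mapping.keys c \<union> Poly_Mapping.keys d"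
  have 0: "\<eta> 0 = 0" using assms[of 0 0] by simp
  have "comb \<eta> T (c + d) = (\<Sum>k\<in>?S. \<eta> (Poly_Mapping.lookup (c + d) k) * T k)"
    using keys_add[of c d] 0 by (intro comb_superset) auto
  also have "\<dots> = comb \<eta> T c + comb \<eta> T d"
    by (simp add: comb_superset[of ?S] 0 lookup_add assms distrib_right sum.distrib)
  finally show ?thesis .
qed

abbreviation delta_seq :: "nat \<Rightarrow> nat \<Rightarrow> 'r::comm_ring_1" where
  "delta_seq n \<equiv> (\<lambda>m. if m = n then 1 else 0)"

text \<open>
  The last assumption says that no \<open>q\<close>-integer vanishes; it makes the action of \<open>gen_act\<close> on
  sequences faithful, so the monomials are linearly independent.
\<close>

locale quantum_weyl =
  fixes \<eta> :: "'r::idom \<Rightarrow> 'a::ring_1" and x y :: 'a and q :: 'r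
    and act :: "'a \<Rightarrow> (nat \<Rightarrow> 'r) \<Rightarrow> nat \<Rightarrow> 'r"
  assumes scalar_add: "\<eta> (a + b) = \<eta> a + \<eta> b"
    and scalar_mult: "\<eta> (a * b) = \<eta> a * \<eta> b"
    and scalar_1: "\<eta> 1 = 1"
    and scalar_central: "\<eta> c * u = u * \<eta> c"
    and relation: "\<eta> q * x * y - y * x = 1"
    and generated: "\<lbrakk>\<And>c. P (\<eta> c); P x; P y; \<And>u v. P u \<Longrightarrow> P v \<Longrightarrow> P (u + v);
      \<And>u v. P u \<Longrightarrow> P v \<Longrightarrow> P (u * v)\<rbrakk> \<Longrightarrow> P u"
    and act_add: "act (u + w) v n = act u v n + act w v n"
    and act_mult: "act (u * w) v = act u (act w v)"
    and act_scalar: "act (\<eta> c) v = (\<lambda>n. c * v n)"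
    and act_x: "act x v = gen_act q GX v"
    and act_y: "act y v = gen_act q GY v"
    and act_scale: "act u (\<lambda>n. c * v n) = (\<lambda>n. c * act u v n)"
    and qcoeff_nonzero: "qcoeff q n \<noteq> 0"
begin

sublocale central_scalars \<eta>
  by standard (rule scalar_central)

lemma scalar_0 [simp]: "\<eta> 0 = 0"
  using scalar_add[of 0 0] by simp

lemma scalar_uminus: "\<eta> (- c) = - \<eta> c"
  using scalar_add[of c "- c"] by (simp add: eq_neg_iff_add_eq_0 add.commute)

lemma scalar_commute: "u * (\<eta> c * v) = \<eta> c * (u * v)"
  by (metis scalar_central mult.assoc)

definition monomial :: "nat \<times> nat \<Rightarrow> 'a" where
  "monomial k = x ^ fst k * y ^ snd k"

text \<open>The span contains 1 and is stable under left multiplication by scalars and generators,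
  hence by the whole algebra. Only \<open>y * x ^ i * y ^ j\<close> needs reordering:
  \<open>y * x = \<eta> q * x * y - 1\<close> moves the y past one x at a time.\<close>

lemma monomial_span: "\<exists>c. u = comb \<eta> monomial c"
proof -
  let ?S = "range (comb \<eta> monomial)"
  have plus: "u + v \<in> ?S" if "u \<in> ?S" "v \<in> ?S" for u v
    using that by (auto simp flip: comb_add[of \<eta> monomial, OF scalar_add])
  have lin: "v * comb \<eta> monomial c \<in> ?S" if "\<And>k. v * monomial k \<in> ?S"
    and "\<And>c u. u \<in> ?S \<Longrightarrow> \<eta> c * u \<in> ?S" for v c
  proof (induction c rule: free_alg_induct)
    case zero
    have "comb \<eta> monomial 0 \<in> ?S" by (rule rangeI)
    thus ?case by simp
  next
    case (single w c)
    thus ?case using that by (simp add: comb_single scalar_commute)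
  next
    case (add a b)
    thus ?case using plus by (simp add: comb_add scalar_add distrib_left)
  qed
  have mon: "\<eta> c * monomial k \<in> ?S" for c k
    unfolding comb_single[of \<eta> monomial k c, OF scalar_0, symmetric] by (rule rangeI)
  have scale: "\<eta> c * u \<in> ?S" if u: "u \<in> ?S" for c u
  proof -
    obtain d where d: "u = comb \<eta> monomial d" using u by auto
    show ?thesis unfolding d
    proof (induction d rule: free_alg_induct)
      case zero
      have "comb \<eta> monomial 0 \<in> ?S" by (rule rangeI)
      thus ?case by simp
    next
      case (single w a)
      thus ?case using mon[of "c * a" w]
        by (simp add: comb_single scalar_mult mult.assoc)
    next
      case (add a b)
      thus ?case using plus by (simp add: comb_add scalar_add distrib_left)
    qed
  qed
  have x: "x * u \<in> ?S" if "u \<in> ?S" for u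
  proof -
    have "x * monomial k \<in> ?S" for k
      using mon[of 1 "(Suc (fst k), snd k)"] by (simp add: monomial_def scalar_1 mult.assoc)
    from lin[OF this scale] show ?thesis using that by auto
  qed
  have y: "y * u \<in> ?S" if "u \<in> ?S" for u
  proof -
    have "y * (x ^ i * y ^ j) \<in> ?S" for i j
    proof (induction i)
      case 0
      have "y * (x ^ 0 * y ^ j) = \<eta> 1 * monomial (0, Suc j)" by (simp add: monomial_def scalar_1)
      thus ?case using mon by metis
    next
      case (Suc i)
      have yx: "y * x = \<eta> q * x * y - 1" using relation by (simp add: algebra_simps)
      have "y * (x ^ Suc i * y ^ j) = y * x * (x ^ i * y ^ j)" by (simp add: mult.assoc)
      also have "\<dots> = \<eta> q * (x * (y * (x ^ i * y ^ j))) + \<eta> (- 1) * monomial (i, j)"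
        by (simp add: yx left_diff_distrib mult.assoc scalar_uminus scalar_1 monomial_def)
      also have "\<dots> \<in> ?S" by (intro plus scale x Suc mon)
      finally show ?case .
    qed
    hence "y * monomial k \<in> ?S" for k by (simp add: monomial_def)
    from lin[OF this scale] show ?thesis using that by auto
  qed
  define S where "S = ?S"
  have "\<forall>v\<in>S. u * v \<in> S"
    by (rule generated[of "\<lambda>u. \<forall>v\<in>S. u * v \<in> S"])
      (use x y plus scale in \<open>simp_all add: distrib_right mult.assoc flip: S_def\<close>)
  moreover have "1 = \<eta> 1 * monomial (0, 0)" by (simp add: monomial_def scalar_1)
  hence "1 \<in> S" using mon unfolding S_def by metis
  ultimately have "u * 1 \<in> ?S" unfolding S_def by blast
  thus ?thesis by auto
qed

lemma monomial_induct [case_names scale_monomial add]: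
  assumes "\<And>c i j. P (\<eta> c * (x ^ i * y ^ j))" "\<And>a b. P a \<Longrightarrow> P b \<Longrightarrow> P (a + b)"
  shows "P u"
proof -
  obtain c where "u = comb \<eta> monomial c" using monomial_span by blast
  moreover have "P (comb \<eta> monomial c)"
  proof (induction c rule: free_alg_induct)
    case zero
    show ?case using assms(1)[of 0 0 0] by simp
  next
    case (single k c)
    show ?case using assms(1)[of c "fst k" "snd k"]
      by (simp add: comb_single monomial_def)
  next
    case (add a b)
    thus ?case using assms(2) by (simp add: comb_add scalar_add)
  qed
  ultimately show ?thesis by simp
qed

section \<open>Faithfulness of the action on sequences, and the centre\<close>

lemma act_0: "act 0 v = (\<lambda>_. 0)"
  using act_scalar[of 0 v] by simp

lemma act_diff: "act (u - w) v n = act u v n - act w v n"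
  using act_add[of "u - w" w v n] by simp

lemma act_comb: "act (comb \<eta> T c) v n = (\<Sum>k\<in>Poly_Mapping.keys c. Poly_Mapping.lookup c k * act (T k) v n)"
proof -
  have "act (\<Sum>k\<in>K. f k) v n = (\<Sum>k\<in>K. act (f k) v n)" for K and f :: "'b \<Rightarrow> 'a"
    by (induction K rule: infinite_finite_induct) (simp_all add: act_0 act_add)
  thus ?thesis by (simp add: comb_def act_mult act_scalar)
qed

lemma act_1: "act 1 v = v"
  using act_scalar[of 1 v] by (simp add: scalar_1)

lemma act_x_power: "act (x ^ i) (delta_seq k) = delta_seq (k + i)"
  by (induction i) (auto simp: act_1 act_mult act_x fun_eq_iff split: nat.splits)

text \<open>For finitely supported sequences, read as coefficients of polynomials, \<open>x\<close>
  multiplies by the variable and \<open>y\<close> is minus the q-derivative, which lowers the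
  degree. The factor \<open>P\<close> is a product of values of \<open>qcoeff\<close>, i.e. of
  negated q-integers.\<close>

lemma act_y_power:
  "(j \<le> n \<longrightarrow> (\<exists>P. P \<noteq> 0 \<and> act (y ^ j) (delta_seq n) = (\<lambda>m. P * delta_seq (n - j) m)))
    \<and> (j > n \<longrightarrow> act (y ^ j) (delta_seq n) = (\<lambda>_. 0))"
proof (induction j)
  case 0
  show ?case by (auto simp: act_1 intro!: exI[of _ 1])
next
  case (Suc j)
  have zero: "act u (\<lambda>_. 0) = (\<lambda>_. 0)" for u
    using act_scale[of u 0 "\<lambda>_. 0"] by simp
  consider "Suc j \<le> n" | "j = n" | "j > n" by linarith
  thus ?case
  proof cases
    case 1
    then obtain P where P: "P \<noteq> 0" "act (y ^ j) (delta_seq n) = (\<lambda>m. P * delta_seq (n - j) m)"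
      using Suc by auto
    have "n - j = Suc (n - Suc j)" using 1 by simp
    hence "act (y ^ Suc j) (delta_seq n) = (\<lambda>m. (P * qcoeff q (n - Suc j)) * delta_seq (n - Suc j) m)"
      by (auto simp: act_mult P act_scale act_y fun_eq_iff)
    moreover have "P * qcoeff q (n - Suc j) \<noteq> 0" using P qcoeff_nonzero by simp
    ultimately show ?thesis using 1 by (metis not_le)
  next
    case 2
    with Suc obtain P where "act (y ^ j) (delta_seq n) = (\<lambda>m. P * delta_seq (n - j) m)" by auto
    hence "act (y ^ Suc j) (delta_seq n) = (\<lambda>_. 0)"
      using 2 by (auto simp: act_mult act_y fun_eq_iff)
    thus ?thesis using 2 by auto
  next
    case 3
    thus ?thesis using Suc by (simp add: act_mult zero)
  qed
qed

text \<open>At \<open>delta_seq j\<close> the monomials with y-exponent above \<open>j\<close> act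
  as zero, those below have coefficient zero by induction, and \<open>x ^ i * y ^ j\<close> yields a
  nonzero multiple of \<open>delta_seq i\<close>. So the coefficients at exponent \<open>j\<close>
  can be read off.\<close>

lemma comb_monomial_faithful:
  assumes "\<And>n. act (comb \<eta> monomial c) (delta_seq n) = (\<lambda>_. 0)"
  shows "c = 0"
proof -
  have "\<forall>i. Poly_Mapping.lookup c (i, j) = 0" for j
  proof (induction j rule: less_induct)
    case (less j)
    obtain P where P: "P \<noteq> 0" "act (y ^ j) (delta_seq j) = (\<lambda>m. P * delta_seq 0 m)"
      using act_y_power[of j j] by auto
    show ?case
    proof
      fix i
      have "Poly_Mapping.lookup c k * act (monomial k) (delta_seq j) i
          = (if k = (i, j) then Poly_Mapping.lookup c k * P else 0)"
        if k: "k \<in> Poly_Mapping.keys c" for k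
      proof -
        obtain a b where ab: "k = (a, b)" by fastforce
        consider "b < j" | "b = j" | "b > j" by linarith
        thus ?thesis
        proof cases
          case 1
          thus ?thesis using less k ab by (auto simp: in_keys_iff)
        next
          case 2
          have "act (x ^ a) (\<lambda>m. P * delta_seq 0 m) = (\<lambda>n. P * delta_seq a n)"
            by (subst act_scale) (simp add: act_x_power)
          thus ?thesis using 2 by (auto simp: ab monomial_def act_mult P(2))
        next
          case 3
          have "act (x ^ a) (\<lambda>_. 0) = (\<lambda>_. 0)"
            using act_scale[of "x ^ a" 0 "\<lambda>_. 0"] by simp
          thus ?thesis using 3 act_y_power[of b j] by (auto simp: ab monomial_def act_mult)
        qed
      qed
      hence "act (comb \<eta> monomial c) (delta_seq j) i
          = (\<Sum>k\<in>Poly_Mapping.keys c. if k = (i, j) then Poly_Mapping.lookup c k * P else 0)"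
        by (simp add: act_comb)
      also have "\<dots> = Poly_Mapping.lookup c (i, j) * P"
        by (simp add: in_keys_iff)
      finally show "Poly_Mapping.lookup c (i, j) = 0" using assms P(1) by simp
    qed
  qed
  thus ?thesis by (intro poly_mapping_eqI) (auto simp: split_paired_all)
qed

lemma act_faithful: "(\<And>n. act u (delta_seq n) = (\<lambda>_. 0)) \<Longrightarrow> u = 0"
  using monomial_span[of u] comb_monomial_faithful by fastforce

lemma comb_monomial_inj:
  assumes "comb \<eta> monomial c = comb \<eta> monomial d"
  shows "c = d"
proof -
  have "comb \<eta> monomial (c - d) = 0"
    using assms comb_add[of \<eta> monomial "c - d" d] by (simp add: scalar_add)
  hence "c - d = 0" by (intro comb_monomial_faithful) (simp add: act_0)
  thus ?thesis by simp
qed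

text \<open>An argument in the style of Schur's lemma: the constants are the sequences killed by
  \<open>y\<close>, so a central element acts on \<open>delta_seq 0\<close> by a scalar. As it
  commutes with \<open>x\<close>, which moves \<open>delta_seq 0\<close> to every
  \<open>delta_seq n\<close>, it acts everywhere by that scalar.\<close>

lemma center_scalar:
  assumes "u * x = x * u" "u * y = y * u"
  obtains c where "u = \<eta> c"
proof -
  define p where "p = act u (delta_seq 0)"
  have zero: "act u (\<lambda>_. 0) = (\<lambda>_. 0)"
    using act_scale[of u 0 "\<lambda>_. 0"] by simp
  have "act y p = act u (act y (delta_seq 0))"
    by (simp only: p_def act_mult[symmetric] assms)
  also have "act y (delta_seq 0) = (\<lambda>_. 0)" by (simp add: act_y fun_eq_iff)
  finally have "p (Suc n) = 0" for n
    using qcoeff_nonzero by (auto simp: zero act_y dest: fun_cong[of _ _ n])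
  hence p: "p = (\<lambda>m. p 0 * delta_seq 0 m)"
    by (auto simp: fun_eq_iff gr0_conv_Suc)
  have "act (u - \<eta> (p 0)) (delta_seq n) = (\<lambda>_. 0)" for n
  proof -
    have comm: "u * x ^ n = x ^ n * u"
      by (induction n) (simp_all add: mult.assoc[symmetric] assms(1), simp add: mult.assoc)
    have "act u (delta_seq n) = act (u * x ^ n) (delta_seq 0)"
      by (simp add: act_mult act_x_power)
    also have "\<dots> = act (x ^ n) p" unfolding comm by (simp add: act_mult p_def)
    also have "\<dots> = (\<lambda>m. p 0 * delta_seq n m)"
      by (subst p, subst act_scale) (simp add: act_x_power)
    finally show ?thesis by (simp add: fun_eq_iff act_diff act_scalar)
  qed
  hence "u - \<eta> (p 0) = 0" by (rule act_faithful)
  thus ?thesis using that by simp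
qed

section \<open>Coordinates, and linear maps given on the monomial basis\<close>

definition coord :: "'a \<Rightarrow> nat \<times> nat \<Rightarrow>\<^sub>0 'r" where
  "coord u = (THE c. u = comb \<eta> monomial c)"

lemma comb_coord: "comb \<eta> monomial (coord u) = u"
proof -
  have "\<exists>!c. u = comb \<eta> monomial c"
    using monomial_span comb_monomial_inj by metis
  from theI'[OF this] show ?thesis by (simp add: coord_def)
qed

lemma coord_add: "coord (u + v) = coord u + coord v"
  by (rule comb_monomial_inj) (simp add: comb_coord comb_add scalar_add)

lemma coord_monomial: "coord (\<eta> c * (x ^ i * y ^ j)) = Poly_Mapping.single (i, j) c"
  by (rule comb_monomial_inj) (simp add: comb_coord comb_single monomial_def)

definition extend_linear :: "(nat \<times> nat \<Rightarrow> 'a) \<Rightarrow> 'a \<Rightarrow> 'a" where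
  "extend_linear T u = comb \<eta> T (coord u)"

lemma extend_linear_add: "extend_linear T (u + v) = extend_linear T u + extend_linear T v"
  by (simp add: extend_linear_def coord_add comb_add scalar_add)

lemma extend_linear_diff: "extend_linear T (u - v) = extend_linear T u - extend_linear T v"
  using extend_linear_add[of T "u - v" v] by simp

lemma extend_linear_monomial: "extend_linear T (\<eta> c * (x ^ i * y ^ j)) = \<eta> c * T (i, j)"
  by (simp add: extend_linear_def coord_monomial comb_single)

lemma extend_linear_basis: "extend_linear T (x ^ i * y ^ j) = T (i, j)"
  using extend_linear_monomial[of T 1 i j] by (simp add: scalar_1)

lemma extend_linear_scale: "extend_linear T (\<eta> c * u) = \<eta> c * extend_linear T u"
proof (induction u rule: monomial_induct)
  case (scale_monomial d i j)
  show ?case using extend_linear_monomial[of T "c * d" i j]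
    by (simp add: extend_linear_monomial scalar_mult mult.assoc)
qed (simp add: distrib_left extend_linear_add)

end

subsection \<open>The two Weyl algebras\<close>

lemma free_alg_generated:
  fixes p :: "'r::comm_ring_1 free_alg"
  assumes "\<And>c. P (free_scalar c)" "P free_x" "P free_y"
    "\<And>a b. P a \<Longrightarrow> P b \<Longrightarrow> P (a + b)" "\<And>a b. P a \<Longrightarrow> P b \<Longrightarrow> P (a * b)"
  shows "P p"
proof (induction p rule: free_alg_induct)
  case zero
  show ?case using assms(1)[of 0] by (simp add: free_scalar_zero)
next
  case (single w c)
  have "P (Poly_Mapping.single (Word l) c)" for l
  proof (induction l)
    case Nil
    show ?case using assms(1)[of c] by (simp add: free_scalar_def zero_word_def)
  next
    case (Cons g l)
    have "Poly_Mapping.single (Word (g # l)) c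
        = Poly_Mapping.single (Word [g]) 1 * Poly_Mapping.single (Word l) c"
      by (simp add: mult_single plus_word_def)
    moreover have "P (Poly_Mapping.single (Word [g]) 1)"
      using assms(2,3) by (cases g) (simp_all add: free_x_def free_y_def)
    ultimately show ?case using Cons assms(5) by simp
  qed
  thus ?case by (cases w) simp
qed (use assms in blast)

lemma free_act_cong: "weyl_rel q a b \<Longrightarrow> free_act q a v = free_act q b v"
  using weyl_ideal_act[of "a - b" q v] free_act_add[of q "a - b" b v]
  by (simp add: weyl_rel_def fun_eq_iff)

lemma free_act_x: "free_act q free_x v = gen_act q GX v"
  and free_act_y: "free_act q free_y v = gen_act q GY v"
  by (simp_all add: fun_eq_iff free_x_def free_y_def free_act_single word_act_def)

lemma weyl_scalar_add: "weyl_scalar (a + b) = weyl_scalar a + weyl_scalar b"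
  and weyl_scalar_mult: "weyl_scalar (a * b) = weyl_scalar a * weyl_scalar b"
  and weyl_scalar_1: "weyl_scalar 1 = 1"
  by (simp_all add: weyl_scalar_def free_scalar_add free_scalar_mult free_scalar_one
      plus_weyl.abs_eq times_weyl.abs_eq one_weyl_def)

lemma weyl_scalar_central: "weyl_scalar c * a = a * weyl_scalar c"
  by (induction a rule: weyl.abs_induct)
    (simp add: weyl_scalar_def times_weyl.abs_eq free_scalar_central)

definition weyl_act :: "'k::comm_ring_1 weyl \<Rightarrow> (nat \<Rightarrow> 'k) \<Rightarrow> nat \<Rightarrow> 'k" where
  "weyl_act a = free_act 1 (rep_weyl a)"

lemma weyl_act_abs: "weyl_act (abs_weyl p) v = free_act 1 p v"
  unfolding weyl_act_def
  by (rule free_act_cong) (simp add: weyl.abs_eq_iff[symmetric] Quotient3_abs_rep[OF Quotient3_weyl])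

definition qweyl_act :: "'k::comm_ring_1 qweyl \<Rightarrow> (nat \<Rightarrow> 'k poly) \<Rightarrow> nat \<Rightarrow> 'k poly" where
  "qweyl_act a = free_act [:1, 1:] (rep_qweyl a)"

lemma qweyl_act_abs: "qweyl_act (abs_qweyl p) v = free_act [:1, 1:] p v"
  unfolding qweyl_act_def
  by (rule free_act_cong) (simp add: qweyl.abs_eq_iff[symmetric] Quotient3_abs_rep[OF Quotient3_qweyl])

lemma weyl_generated:
  fixes u :: "'k::comm_ring_1 weyl"
  assumes "\<And>c. P (weyl_scalar c)" "P weyl_x" "P weyl_y"
    "\<And>a b. P a \<Longrightarrow> P b \<Longrightarrow> P (a + b)" "\<And>a b. P a \<Longrightarrow> P b \<Longrightarrow> P (a * b)"
  shows "P u"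
proof (induction u rule: weyl.abs_induct)
  case (1 p)
  show ?case
    by (induction p rule: free_alg_generated)
      (use assms in \<open>simp_all add: weyl_scalar_def weyl_x_def weyl_y_def
        plus_weyl.abs_eq[symmetric] times_weyl.abs_eq[symmetric]\<close>)
qed

lemma qweyl_generated:
  fixes u :: "'k::comm_ring_1 qweyl"
  assumes "\<And>c. P (qweyl_scalar c)" "P qweyl_x" "P qweyl_y"
    "\<And>a b. P a \<Longrightarrow> P b \<Longrightarrow> P (a + b)" "\<And>a b. P a \<Longrightarrow> P b \<Longrightarrow> P (a * b)"
  shows "P u"
proof (induction u rule: qweyl.abs_induct)
  case (1 p)
  show ?case
    by (induction p rule: free_alg_generated)
      (use assms in \<open>simp_all add: qweyl_scalar_def qweyl_x_def qweyl_y_def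
        plus_qweyl.abs_eq[symmetric] times_qweyl.abs_eq[symmetric]\<close>)
qed

lemma qcoeff_1: "qcoeff 1 n = - of_nat (Suc n)"
  by (induction n) simp_all

lemma poly_qcoeff: "poly (qcoeff [:1, 1:] n) 0 = - of_nat (Suc n)"
  by (induction n) simp_all

interpretation W: quantum_weyl "weyl_scalar :: 'k::field_char_0 \<Rightarrow> _" weyl_x weyl_y 1 weyl_act
proof
  show "\<lbrakk>\<And>c. P (weyl_scalar c); P weyl_x; P weyl_y; \<And>u v. P u \<Longrightarrow> P v \<Longrightarrow> P (u + v);
      \<And>u v. P u \<Longrightarrow> P v \<Longrightarrow> P (u * v)\<rbrakk> \<Longrightarrow> P u" for P and u :: "'k weyl"
    by (rule weyl_generated)
  show "weyl_act (u + w) v n = weyl_act u v n + weyl_act w v n"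
    and "weyl_act (u * w) v = weyl_act u (weyl_act w v)" for u w :: "'k weyl" and v n
    by (induction u rule: weyl.abs_induct, induction w rule: weyl.abs_induct,
        simp add: plus_weyl.abs_eq times_weyl.abs_eq weyl_act_abs free_act_add free_act_mult)+
  show "weyl_act u (\<lambda>n. c * v n) = (\<lambda>n. c * weyl_act u v n)" for u :: "'k weyl" and c v
    by (simp add: weyl_act_def free_act_lin)
  \<comment> \<open>At \<open>q = 1\<close> this is a negated positive integer, nonzero in
    characteristic zero.\<close>
  show "qcoeff (1::'k) n \<noteq> 0" for n
    unfolding qcoeff_1 by (simp del: of_nat_Suc)
  show "weyl_act (weyl_scalar c) v = (\<lambda>n. c * v n)" for c :: 'k and v
    by (simp add: weyl_scalar_def weyl_act_abs free_act_scalar)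
  show "weyl_act weyl_x v = gen_act 1 GX v" "weyl_act weyl_y v = gen_act 1 GY v"
    for v :: "nat \<Rightarrow> 'k"
    by (simp_all add: weyl_x_def weyl_y_def weyl_act_abs free_act_x free_act_y)
qed (rule weyl_scalar_add weyl_scalar_mult weyl_scalar_1 weyl_scalar_central |
    simp add: weyl_scalar_1 weyl_relation)+

interpretation Q: quantum_weyl "qweyl_scalar :: 'k::field_char_0 poly \<Rightarrow> _" qweyl_x qweyl_y
  "[:1, 1:]" qweyl_act
proof
  show "\<lbrakk>\<And>c. P (qweyl_scalar c); P qweyl_x; P qweyl_y; \<And>u v. P u \<Longrightarrow> P v \<Longrightarrow> P (u + v);
      \<And>u v. P u \<Longrightarrow> P v \<Longrightarrow> P (u * v)\<rbrakk> \<Longrightarrow> P u" for P and u :: "'k qweyl"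
    by (rule qweyl_generated)
  show "qweyl_act (u + w) v n = qweyl_act u v n + qweyl_act w v n"
    and "qweyl_act (u * w) v = qweyl_act u (qweyl_act w v)" for u w :: "'k qweyl" and v n
    by (induction u rule: qweyl.abs_induct, induction w rule: qweyl.abs_induct,
        simp add: plus_qweyl.abs_eq times_qweyl.abs_eq qweyl_act_abs free_act_add free_act_mult)+
  show "qweyl_act u (\<lambda>n. c * v n) = (\<lambda>n. c * qweyl_act u v n)" for u :: "'k qweyl" and c v
    by (simp add: qweyl_act_def free_act_lin)
  \<comment> \<open>A q-integer specialises at \<hbar> = 0 to an ordinary positive integer, so it is
    not the zero polynomial.\<close>
  show "qcoeff [:1, 1 :: 'k:] n \<noteq> 0" for n
  proof
    assume "qcoeff [:1, 1 :: 'k:] n = 0"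
    with poly_qcoeff[of n, where ?'a = 'k] have "- of_nat (Suc n) = (0 :: 'k)"
      by (simp del: of_nat_Suc)
    thus False by (simp del: of_nat_Suc)
  qed
  show "qweyl_act (qweyl_scalar c) v = (\<lambda>n. c * v n)" for c :: "'k poly" and v
    by (simp add: qweyl_scalar_def qweyl_act_abs free_act_scalar)
  show "qweyl_act qweyl_x v = gen_act [:1, 1:] GX v" "qweyl_act qweyl_y v = gen_act [:1, 1:] GY v"
    for v :: "nat \<Rightarrow> 'k poly"
    by (simp_all add: qweyl_x_def qweyl_y_def qweyl_act_abs free_act_x free_act_y)
qed (rule qweyl_scalar_add qweyl_scalar_mult qweyl_scalar_one qweyl_scalar_central qweyl_relation)+

section \<open>Vanishing for the Weyl algebra\<close>

lemma cochains_tl: "f \<in> cochains \<eta> \<Longrightarrow> (\<lambda>xs. f (a # xs)) \<in> cochains \<eta>"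
  unfolding cochains_iff bounded_cochain_def
  by (metis multilinear_tl length_Cons less_SucI)

lemma normalised_iff: "normalised f \<longleftrightarrow> (\<forall>i. normalised_below i f)"
  unfolding normalised_def normalised_below_def by blast

lemma normalisedD: "normalised f \<Longrightarrow> f (us @ 1 # vs) = 0" "normalised f \<Longrightarrow> f (1 # vs) = 0"
  unfolding normalised_def by (blast, metis append_Nil)

lemma normalised_tl: "normalised f \<Longrightarrow> normalised (\<lambda>xs. f (a # xs))"
  unfolding normalised_def by (metis append_Cons)

lemma normalised_coboundary: "normalised f \<Longrightarrow> normalised (coboundary f)"
  by (simp add: normalised_iff normalised_below_coboundary)

lemma rmul_normalised:
  assumes "normalised f"
  shows "rmul f (1 # vs) = f vs" "us \<noteq> [] \<Longrightarrow> rmul f (us @ 1 # vs) = 0"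
  using assms rmul_one[of f vs] rmul_normalised_below[of "Suc (length us)" f us vs]
  by (simp_all add: normalised_iff)

lemma normalised_diff: "normalised f \<Longrightarrow> normalised g \<Longrightarrow> normalised (\<lambda>xs. f xs - g xs)"
  by (simp add: normalised_def)

context central_scalars
begin

lemma cocycles_diff_coboundary:
  "f \<in> cocycles \<Longrightarrow> g \<in> cochains \<eta> \<Longrightarrow> (\<lambda>xs. f xs - coboundary g xs) \<in> cocycles"
  by (auto simp: cochains_diff cochains_coboundary coboundary_diff intro!: ext)

lemma multilinear_lmult:
  assumes "multilinear \<eta> f"
  shows "multilinear \<eta> (\<lambda>xs. c * f xs)"
proof (rule multilinearI)
  show "c * f (us @ (\<eta> r * a) # vs) = \<eta> r * (c * f (us @ a # vs))" for us vs r a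
    using multilinear_app(2)[OF assms] by (metis central mult.assoc)
qed (simp add: multilinear_app(1)[OF assms] distrib_left)

end

section \<open>Cochains given by their values on basis elements in the first argument\<close>

context quantum_weyl
begin

lemma extend_linear_pointwise_add:
  "extend_linear (\<lambda>k. S k + T k) u = extend_linear S u + extend_linear T u"
  by (simp add: extend_linear_def comb_def distrib_left sum.distrib)

lemma extend_linear_pointwise_scale:
  "extend_linear (\<lambda>k. \<eta> c * T k) u = \<eta> c * extend_linear T u"
  unfolding extend_linear_def comb_def sum_distrib_left by (intro sum.cong refl scalar_commute)

lemma extend_linear_0 [simp]: "extend_linear (\<lambda>k. 0) u = 0"
  by (simp add: extend_linear_def comb_def)

text \<open>Allows a primitive to be prescribed separately for each basis element in the first
  argument, as a cochain \<open>G k\<close> of the remaining ones; \<open>g\<close> is its component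
  in degree zero.\<close>

definition extend_head :: "(nat \<times> nat \<Rightarrow> 'a list \<Rightarrow> 'a) \<Rightarrow> 'a \<Rightarrow> 'a list \<Rightarrow> 'a" where
  "extend_head G g xs = (case xs of [] \<Rightarrow> g | b # cs \<Rightarrow> extend_linear (\<lambda>k. G k cs) b)"

lemma extend_head_Nil [simp]: "extend_head G g [] = g"
  by (simp add: extend_head_def)

lemma extend_head_monomial: "extend_head G g ((x ^ i * y ^ j) # cs) = G (i, j) cs"
  by (simp add: extend_head_def extend_linear_basis)

lemma extend_head_1: "extend_head G g (1 # cs) = G (0, 0) cs"
  and extend_head_x: "extend_head G g (x # cs) = G (1, 0) cs"
  and extend_head_y: "extend_head G g (y ^ j # cs) = G (0, j) cs"
  using extend_head_monomial[of G g 0 0 cs] extend_head_monomial[of G g 1 0 cs]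
    extend_head_monomial[of G g 0 j cs] by simp_all

lemma cochains_extend_head:
  assumes "\<And>k. multilinear \<eta> (G k)" "\<And>k. bounded_cochain N (G k)"
  shows "extend_head G g \<in> cochains \<eta>"
proof -
  have "bounded_cochain (Suc N) (extend_head G g)"
    using assms(2) by (auto simp: bounded_cochain_def extend_head_def split: list.split)
  moreover have "multilinear \<eta> (extend_head G g)"
  proof (rule multilinearI)
    show "extend_head G g (us @ (a + b) # vs) = extend_head G g (us @ a # vs) + extend_head G g (us @ b # vs)"
      for us vs a b
      using multilinear_app(1)[OF assms(1)]
      by (cases us) (simp_all add: extend_head_def extend_linear_add extend_linear_pointwise_add)
    show "extend_head G g (us @ (\<eta> r * a) # vs) = \<eta> r * extend_head G g (us @ a # vs)" for us vs r a
      using multilinear_app(2)[OF assms(1)]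
      by (cases us) (simp_all add: extend_head_def extend_linear_scale extend_linear_pointwise_scale)
  qed
  ultimately show ?thesis by (auto simp: cochains_iff)
qed

lemma normalised_extend_head:
  assumes "\<And>k. normalised (G k)" "\<And>cs. G (0, 0) cs = 0"
  shows "normalised (extend_head G g)"
  unfolding normalised_def
proof (intro allI)
  fix us vs
  show "extend_head G g (us @ 1 # vs) = 0"
    by (cases us) (simp_all add: extend_head_1 assms(2), simp add: extend_head_def normalisedD(1)[OF assms(1)])
qed

lemma cochain_eq_0_hd:
  assumes "f \<in> cochains \<eta>" "\<And>i j. f ((x ^ i * y ^ j) # cs) = 0"
  shows "f (b # cs) = 0"
  using assms by (induction b rule: monomial_induct) (simp_all add: cochains_iff multilinear_hd[of \<eta>])

lemma cocycle_eq_0: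
  assumes f: "f \<in> cocycles" and n: "normalised f" and "f [] = 0"
    and x: "\<And>cs. f (x # cs) = 0" and y: "\<And>cs. f (y # cs) = 0"
  shows "f = (\<lambda>_. 0)"
proof -
  have mult: "f ((a * b) # cs) = a * f (b # cs) + rmul (\<lambda>xs. f (a # xs)) (b # cs)" for a b cs
    using cocycle_mult f by blast
  have "f (y ^ j # cs) = 0" for j cs
    by (induction j) (simp_all add: normalisedD(2)[OF n] mult y)
  hence "f ((x ^ i * y ^ j) # cs) = 0" for i j cs
    by (induction i) (simp_all add: mult[of x] x mult.assoc)
  hence "f (b # cs) = 0" for b cs using cochain_eq_0_hd f by blast
  hence "f xs = 0" for xs using assms(3) by (cases xs) auto
  thus ?thesis by blast
qed

end

section \<open>Commutators with the generators of the Weyl algebra\<close>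

lemma weyl_scalar_0 [simp]: "weyl_scalar 0 = 0"
  using weyl_scalar_add[of 0 0] by simp

lemma of_nat_weyl: "of_nat n = weyl_scalar (of_nat n)"
  by (induction n) (simp_all add: weyl_scalar_add weyl_scalar_1)

lemma of_nat_left_commute: "(a :: 'a::ring_1) * (of_nat n * b) = of_nat n * (a * b)"
  by (metis mult.assoc mult_of_nat_commute)

context
  fixes x y :: "'a::ring_1"
  assumes yx: "y * x = x * y - 1"
begin

lemma weyl_y_power_x: "y ^ j * x = x * y ^ j - of_nat j * y ^ (j - 1)"
proof (induction j)
  case (Suc j)
  have "y ^ Suc j * x = y * (x * y ^ j - of_nat j * y ^ (j - 1))"
    by (simp only: power_Suc mult.assoc Suc)
  also have "\<dots> = y * x * y ^ j - of_nat j * (y * y ^ (j - 1))"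
    by (simp only: right_diff_distrib mult.assoc of_nat_left_commute)
  also have "of_nat j * (y * y ^ (j - 1)) = of_nat j * y ^ j"
    by (cases j) simp_all
  finally show ?case by (simp add: yx left_diff_distrib distrib_right mult.assoc)
qed simp

lemma weyl_y_x_power: "y * x ^ i = x ^ i * y - of_nat i * x ^ (i - 1)"
proof (induction i)
  case (Suc i)
  have "y * x ^ Suc i = (x * y - 1) * x ^ i"
    by (simp add: mult.assoc[symmetric] yx)
  also have "\<dots> = x * (x ^ i * y - of_nat i * x ^ (i - 1)) - x ^ i"
    by (simp only: left_diff_distrib mult.assoc Suc mult_1_left)
  also have "\<dots> = x ^ Suc i * y - of_nat i * (x * x ^ (i - 1)) - x ^ i"
    by (simp only: right_diff_distrib power_Suc mult.assoc of_nat_left_commute)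
  also have "of_nat i * (x * x ^ (i - 1)) = of_nat i * x ^ i"
    by (cases i) simp_all
  finally show ?case by (simp add: distrib_right algebra_simps)
qed simp

text \<open>On ordered monomials the commutator with \<open>x\<close> is the partial derivative in
  \<open>y\<close>; at \<open>j = 0\<close> the factor \<open>of_nat j\<close> covers the truncated
  exponent.\<close>

lemma weyl_commutator_x: "x * (x ^ i * y ^ j) - x ^ i * y ^ j * x = of_nat j * (x ^ i * y ^ (j - 1))"
proof -
  have "x ^ i * y ^ j * x = x ^ i * x * y ^ j - x ^ i * (of_nat j * y ^ (j - 1))"
    by (simp only: mult.assoc weyl_y_power_x right_diff_distrib)
  also have "\<dots> = x * (x ^ i * y ^ j) - of_nat j * (x ^ i * y ^ (j - 1))"
    by (simp only: power_commutes mult.assoc of_nat_left_commute)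
  finally show ?thesis by simp
qed

end

lemma weyl_y_x: "weyl_y * weyl_x = weyl_x * weyl_y - 1"
  unfolding weyl_relation[symmetric] by simp

lemma weyl_scalar_inverse: "weyl_scalar (inverse (of_nat (Suc n)) :: 'k::field_char_0) * of_nat (Suc n) = 1"
proof -
  have "inverse (of_nat (Suc n) :: 'k) * of_nat (Suc n) = 1"
    by (rule left_inverse) (simp del: of_nat_Suc)
  thus ?thesis by (simp only: of_nat_weyl weyl_scalar_mult[symmetric] weyl_scalar_1)
qed

text \<open>Integration in \<open>y\<close>, which divides by \<open>j + 1\<close>.\<close>

lemma weyl_commutator_x_surj: "\<exists>r. weyl_x * r - r * weyl_x = (u :: 'k::field_char_0 weyl)"
proof (induction u rule: W.monomial_induct)
  case (scale_monomial c i j)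
  let ?c = "weyl_scalar (c * inverse (of_nat (Suc j)))"
  let ?r = "?c * (weyl_x ^ i * weyl_y ^ Suc j)"
  have "weyl_x * ?r - ?r * weyl_x
      = ?c * (weyl_x * (weyl_x ^ i * weyl_y ^ Suc j) - weyl_x ^ i * weyl_y ^ Suc j * weyl_x)"
    by (simp only: W.scalar_commute right_diff_distrib mult.assoc)
  also have "\<dots> = ?c * (of_nat (Suc j) * (weyl_x ^ i * weyl_y ^ j))"
    unfolding weyl_commutator_x[OF weyl_y_x] by simp
  also have "\<dots> = weyl_scalar c * (weyl_scalar (inverse (of_nat (Suc j))) * of_nat (Suc j))
      * (weyl_x ^ i * weyl_y ^ j)"
    by (simp only: weyl_scalar_mult mult.assoc)
  finally show ?case by (simp only: weyl_scalar_inverse mult_1_right) blast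
next
  case (add a b)
  then obtain r s where "weyl_x * r - r * weyl_x = a" "weyl_x * s - s * weyl_x = b" by blast
  hence "weyl_x * (r + s) - (r + s) * weyl_x = a + b" by (auto simp: algebra_simps)
  thus ?case by blast
qed

text \<open>
  An antiderivative in \<open>y\<close> inverts the commutator with \<open>x\<close> up to the projection to polynomials
  in \<open>x\<close>.
\<close>

lemma weyl_centralizer_x:
  fixes u :: "'k::field_char_0 weyl"
  assumes "weyl_x * u = u * weyl_x"
  obtains g where "weyl_x * g = g * weyl_x" "weyl_y * g - g * weyl_y = u"
proof -
  define J where "J = W.extend_linear
    (\<lambda>(i, j). weyl_scalar (inverse (of_nat (Suc j)) :: 'k) * (weyl_x ^ i * weyl_y ^ Suc j))"
  define P where "P = W.extend_linear (\<lambda>(i, j). if j = 0 then (weyl_x :: 'k weyl) ^ i else 0)"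
  have J: "J (weyl_x * u - u * weyl_x) = u - P u" for u
  proof (induction u rule: W.monomial_induct)
    case (scale_monomial c i j)
    have "J (weyl_x * (weyl_scalar c * (weyl_x ^ i * weyl_y ^ j)) - weyl_scalar c * (weyl_x ^ i * weyl_y ^ j) * weyl_x)
        = weyl_scalar c * J (weyl_x * (weyl_x ^ i * weyl_y ^ j) - weyl_x ^ i * weyl_y ^ j * weyl_x)"
      by (simp only: W.scalar_commute mult.assoc right_diff_distrib[symmetric])
        (simp only: J_def W.extend_linear_scale)
    also have "J (weyl_x * (weyl_x ^ i * weyl_y ^ j) - weyl_x ^ i * weyl_y ^ j * weyl_x)
        = weyl_x ^ i * weyl_y ^ j - P (weyl_x ^ i * weyl_y ^ j)"
    proof (cases j)
      case 0
      have "J 0 = 0" using W.extend_linear_diff[of _ 0 0] by (simp add: J_def)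
      moreover have "P (weyl_x ^ i * weyl_y ^ 0) = weyl_x ^ i" unfolding P_def W.extend_linear_basis by simp
      ultimately show ?thesis unfolding weyl_commutator_x[OF weyl_y_x] by (simp add: 0)
    next
      case (Suc l)
      have "J (of_nat j * (weyl_x ^ i * weyl_y ^ l))
          = of_nat j * (weyl_scalar (inverse (of_nat j)) * (weyl_x ^ i * weyl_y ^ j))"
        unfolding J_def of_nat_weyl W.extend_linear_scale W.extend_linear_basis by (simp add: Suc)
      also have "\<dots> = weyl_scalar (inverse (of_nat j)) * of_nat j * (weyl_x ^ i * weyl_y ^ j)"
        by (simp only: mult.assoc of_nat_left_commute)
      also have "\<dots> = weyl_x ^ i * weyl_y ^ j" unfolding Suc weyl_scalar_inverse by simp
      finally have "J (of_nat j * (weyl_x ^ i * weyl_y ^ l)) = weyl_x ^ i * weyl_y ^ j" .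
      moreover have "P (weyl_x ^ i * weyl_y ^ j) = 0" unfolding P_def W.extend_linear_basis by (simp add: Suc)
      ultimately show ?thesis unfolding weyl_commutator_x[OF weyl_y_x] by (simp add: Suc)
    qed
    finally show ?case by (simp only: P_def W.extend_linear_scale right_diff_distrib)
  next
    case (add a b)
    have "weyl_x * (a + b) - (a + b) * weyl_x = (weyl_x * a - a * weyl_x) + (weyl_x * b - b * weyl_x)"
      by (simp add: algebra_simps)
    hence "J (weyl_x * (a + b) - (a + b) * weyl_x) = J (weyl_x * a - a * weyl_x) + J (weyl_x * b - b * weyl_x)"
      by (simp only: J_def W.extend_linear_add)
    with add show ?case by (simp add: P_def W.extend_linear_add)
  qed
  have "J 0 = 0" using W.extend_linear_diff[of _ 0 0] by (simp add: J_def)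
  with J[of u] assms have "u = P u" by simp
  \<comment> \<open>On polynomials in \<open>x\<close> the commutator with \<open>y\<close> is minus
    the derivative, so minus an antiderivative in \<open>x\<close> solves the equation, and it
    commutes with \<open>x\<close>.\<close>
  moreover have "\<exists>g. weyl_x * g = g * weyl_x \<and> weyl_y * g - g * weyl_y = P u" for u
  proof (induction u rule: W.monomial_induct)
    case (scale_monomial c i j)
    let ?g = "weyl_scalar (- c * inverse (of_nat (Suc i))) * weyl_x ^ Suc i"
    show ?case
    proof (cases j)
      case 0
      have gx: "weyl_x * ?g = ?g * weyl_x"
        by (simp only: W.scalar_commute mult.assoc power_Suc2[symmetric] power_Suc[symmetric])
      have "weyl_y * ?g - ?g * weyl_y
          = weyl_scalar (- c * inverse (of_nat (Suc i))) * (weyl_y * weyl_x ^ Suc i - weyl_x ^ Suc i * weyl_y)"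
        by (simp only: W.scalar_commute mult.assoc right_diff_distrib)
      also have "weyl_y * weyl_x ^ Suc i - weyl_x ^ Suc i * weyl_y = - (of_nat (Suc i) * weyl_x ^ i)"
        unfolding weyl_y_x_power[OF weyl_y_x] by (simp del: of_nat_Suc)
      also have "weyl_scalar (- c * inverse (of_nat (Suc i))) * - (of_nat (Suc i) * weyl_x ^ i)
          = - (weyl_scalar (- c) * (weyl_scalar (inverse (of_nat (Suc i))) * of_nat (Suc i)) * weyl_x ^ i)"
        by (simp only: mult_minus_right weyl_scalar_mult mult.assoc)
      also have "\<dots> = weyl_scalar c * weyl_x ^ i"
        unfolding weyl_scalar_inverse by (simp add: W.scalar_uminus)
      finally have "weyl_y * ?g - ?g * weyl_y = weyl_scalar c * weyl_x ^ i" .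
      moreover have "P (weyl_scalar c * (weyl_x ^ i * weyl_y ^ j)) = weyl_scalar c * weyl_x ^ i"
        unfolding P_def W.extend_linear_monomial by (simp add: 0)
      ultimately show ?thesis using gx by metis
    next
      case (Suc l)
      have "P (weyl_scalar c * (weyl_x ^ i * weyl_y ^ j)) = 0"
        unfolding P_def W.extend_linear_monomial by (simp add: Suc)
      thus ?thesis by (intro exI[of _ 0]) simp
    qed
  next
    case (add a b)
    then obtain g h where "weyl_x * g = g * weyl_x" "weyl_y * g - g * weyl_y = P a"
      "weyl_x * h = h * weyl_x" "weyl_y * h - h * weyl_y = P b" by blast
    moreover have "P (a + b) = P a + P b" by (simp add: P_def W.extend_linear_add)
    ultimately show ?case
      by (intro exI[of _ "g + h"]) (simp add: distrib_left distrib_right algebra_simps)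
  qed
  ultimately show ?thesis using that by metis
qed

text \<open>The value at first argument \<open>x ^ i * y ^ j\<close> of a primitive \<open>r\<close>
  with \<open>r (x # cs) = 0\<close>. Under this condition
  \<open>coboundary r (x # b # cs) = u (b # cs)\<close> reads
  \<open>r ((x * b) # cs) = x * r (b # cs) - u (b # cs)\<close>, a recursion upwards in
  \<open>i\<close>. The start at \<open>i = 0\<close> is free; zero keeps \<open>r\<close>
  normalised.\<close>

primrec transport_x :: "('k::field_char_0 weyl list \<Rightarrow> 'k weyl) \<Rightarrow> nat \<Rightarrow> nat \<Rightarrow> 'k weyl list \<Rightarrow> 'k weyl" where
  "transport_x u j 0 cs = 0"
| "transport_x u j (Suc i) cs = weyl_x * transport_x u j i cs - u ((weyl_x ^ i * weyl_y ^ j) # cs)"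

text \<open>The commutator with \<open>x\<close> is surjective on normalised cochains. This serves
  twice: to make a cocycle vanish at \<open>x\<close>, and to find the value at \<open>y\<close> of
  the primitive in the second stage.\<close>

lemma solve_x:
  fixes u :: "'k::field_char_0 weyl list \<Rightarrow> 'k weyl"
  assumes u: "u \<in> cochains weyl_scalar" "normalised u"
  obtains r where "r \<in> cochains weyl_scalar" "normalised r" "\<And>bs. coboundary r (weyl_x # bs) = u bs"
proof -
  obtain r0 where r0: "weyl_x * r0 - r0 * weyl_x = u []" using weyl_commutator_x_surj by blast
  define G where "G = (\<lambda>k. transport_x u (snd k) (fst k))"
  define r where "r = W.extend_head G r0"
  have lin: "multilinear weyl_scalar u" using u by (simp add: cochains_iff)
  obtain N where N: "bounded_cochain N u" using u by (auto simp: cochains_iff)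
  have "multilinear weyl_scalar (transport_x u j i)" for i j
    by (induction i)
      (simp_all add: multilinear_0 diff_conv_add_uminus multilinear_add multilinear_uminus multilinear_tl
        W.multilinear_lmult lin del: add_uminus_conv_diff)
  moreover have "bounded_cochain N (transport_x u j i)" for i j
    using N by (induction i) (auto simp: bounded_cochain_def)
  ultimately have r: "r \<in> cochains weyl_scalar"
    unfolding r_def G_def by (intro W.cochains_extend_head)
  hence rlin: "multilinear weyl_scalar r" by (simp add: cochains_iff)
  have "normalised (transport_x u j i)" for i j
  proof -
    have "transport_x u j i (us @ 1 # vs) = 0" for us vs
      using normalisedD(1)[OF u(2), of "_ # us"] by (induction i) auto
    thus ?thesis by (simp add: normalised_def)
  qed
  hence n: "normalised r" unfolding r_def by (intro W.normalised_extend_head) (simp_all add: G_def)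
  have shift: "r ((weyl_x * b) # cs) = weyl_x * r (b # cs) - u (b # cs)" for b cs
  proof (induction b rule: W.monomial_induct)
    case (scale_monomial c i j)
    have "r ((weyl_x * (weyl_x ^ i * weyl_y ^ j)) # cs)
        = weyl_x * r ((weyl_x ^ i * weyl_y ^ j) # cs) - u ((weyl_x ^ i * weyl_y ^ j) # cs)"
      using W.extend_head_monomial[of G r0 "Suc i" j cs]
      by (simp add: r_def W.extend_head_monomial G_def mult.assoc)
    thus ?case
      by (simp only: W.scalar_commute multilinear_hd(2)[OF rlin] multilinear_hd(2)[OF lin] right_diff_distrib)
  next
    case (add a b)
    thus ?case by (simp add: distrib_left multilinear_hd[OF rlin] multilinear_hd[OF lin])
  qed
  \<comment> \<open>The condition under which the recursion was derived, recovered from its first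
    step, as \<open>r\<close> and \<open>u\<close> vanish at a leading unit.\<close>
  have x: "(\<lambda>cs. r (weyl_x # cs)) = (\<lambda>_. 0)"
    using shift[of 1] normalisedD(2)[OF n] normalisedD(2)[OF u(2)] by (simp add: fun_eq_iff)
  have "coboundary r (weyl_x # bs) = u bs" for bs
    by (cases bs) (simp_all add: coboundary_Cons x shift, simp add: r_def r0)
  thus ?thesis using that r n by blast
qed

text \<open>Apply \<open>f\<close> to the relation \<open>x * y - y * x = 1\<close> in the first
  argument. The value at 1 is zero by normalisation, and as \<open>f\<close> vanishes at
  \<open>x\<close>, the derivation rule leaves just the commutator of \<open>x\<close> with
  \<open>f (y # _)\<close>.\<close>

lemma coboundary_tl_y:
  fixes f :: "'k::field_char_0 weyl list \<Rightarrow> 'k weyl"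
  assumes f: "f \<in> W.cocycles" "normalised f" "\<And>cs. f (weyl_x # cs) = 0"
  shows "coboundary (\<lambda>xs. f (weyl_y # xs)) (weyl_x # cs) = 0"
proof -
  have mult: "f ((a * b) # cs) = a * f (b # cs) + rmul (\<lambda>xs. f (a # xs)) (b # cs)" for a b cs
    using cocycle_mult f by blast
  have "multilinear weyl_scalar f" using f by (simp add: cochains_iff)
  from multilinear_diff_hd[OF this, of "weyl_x * weyl_y" "weyl_y * weyl_x" cs]
  have "f ((weyl_x * weyl_y) # cs) - f ((weyl_y * weyl_x) # cs) = 0"
    unfolding weyl_relation normalisedD(2)[OF f(2)] by simp
  thus ?thesis by (simp add: mult f(3) coboundary_Cons)
qed

text \<open>The value at first argument \<open>y ^ j\<close> of a primitive whose value at
  \<open>y\<close> is \<open>r\<close>: the recursion is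
  \<open>coboundary g (y # y ^ j # cs) = F (y ^ j # cs)\<close> solved for
  \<open>g (y ^ Suc j # cs)\<close>.\<close>

primrec transport_y ::
  "('k::field_char_0 weyl list \<Rightarrow> 'k weyl) \<Rightarrow> ('k weyl list \<Rightarrow> 'k weyl) \<Rightarrow> nat \<Rightarrow> 'k weyl list \<Rightarrow> 'k weyl" where
  "transport_y r F 0 cs = 0"
| "transport_y r F (Suc j) cs
    = weyl_y * transport_y r F j cs + rmul r (weyl_y ^ j # cs) - F (weyl_y ^ j # cs)"

lemma cocycle_vanishing_x_is_coboundary:
  fixes f :: "'k::field_char_0 weyl list \<Rightarrow> 'k weyl"
  assumes f: "f \<in> W.cocycles" "normalised f" "\<And>cs. f (weyl_x # cs) = 0" "f [] = 0"
  obtains g where "g \<in> cochains weyl_scalar" "f = coboundary g"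
proof -
  define F where "F = (\<lambda>bs. f (weyl_y # bs))"
  have F: "F \<in> cochains weyl_scalar" "normalised F"
    using f by (simp_all add: F_def cochains_tl normalised_tl)
  have dF: "coboundary F (weyl_x # cs) = 0" for cs
    using coboundary_tl_y[OF f(1-3)] by (simp add: F_def)
  have "weyl_x * F [] = F [] * weyl_x" using dF[of "[]"] by (simp add: coboundary_Cons)
  \<comment> \<open>In degree zero the primitive has to commute with \<open>x\<close>, or its
    coboundary would no longer vanish at \<open>x\<close>.\<close>
  then obtain g0 where g0: "weyl_x * g0 = g0 * weyl_x" "weyl_y * g0 - g0 * weyl_y = F []"
    by (rule weyl_centralizer_x)
  have "(\<lambda>bs. - F (weyl_x # bs)) \<in> cochains weyl_scalar" "normalised (\<lambda>bs. - F (weyl_x # bs))"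
    using F normalised_tl[of F weyl_x] by (simp_all add: cochains_uminus cochains_tl normalised_def)
  \<comment> \<open>The prescribed commutator is the one that makes \<open>f - coboundary g\<close>
    vanish at \<open>y\<close> followed by \<open>x\<close>; the recursion in
    \<open>transport_y\<close> takes care only of \<open>y\<close> followed by powers of
    \<open>y\<close>.\<close>
  then obtain r where r: "r \<in> cochains weyl_scalar" "normalised r"
    and dr: "\<And>bs. coboundary r (weyl_x # bs) = - F (weyl_x # bs)"
    by (rule solve_x) blast
  define G where "G = (\<lambda>(i, j) cs. weyl_x ^ i * transport_y r F j cs)"
  define g where "g = W.extend_head G g0"
  have lin: "multilinear weyl_scalar r" "multilinear weyl_scalar F"
    using r F by (simp_all add: cochains_iff)
  obtain N M where N: "bounded_cochain N (rmul r)" "bounded_cochain M F"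
    using r F bounded_rmul by (auto simp: cochains_iff)
  have "multilinear weyl_scalar (transport_y r F j)" for j
    by (induction j)
      (simp_all add: multilinear_0 diff_conv_add_uminus multilinear_add multilinear_uminus multilinear_tl
        W.multilinear_lmult multilinear_rmul[OF lin(1) W.central] lin del: add_uminus_conv_diff)
  hence "multilinear weyl_scalar (G k)" for k
    by (cases k) (simp add: G_def W.multilinear_lmult)
  moreover have "bounded_cochain (max N M) (transport_y r F j)" for j
    using N by (induction j) (auto simp: bounded_cochain_def)
  hence "bounded_cochain (max N M) (G k)" for k
    by (cases k) (simp add: G_def bounded_cochain_def)
  ultimately have g: "g \<in> cochains weyl_scalar"
    unfolding g_def by (intro W.cochains_extend_head)
  hence glin: "multilinear weyl_scalar g" by (simp add: cochains_iff)
  have "transport_y r F j (us @ 1 # vs) = 0" for j us vs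
    using rmul_normalised(2)[OF r(2), of "_ # us"] normalisedD(1)[OF F(2), of "_ # us"]
    by (induction j) auto
  hence "normalised (G k)" for k by (cases k) (simp add: G_def normalised_def)
  hence n: "normalised g" unfolding g_def by (intro W.normalised_extend_head) (simp_all add: G_def)
  have shift: "g ((weyl_x * b) # cs) = weyl_x * g (b # cs)" for b cs
  proof (induction b rule: W.monomial_induct)
    case (scale_monomial c i j)
    have "g ((weyl_x * (weyl_x ^ i * weyl_y ^ j)) # cs) = weyl_x * g ((weyl_x ^ i * weyl_y ^ j) # cs)"
      using W.extend_head_monomial[of G g0 "Suc i" j cs]
      by (simp add: g_def W.extend_head_monomial G_def mult.assoc)
    thus ?case by (simp only: W.scalar_commute multilinear_hd(2)[OF glin])
  next
    case (add a b)
    thus ?case by (simp add: distrib_left multilinear_hd[OF glin])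
  qed
  have gx: "(\<lambda>cs. g (weyl_x # cs)) = (\<lambda>_. 0)"
    by (simp add: g_def W.extend_head_x G_def)
  have gyj: "g (weyl_y ^ j # cs) = transport_y r F j cs" for j cs
    by (simp add: g_def W.extend_head_y G_def)
  \<comment> \<open>The first step of the recursion starts at the unit, where \<open>F\<close>
    vanishes and the right action gives back \<open>r\<close>; so the value at \<open>y\<close> is
    the intended one.\<close>
  have gy: "(\<lambda>cs. g (weyl_y # cs)) = r"
    using gyj[of 1] by (simp add: fun_eq_iff rmul_normalised(1)[OF r(2)] normalisedD(2)[OF F(2)])
  define h where "h = (\<lambda>xs. f xs - coboundary g xs)"
  have h: "h \<in> W.cocycles" "normalised h"
    unfolding h_def
    by (intro W.cocycles_diff_coboundary normalised_diff normalised_coboundary f g n)+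
  have hx: "h (weyl_x # cs) = 0" for cs
    by (cases cs) (simp_all add: h_def f(3) coboundary_Cons shift gx, simp add: g_def g0)
  define H where "H = (\<lambda>cs. h (weyl_y # cs))"
  have H: "H \<in> cochains weyl_scalar" using h by (simp add: H_def cochains_tl)
  have H_Nil: "H [] = 0"
  proof -
    have "H [] = F [] - (weyl_y * g0 - g0 * weyl_y)"
      by (simp add: H_def h_def coboundary_Cons F_def) (simp add: g_def)
    thus ?thesis by (simp add: g0)
  qed
  have Hy: "H (weyl_y ^ j # cs) = 0" for j cs
    using gyj[of "Suc j"] by (simp add: H_def h_def coboundary_Cons gy gyj) (simp add: F_def)
  have "H (weyl_x # cs) = 0" for cs
  proof -
    \<comment> \<open>Reordering \<open>y * x\<close> as \<open>x * y - 1\<close> turns the term of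
      \<open>coboundary g\<close> that merges \<open>y\<close> with \<open>x\<close> into
      \<open>x * r cs\<close>. With \<open>rmul r (x # cs)\<close> it forms the commutator of
      \<open>x\<close> and \<open>r\<close>, which cancels \<open>F (x # cs)\<close>.\<close>
    have "g ((weyl_y * weyl_x) # cs) = weyl_x * r cs"
      using fun_cong[OF gy, of cs] normalisedD(2)[OF n]
      by (simp add: weyl_y_x multilinear_diff_hd[OF glin] shift)
    thus ?thesis
      using dr[of cs] fun_cong[OF gx, of cs]
      by (simp add: H_def h_def coboundary_Cons gy) (simp add: F_def algebra_simps)
  qed
  \<comment> \<open>\<open>H\<close> commutes with \<open>x\<close>, being the value at
    \<open>y\<close> of a normalised cocycle that vanishes at \<open>x\<close>. Together with its
    vanishing at \<open>x\<close> this makes it linear under left multiplication by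
    \<open>x\<close>, so the powers of \<open>y\<close> determine it.\<close>
  hence Hx: "H ((weyl_x * b) # cs) = weyl_x * H (b # cs)" for b cs
    using coboundary_tl_y[OF h hx, of "b # cs"] by (simp add: H_def[symmetric] coboundary_Cons)
  have "H ((weyl_x ^ i * weyl_y ^ j) # cs) = 0" for i j cs
    by (induction i) (simp_all add: Hy Hx mult.assoc)
  hence "H (b # cs) = 0" for b cs by (rule W.cochain_eq_0_hd[OF H])
  hence "H cs = 0" for cs using H_Nil by (cases cs) auto
  hence "h = (\<lambda>_. 0)"
    using h hx f(4) by (intro W.cocycle_eq_0) (simp_all add: H_def, simp add: h_def)
  thus ?thesis using that g by (simp add: h_def fun_eq_iff)
qed

theorem weyl_cocycle_is_coboundary:
  fixes f :: "'k::field_char_0 weyl list \<Rightarrow> 'k weyl"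
  assumes f: "f \<in> W.cocycles" "f [] = 0"
  obtains g where "g \<in> cochains weyl_scalar" "f = coboundary g"
proof -
  obtain g1 where g1: "g1 \<in> cochains weyl_scalar" "normalised (\<lambda>xs. f xs - coboundary g1 xs)"
    using W.normalise f(1) by blast
  define f1 where "f1 = (\<lambda>xs. f xs - coboundary g1 xs)"
  have f1: "f1 \<in> W.cocycles" "normalised f1" "f1 [] = 0"
    unfolding f1_def using W.cocycles_diff_coboundary[OF f(1) g1(1)] g1(2) f(2) by simp_all
  have "(\<lambda>bs. f1 (weyl_x # bs)) \<in> cochains weyl_scalar" "normalised (\<lambda>bs. f1 (weyl_x # bs))"
    using f1 by (simp_all add: cochains_tl normalised_tl)
  then obtain g2 where g2: "g2 \<in> cochains weyl_scalar" "normalised g2"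
    "\<And>bs. coboundary g2 (weyl_x # bs) = f1 (weyl_x # bs)"
    by (rule solve_x) blast
  define f2 where "f2 = (\<lambda>xs. f1 xs - coboundary g2 xs)"
  have "f2 \<in> W.cocycles" "f2 [] = 0" "\<And>cs. f2 (weyl_x # cs) = 0"
    unfolding f2_def using W.cocycles_diff_coboundary[OF f1(1) g2(1)] g2(3) f1(3) by simp_all
  moreover have "normalised f2"
    using f1(2) normalised_coboundary[OF g2(2)] by (simp add: f2_def normalised_def)
  ultimately obtain g3 where g3: "g3 \<in> cochains weyl_scalar" "f2 = coboundary g3"
    using cocycle_vanishing_x_is_coboundary by blast
  have "f = coboundary (\<lambda>xs. g1 xs + (g2 xs + g3 xs))"
    using g3(2) by (simp add: fun_eq_iff coboundary_add f2_def f1_def algebra_simps)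
  thus ?thesis using that g1 g2 g3 by (blast intro: cochains_add)
qed

section \<open>The isomorphism of the two deformations\<close>

definition word_eval :: "'b::ring_1 \<Rightarrow> 'b \<Rightarrow> word \<Rightarrow> 'b" where
  "word_eval gx gy w = prod_list (map (case_gen gx gy) (letters w))"

lemma word_eval_plus: "word_eval gx gy (u + w) = word_eval gx gy u * word_eval gx gy w"
  by (simp add: word_eval_def plus_word_def)

text \<open>The universal property of the quotient of the free algebra: images of the generators
  that satisfy the relation define a homomorphism.\<close>

locale weyl_evaluation =
  fixes \<theta> :: "'r::comm_ring_1 \<Rightarrow> 'b::ring_1" and gx gy :: 'b and q :: 'r
  assumes theta_add: "\<theta> (a + b) = \<theta> a + \<theta> b"
    and theta_mult: "\<theta> (a * b) = \<theta> a * \<theta> b"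
    and theta_1: "\<theta> 1 = 1"
    and theta_central: "\<theta> a * u = u * \<theta> a"
    and theta_relation: "\<theta> q * gx * gy - gy * gx = 1"
begin

definition free_eval :: "'r free_alg \<Rightarrow> 'b" where
  "free_eval p = comb \<theta> (word_eval gx gy) p"

lemma theta_0: "\<theta> 0 = 0"
  using theta_add[of 0 0] by simp

lemma free_eval_add: "free_eval (a + b) = free_eval a + free_eval b"
  by (simp add: free_eval_def comb_add theta_add)

lemma free_eval_single: "free_eval (Poly_Mapping.single w c) = \<theta> c * word_eval gx gy w"
  by (simp add: free_eval_def comb_single theta_0)

lemma free_eval_0 [simp]: "free_eval 0 = 0"
  by (simp add: free_eval_def)

lemma free_eval_diff: "free_eval (a - b) = free_eval a - free_eval b"
  using free_eval_add[of "a - b" b] by simp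

lemma free_eval_mult: "free_eval (a * b) = free_eval a * free_eval b"
proof (induction a rule: free_alg_induct)
  case (single w c)
  show ?case
  proof (induction b rule: free_alg_induct)
    case (single w' c')
    have "\<theta> c * \<theta> c' * (word_eval gx gy w * word_eval gx gy w')
        = \<theta> c * word_eval gx gy w * (\<theta> c' * word_eval gx gy w')"
      by (metis mult.assoc theta_central)
    thus ?case by (simp add: mult_single free_eval_single theta_mult word_eval_plus)
  qed (simp_all add: distrib_left free_eval_add)
qed (simp_all add: distrib_right free_eval_add)

lemma free_eval_simps [simp]:
  "free_eval (free_scalar c) = \<theta> c" "free_eval free_x = gx" "free_eval free_y = gy" "free_eval 1 = 1"
  unfolding single_one[symmetric]
  by (simp_all add: free_scalar_def free_x_def free_y_def free_eval_single word_eval_def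
      zero_word_def theta_1)

lemma free_eval_cong:
  assumes "weyl_rel q a b"
  shows "free_eval a = free_eval b"
proof -
  have "ideal {a. free_eval a = 0} ring_of_type_algebra"
    by (rule type_idealI) (simp_all add: free_eval_add free_eval_mult)
  moreover have "free_scalar q * free_x * free_y - free_y * free_x - 1 \<in> {a. free_eval a = 0}"
    by (simp add: free_eval_diff free_eval_mult theta_relation)
  ultimately have "weyl_ideal q \<subseteq> {a. free_eval a = 0}"
    unfolding weyl_ideal_def by (intro ring.genideal_minimal[OF ring_of_type]) auto
  thus ?thesis using assms by (auto simp: weyl_rel_def free_eval_diff)
qed

end

section \<open>The homomorphism from W_q to power series over the Weyl algebra\<close>

lemma weyl_fps_scalar_nth [simp]: "fps_nth (weyl_fps_scalar s) n = weyl_scalar (fps_nth s n)"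
  by (simp add: weyl_fps_scalar_def)

lemma weyl_scalar_sum: "weyl_scalar (\<Sum>i\<in>I. h i) = (\<Sum>i\<in>I. weyl_scalar (h i))"
  by (induction I rule: infinite_finite_induct) (simp_all add: weyl_scalar_add)

lemma weyl_fps_scalar_add: "weyl_fps_scalar (a + b) = weyl_fps_scalar a + weyl_fps_scalar b"
  and weyl_fps_scalar_mult: "weyl_fps_scalar (a * b) = weyl_fps_scalar a * weyl_fps_scalar b"
  and weyl_fps_scalar_1: "weyl_fps_scalar 1 = 1"
  by (simp_all add: fps_eq_iff weyl_scalar_add fps_mult_nth weyl_scalar_sum weyl_scalar_mult weyl_scalar_1)

lemma weyl_fps_scalar_X: "weyl_fps_scalar fps_X = fps_X"
  by (simp add: fps_eq_iff weyl_scalar_1)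

lemma weyl_fps_scalar_X_power: "weyl_fps_scalar (fps_X ^ n) = fps_X ^ n"
  by (induction n) (simp_all add: weyl_fps_scalar_1 weyl_fps_scalar_mult weyl_fps_scalar_X)

lemma weyl_fps_scalar_central: "weyl_fps_scalar s * f = f * weyl_fps_scalar s"
proof (rule fps_ext)
  fix n
  have "fps_nth (weyl_fps_scalar s * f) n = (\<Sum>i=0..n. fps_nth f (n - i) * weyl_scalar (fps_nth s i))"
    by (simp only: fps_mult_nth weyl_fps_scalar_nth weyl_scalar_central)
  also have "\<dots> = fps_nth (f * weyl_fps_scalar s) n"
    unfolding fps_mult_nth by (subst sum.atLeastAtMost_rev) simp
  finally show "fps_nth (weyl_fps_scalar s * f) n = fps_nth (f * weyl_fps_scalar s) n" .
qed

text \<open>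
  If \<open>x\<close> acts on polynomials by multiplication, then \<open>y\<close> acts by \<open>- d/dx\<close>, and this series
  by \<open>f \<mapsto> - (f (q x) - f x) / ((q - 1) x)\<close>, with the dilation by \<open>q = 1 + \<hbar>\<close> expanded as a binomial series.
\<close>

definition deformed_y :: "'k::field_char_0 weyl fps" where
  "deformed_y = Abs_fps (\<lambda>n. weyl_scalar ((- 1) ^ n / fact (Suc n)) * (weyl_x ^ n * weyl_y ^ Suc n))"

lemma deformed_y_commutator:
  "weyl_x * fps_nth deformed_y n - fps_nth deformed_y n * weyl_x
    = weyl_scalar ((- 1) ^ n / fact n) * (weyl_x ^ n * weyl_y ^ n :: 'k::field_char_0 weyl)"
proof -
  let ?c = "weyl_scalar ((- 1) ^ n / fact (Suc n)) :: 'k weyl"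
  have "weyl_x * fps_nth deformed_y n - fps_nth deformed_y n * weyl_x
      = ?c * (weyl_x * (weyl_x ^ n * weyl_y ^ Suc n) - weyl_x ^ n * weyl_y ^ Suc n * weyl_x)"
    by (simp only: deformed_y_def fps_nth_Abs_fps W.scalar_commute right_diff_distrib mult.assoc)
  also have "\<dots> = weyl_scalar ((- 1) ^ n / fact (Suc n) * of_nat (Suc n)) * (weyl_x ^ n * weyl_y ^ n)"
    unfolding weyl_commutator_x[OF weyl_y_x] weyl_scalar_mult
    by (simp add: of_nat_weyl mult.assoc del: of_nat_Suc)
  also have "(- 1) ^ n / fact (Suc n) * of_nat (Suc n) = ((- 1) ^ n / fact n :: 'k)"
    by (simp add: field_simps del: of_nat_Suc)
  finally show ?thesis .
qed

text \<open>Let \<open>Y n\<close> be the coefficients of \<open>deformed_y\<close>. The relation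
  says that the commutator of \<open>x\<close> with \<open>Y 0\<close> is 1 and that, for
  \<open>n > 0\<close>, the commutator of \<open>x\<close> with \<open>Y n\<close> is
  \<open>- x * Y (n - 1)\<close>. Integrating this recursion in \<open>y\<close> produces the
  alternating signs and the factorials.\<close>

lemma deformed_relation:
  "weyl_fps_scalar (fps_of_poly [:1, 1:]) * fps_const weyl_x * deformed_y
    - deformed_y * fps_const weyl_x = (1 :: 'k::field_char_0 weyl fps)"
proof (rule fps_ext)
  fix n
  let ?gy = "deformed_y :: 'k weyl fps"
  have q: "fps_of_poly [:1, 1:] = (1 + fps_X :: 'k fps)"
    by (simp add: fps_of_poly_pCons fps_eq_iff)
  have "weyl_fps_scalar (fps_of_poly [:1, 1:]) * fps_const weyl_x * ?gy - ?gy * fps_const weyl_x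
      = fps_const weyl_x * ?gy - ?gy * fps_const weyl_x + fps_X * (fps_const weyl_x * ?gy)"
    unfolding q
    by (simp add: weyl_fps_scalar_add weyl_fps_scalar_1 weyl_fps_scalar_X distrib_right mult.assoc)
  hence "fps_nth (weyl_fps_scalar (fps_of_poly [:1, 1:]) * fps_const weyl_x * ?gy - ?gy * fps_const weyl_x) n
      = weyl_x * fps_nth ?gy n - fps_nth ?gy n * weyl_x
        + (if n = 0 then 0 else weyl_x * fps_nth ?gy (n - 1))"
    by simp
  also have "\<dots> = fps_nth 1 n"
  proof (cases n)
    case 0
    thus ?thesis unfolding deformed_y_commutator by (simp add: weyl_scalar_1)
  next
    case (Suc m)
    have "weyl_x * fps_nth ?gy m = weyl_scalar ((- 1) ^ m / fact (Suc m)) * (weyl_x ^ Suc m * weyl_y ^ Suc m)"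
      by (simp only: deformed_y_def fps_nth_Abs_fps W.scalar_commute) (simp only: power_Suc mult.assoc)
    thus ?thesis unfolding deformed_y_commutator
      by (simp only: Suc) (simp add: W.scalar_uminus del: fact_Suc)
  qed
  finally show "fps_nth (weyl_fps_scalar (fps_of_poly [:1, 1:]) * fps_const weyl_x * ?gy - ?gy * fps_const weyl_x) n
      = fps_nth 1 n" .
qed

interpretation D: weyl_evaluation
  "\<lambda>p :: 'k::field_char_0 poly. weyl_fps_scalar (fps_of_poly p)" "fps_const weyl_x" deformed_y "[:1, 1:]"
proof
  show "weyl_fps_scalar (fps_of_poly a) * u = u * weyl_fps_scalar (fps_of_poly a)"
    for a :: "'k poly" and u
    by (rule weyl_fps_scalar_central)
qed (simp_all only: fps_of_poly_add fps_of_poly_mult weyl_fps_scalar_add weyl_fps_scalar_mult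
  fps_of_poly_1 weyl_fps_scalar_1 deformed_relation)

definition qweyl_to_fps :: "'k::field_char_0 qweyl \<Rightarrow> 'k weyl fps" where
  "qweyl_to_fps a = D.free_eval (rep_qweyl a)"

lemma qweyl_to_fps_abs: "qweyl_to_fps (abs_qweyl p) = D.free_eval p"
  unfolding qweyl_to_fps_def
  by (rule D.free_eval_cong) (simp add: qweyl.abs_eq_iff[symmetric] Quotient3_abs_rep[OF Quotient3_qweyl])

lemma qweyl_to_fps_add: "qweyl_to_fps (a + b) = qweyl_to_fps a + qweyl_to_fps b"
  and qweyl_to_fps_mult: "qweyl_to_fps (a * b) = qweyl_to_fps a * qweyl_to_fps b"
  by (induction a rule: qweyl.abs_induct, induction b rule: qweyl.abs_induct,
      simp add: plus_qweyl.abs_eq times_qweyl.abs_eq qweyl_to_fps_abs D.free_eval_add D.free_eval_mult)+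

lemma qweyl_to_fps_scalar: "qweyl_to_fps (qweyl_scalar p) = weyl_fps_scalar (fps_of_poly p)"
  and qweyl_to_fps_x: "qweyl_to_fps qweyl_x = fps_const weyl_x"
  and qweyl_to_fps_y: "qweyl_to_fps qweyl_y = deformed_y"
  by (simp_all add: qweyl_scalar_def qweyl_x_def qweyl_y_def qweyl_to_fps_abs)

lemma qweyl_to_fps_1: "qweyl_to_fps 1 = 1"
  by (simp add: one_qweyl_def qweyl_to_fps_abs)

lemma qweyl_to_fps_diff: "qweyl_to_fps (a - b) = qweyl_to_fps a - qweyl_to_fps b"
  using qweyl_to_fps_add[of "a - b" b] by simp

lemma qweyl_to_fps_0: "qweyl_to_fps 0 = 0"
  using qweyl_to_fps_add[of 0 0] by simp

lemma qweyl_to_fps_hbar: "qweyl_to_fps (hbar :: 'k::field_char_0 qweyl) = fps_X"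
proof -
  have "fps_of_poly [:0, 1:] = (fps_X :: 'k fps)"
    by (simp add: fps_of_poly_pCons)
  thus ?thesis by (simp add: hbar_def qweyl_to_fps_scalar weyl_fps_scalar_X)
qed

lemma qweyl_to_fps_hbar_power: "qweyl_to_fps (hbar ^ N) = fps_X ^ N"
  by (induction N) (simp_all add: qweyl_to_fps_1 qweyl_to_fps_mult qweyl_to_fps_hbar)

text \<open>A section of the reduction modulo \<hbar>, linear over k but not multiplicative.\<close>

definition weyl_lift :: "'k::field_char_0 weyl \<Rightarrow> 'k qweyl" where
  "weyl_lift u = comb (\<lambda>c. qweyl_scalar [:c:]) Q.monomial (W.coord u)"

lemma weyl_lift_add: "weyl_lift (u + v) = weyl_lift u + weyl_lift v"
  unfolding weyl_lift_def W.coord_add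
  by (rule comb_add) (simp add: qweyl_scalar_add[symmetric])

lemma weyl_lift_0 [simp]: "weyl_lift 0 = 0"
  using weyl_lift_add[of 0 0] by simp

lemma weyl_lift_monomial:
  "weyl_lift (weyl_scalar c * (weyl_x ^ i * weyl_y ^ j)) = qweyl_scalar [:c:] * (qweyl_x ^ i * qweyl_y ^ j)"
  by (simp add: weyl_lift_def W.coord_monomial comb_single Q.monomial_def)

lemma qweyl_to_fps_monomial_nth_0:
  "fps_nth (qweyl_to_fps (qweyl_scalar p * (qweyl_x ^ i * qweyl_y ^ j))) 0
    = weyl_scalar (coeff p 0 :: 'k::field_char_0) * (weyl_x ^ i * weyl_y ^ j)"
proof -
  have pow: "fps_nth (f ^ n) 0 = fps_nth f 0 ^ n" for f :: "'k weyl fps" and n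
    by (induction n) simp_all
  have "qweyl_to_fps (a ^ n) = qweyl_to_fps a ^ n" for a :: "'k qweyl" and n
    by (induction n) (simp_all add: qweyl_to_fps_1 qweyl_to_fps_mult)
  thus ?thesis
    by (simp add: qweyl_to_fps_mult qweyl_to_fps_scalar qweyl_to_fps_x qweyl_to_fps_y pow
        deformed_y_def weyl_scalar_1)
qed

lemma weyl_lift_nth_0: "fps_nth (qweyl_to_fps (weyl_lift u)) 0 = u"
  by (induction u rule: W.monomial_induct)
    (simp_all add: weyl_lift_monomial qweyl_to_fps_monomial_nth_0 weyl_lift_add qweyl_to_fps_add)

text \<open>Each coordinate of \<open>a\<close> is congruent to its constant term modulo \<hbar>. If
  the constant coefficient of the image is zero, so is its lift, and \<open>a\<close> itself is
  divisible by \<hbar>.\<close>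

lemma hbar_dvd_diff_weyl_lift: "hbar ^ 1 dvd a - weyl_lift (fps_nth (qweyl_to_fps a) 0)"
proof (induction a rule: Q.monomial_induct)
  case (scale_monomial p i j)
  have "p = [:coeff p 0:] + [:0, 1:] * poly_shift 1 p"
    by (rule poly_eqI) (auto simp: coeff_pCons coeff_poly_shift split: nat.splits)
  hence "qweyl_scalar p = qweyl_scalar [:coeff p 0:] + hbar * qweyl_scalar (poly_shift 1 p)"
    by (metis hbar_def qweyl_scalar_add qweyl_scalar_mult)
  hence "qweyl_scalar p * (qweyl_x ^ i * qweyl_y ^ j)
      - weyl_lift (fps_nth (qweyl_to_fps (qweyl_scalar p * (qweyl_x ^ i * qweyl_y ^ j))) 0)
      = hbar * (qweyl_scalar (poly_shift 1 p) * (qweyl_x ^ i * qweyl_y ^ j))"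
    unfolding qweyl_to_fps_monomial_nth_0 weyl_lift_monomial by (simp add: distrib_right mult.assoc)
  thus ?case by (auto simp: dvd_def)
next
  case (add a b)
  from hbar_dvd_add[OF add] show ?case
    by (simp add: qweyl_to_fps_add weyl_lift_add algebra_simps)
qed

text \<open>So the adic topology of W_q is induced from the power series. For the harder direction,
  a vanishing constant coefficient allows one factor \<hbar> to be divided off, which shifts the
  remaining coefficients down.\<close>

lemma hbar_power_dvd_iff: "hbar ^ N dvd a \<longleftrightarrow> (\<forall>n<N. fps_nth (qweyl_to_fps a) n = 0)"
proof
  assume "hbar ^ N dvd a"
  thus "\<forall>n<N. fps_nth (qweyl_to_fps a) n = 0"
    by (auto simp: dvd_def qweyl_to_fps_mult qweyl_to_fps_hbar_power fps_X_power_mult_nth)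
next
  show "\<forall>n<N. fps_nth (qweyl_to_fps a) n = 0 \<Longrightarrow> hbar ^ N dvd a"
  proof (induction N arbitrary: a)
    case 0
    show ?case by (auto simp: dvd_def)
  next
    case (Suc N)
    from hbar_dvd_diff_weyl_lift[of a] Suc.prems obtain b where b: "a = hbar * b"
      by (auto simp: dvd_def)
    have "qweyl_to_fps a = fps_X * qweyl_to_fps b"
      by (simp add: b qweyl_to_fps_mult qweyl_to_fps_hbar)
    hence "\<forall>n<N. fps_nth (qweyl_to_fps b) n = 0"
      using Suc.prems by (metis Suc_less_eq diff_Suc_1 fps_X_mult_nth nat.distinct(1))
    then obtain c where "b = hbar ^ N * c" using Suc.IH by (auto simp: dvd_def)
    thus ?case by (auto simp: b dvd_def mult.assoc)
  qed
qed

section \<open>The completion as limits of coefficientwise convergent sequences\<close>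

definition represents :: "(nat \<Rightarrow> 'k::field_char_0 qweyl) \<Rightarrow> 'k weyl fps \<Rightarrow> bool" where
  "represents s F \<longleftrightarrow> (\<forall>N. \<exists>m. \<forall>i\<ge>m. \<forall>n<N. fps_nth (qweyl_to_fps (s i)) n = fps_nth F n)"

lemma representsD2:
  assumes "represents s F" "represents t G"
  obtains m where "\<And>i n. i \<ge> m \<Longrightarrow> n < N \<Longrightarrow> fps_nth (qweyl_to_fps (s i)) n = fps_nth F n"
    "\<And>i n. i \<ge> m \<Longrightarrow> n < N \<Longrightarrow> fps_nth (qweyl_to_fps (t i)) n = fps_nth G n"
proof -
  obtain m1 m2 where "\<forall>i\<ge>m1. \<forall>n<N. fps_nth (qweyl_to_fps (s i)) n = fps_nth F n"
    "\<forall>i\<ge>m2. \<forall>n<N. fps_nth (qweyl_to_fps (t i)) n = fps_nth G n"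
    using assms unfolding represents_def by meson
  thus ?thesis using that[of "max m1 m2"] by auto
qed

lemma represents_const: "represents (\<lambda>_. a) (qweyl_to_fps a)"
  by (simp add: represents_def)

lemma represents_add:
  assumes "represents s F" "represents t G"
  shows "represents (\<lambda>i. s i + t i) (F + G)"
  unfolding represents_def
proof
  fix N
  obtain m where "\<And>i n. i \<ge> m \<Longrightarrow> n < N \<Longrightarrow> fps_nth (qweyl_to_fps (s i)) n = fps_nth F n"
    "\<And>i n. i \<ge> m \<Longrightarrow> n < N \<Longrightarrow> fps_nth (qweyl_to_fps (t i)) n = fps_nth G n"
    using representsD2[OF assms] by blast
  thus "\<exists>m. \<forall>i\<ge>m. \<forall>n<N. fps_nth (qweyl_to_fps (s i + t i)) n = fps_nth (F + G) n"
    by (intro exI[of _ m]) (simp add: qweyl_to_fps_add)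
qed

lemma represents_mult:
  assumes "represents s F" "represents t G"
  shows "represents (\<lambda>i. s i * t i) (F * G)"
  unfolding represents_def
proof
  fix N
  obtain m where "\<And>i n. i \<ge> m \<Longrightarrow> n < N \<Longrightarrow> fps_nth (qweyl_to_fps (s i)) n = fps_nth F n"
    "\<And>i n. i \<ge> m \<Longrightarrow> n < N \<Longrightarrow> fps_nth (qweyl_to_fps (t i)) n = fps_nth G n"
    using representsD2[OF assms] by blast
  hence "\<forall>i\<ge>m. \<forall>n<N. fps_nth (qweyl_to_fps (s i * t i)) n = fps_nth (F * G) n"
    by (auto simp: qweyl_to_fps_mult fps_mult_nth intro!: sum.cong)
  thus "\<exists>m. \<forall>i\<ge>m. \<forall>n<N. fps_nth (qweyl_to_fps (s i * t i)) n = fps_nth (F * G) n" ..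
qed

lemma represents_Cauchy:
  assumes "represents s F"
  shows "hbar_Cauchy s"
  unfolding hbar_Cauchy_def
proof
  fix N
  obtain m where "\<forall>i\<ge>m. \<forall>n<N. fps_nth (qweyl_to_fps (s i)) n = fps_nth F n"
    using assms by (auto simp: represents_def)
  thus "\<exists>m. \<forall>i\<ge>m. \<forall>j\<ge>m. hbar ^ N dvd s i - s j"
    by (intro exI[of _ m]) (simp add: hbar_power_dvd_iff qweyl_to_fps_diff)
qed

lemma Cauchy_represents:
  assumes "hbar_Cauchy s"
  obtains F where "represents s F"
proof -
  have "\<forall>N. \<exists>m. \<forall>i\<ge>m. \<forall>j\<ge>m. \<forall>n<N. fps_nth (qweyl_to_fps (s i)) n = fps_nth (qweyl_to_fps (s j)) n"
    using assms by (simp add: hbar_Cauchy_def hbar_power_dvd_iff qweyl_to_fps_diff)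
  then obtain m where m: "\<And>N i j n. i \<ge> m N \<Longrightarrow> j \<ge> m N \<Longrightarrow> n < N \<Longrightarrow>
      fps_nth (qweyl_to_fps (s i)) n = fps_nth (qweyl_to_fps (s j)) n"
    by metis
  \<comment> \<open>Coefficient \<open>n\<close> is read off at an index from which on all
    coefficients up to \<open>n\<close> are stationary.\<close>
  define F where "F = Abs_fps (\<lambda>n. fps_nth (qweyl_to_fps (s (m (Suc n)))) n)"
  have "fps_nth (qweyl_to_fps (s i)) n = fps_nth F n" if "i \<ge> m N" "n < N" for N i n
    using m[of N i "max (m N) (m (Suc n))" n] m[of "Suc n" "max (m N) (m (Suc n))" "m (Suc n)" n] that
    by (simp add: F_def)
  thus ?thesis using that[of F] unfolding represents_def by blast
qed

lemma represents_rel_iff: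
  assumes "represents s F" "represents t G"
  shows "hbar_rel s t \<longleftrightarrow> F = G"
proof
  assume rel: "hbar_rel s t"
  show "F = G"
  proof (rule fps_ext)
    fix n
    obtain m where m: "\<And>i k. i \<ge> m \<Longrightarrow> k < Suc n \<Longrightarrow> fps_nth (qweyl_to_fps (s i)) k = fps_nth F k"
      "\<And>i k. i \<ge> m \<Longrightarrow> k < Suc n \<Longrightarrow> fps_nth (qweyl_to_fps (t i)) k = fps_nth G k"
      using representsD2[OF assms] by blast
    obtain l where "\<forall>i\<ge>l. hbar ^ Suc n dvd s i - t i"
      using rel unfolding hbar_rel_def hbar_null_def by blast
    hence "hbar ^ Suc n dvd s (max l m) - t (max l m)" by simp
    thus "fps_nth F n = fps_nth G n"
      using m[of "max l m" n] by (auto simp: hbar_power_dvd_iff qweyl_to_fps_diff simp del: power_Suc)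
  qed
next
  assume "F = G"
  have "hbar_null (\<lambda>n. s n - t n)"
    unfolding hbar_null_def
  proof
    fix N
    obtain m where "\<And>i n. i \<ge> m \<Longrightarrow> n < N \<Longrightarrow> fps_nth (qweyl_to_fps (s i)) n = fps_nth F n"
      "\<And>i n. i \<ge> m \<Longrightarrow> n < N \<Longrightarrow> fps_nth (qweyl_to_fps (t i)) n = fps_nth G n"
      using representsD2[OF assms] by blast
    thus "\<exists>m. \<forall>i\<ge>m. hbar ^ N dvd s i - t i"
      using \<open>F = G\<close>
      by (intro exI[of _ m]) (simp add: hbar_power_dvd_iff qweyl_to_fps_diff)
  qed
  thus "hbar_rel s t" using assms represents_Cauchy by (auto simp: hbar_rel_def)
qed

definition hat_to_fps :: "'k::field_char_0 qweyl_hat \<Rightarrow> 'k weyl fps" where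
  "hat_to_fps z = (THE F. represents (rep_qweyl_hat z) F)"

lemma qweyl_hat_cases:
  obtains s where "z = abs_qweyl_hat s" "hbar_Cauchy s"
  using Quotient3_abs_rep[OF Quotient3_qweyl_hat, of z] Quotient3_rep_reflp[OF Quotient3_qweyl_hat, of z]
  by (metis hbar_rel_def)

lemma hat_to_fps_abs:
  assumes "represents s F"
  shows "hat_to_fps (abs_qweyl_hat s) = F"
proof -
  let ?r = "rep_qweyl_hat (abs_qweyl_hat s)"
  have rel: "hbar_rel ?r s"
    by (rule Quotient3_rep_abs[OF Quotient3_qweyl_hat hbar_rel_refl]) (rule represents_Cauchy[OF assms])
  then obtain G where G: "represents ?r G" using Cauchy_represents hbar_rel_def by blast
  have r: "represents ?r F" using represents_rel_iff[OF G assms] rel G by simp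
  have "H = F" if "represents ?r H" for H
    using represents_rel_iff[OF that r] hbar_rel_refl[OF represents_Cauchy[OF r]] by simp
  with r show ?thesis unfolding hat_to_fps_def by (rule the_equality)
qed

lemma qweyl_hat_representation:
  obtains s F where "z = abs_qweyl_hat s" "represents s F" "hat_to_fps z = F"
  using qweyl_hat_cases[of z] Cauchy_represents hat_to_fps_abs by metis

lemma hat_to_fps_add: "hat_to_fps (z + w) = hat_to_fps z + hat_to_fps w"
  and hat_to_fps_mult: "hat_to_fps (z * w) = hat_to_fps z * hat_to_fps w"
proof -
  obtain s F where s: "z = abs_qweyl_hat s" "represents s F" "hat_to_fps z = F"
    by (rule qweyl_hat_representation)
  obtain t G where t: "w = abs_qweyl_hat t" "represents t G" "hat_to_fps w = G"
    by (rule qweyl_hat_representation)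
  have rel: "hbar_rel s s" "hbar_rel t t"
    using s t represents_Cauchy hbar_rel_refl by blast+
  show "hat_to_fps (z + w) = hat_to_fps z + hat_to_fps w"
    using hat_to_fps_abs[OF represents_add[OF s(2) t(2)]]
    by (simp only: s(3) t(3)) (simp only: s(1) t(1) plus_qweyl_hat.abs_eq[OF rel])
  show "hat_to_fps (z * w) = hat_to_fps z * hat_to_fps w"
    using hat_to_fps_abs[OF represents_mult[OF s(2) t(2)]]
    by (simp only: s(3) t(3)) (simp only: s(1) t(1) times_qweyl_hat.abs_eq[OF rel])
qed

lemma hat_to_fps_to_hat: "hat_to_fps (to_hat a) = qweyl_to_fps a"
  unfolding to_hat_def by (rule hat_to_fps_abs) (rule represents_const)

lemma hat_to_fps_1: "hat_to_fps 1 = 1"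
  using hat_to_fps_to_hat[of 1] by (simp add: one_qweyl_hat_def to_hat_def qweyl_to_fps_1)

lemma represents_truncations:
  "represents (\<lambda>n. qweyl_scalar (Poly (map (fps_nth r) [0..<n]))) (weyl_fps_scalar r)"
proof -
  have "coeff (Poly (map (fps_nth r) [0..<i])) n = fps_nth r n" if "n < i" for i n
    using that by (simp add: nth_default_nth)
  thus ?thesis
    unfolding represents_def
    by (intro allI, rule_tac x = N in exI) (simp add: qweyl_to_fps_scalar)
qed

lemma hat_to_fps_scalar: "hat_to_fps (qweyl_hat_scalar r) = weyl_fps_scalar r"
  unfolding qweyl_hat_scalar_def by (rule hat_to_fps_abs) (rule represents_truncations)

lemma inj_hat_to_fps: "inj (hat_to_fps :: 'k::field_char_0 qweyl_hat \<Rightarrow> _)"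
proof (rule injI)
  fix z w :: "'k qweyl_hat" assume eq: "hat_to_fps z = hat_to_fps w"
  obtain s F where s: "z = abs_qweyl_hat s" "represents s F" "hat_to_fps z = F"
    by (rule qweyl_hat_representation)
  obtain t G where t: "w = abs_qweyl_hat t" "represents t G" "hat_to_fps w = G"
    by (rule qweyl_hat_representation)
  have "hbar_rel s t" using represents_rel_iff[OF s(2) t(2)] eq s t by simp
  thus "z = w" using s t Quotient3_rel_abs[OF Quotient3_qweyl_hat] by simp
qed

text \<open>The remainders in an expansion of \<open>F\<close> by powers of \<hbar> with lifted
  elements of the Weyl algebra as digits: subtracting the image of the lifted constant coefficient
  leaves a multiple of \<open>fps_X\<close>, and that factor is divided off. The partial sums
  converge to a preimage of \<open>F\<close>.\<close>

primrec lift_remainder :: "'k::field_char_0 weyl fps \<Rightarrow> nat \<Rightarrow> 'k weyl fps" where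
  "lift_remainder F 0 = F"
| "lift_remainder F (Suc n)
    = fps_shift 1 (lift_remainder F n - qweyl_to_fps (weyl_lift (fps_nth (lift_remainder F n) 0)))"

lemma surj_hat_to_fps: "surj (hat_to_fps :: 'k::field_char_0 qweyl_hat \<Rightarrow> _)"
proof (rule surjI)
  fix F :: "'k weyl fps"
  define s where "s = (\<lambda>n. \<Sum>l<n. hbar ^ l * weyl_lift (fps_nth (lift_remainder F l) 0))"
  have F: "F = qweyl_to_fps (s n) + fps_X ^ n * lift_remainder F n" for n
  proof (induction n)
    case 0
    show ?case by (simp add: s_def qweyl_to_fps_0)
  next
    case (Suc n)
    let ?d = "qweyl_to_fps (weyl_lift (fps_nth (lift_remainder F n) 0))"
    have "lift_remainder F n - ?d = fps_X * lift_remainder F (Suc n)"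
      by (rule fps_ext) (simp add: weyl_lift_nth_0)
    hence "lift_remainder F n = ?d + fps_X * lift_remainder F (Suc n)"
      by (simp only: diff_eq_eq add.commute)
    from arg_cong[OF this, of "\<lambda>f. fps_X ^ n * f"]
    have "fps_X ^ n * lift_remainder F n = fps_X ^ n * ?d + fps_X ^ Suc n * lift_remainder F (Suc n)"
      by (simp only: distrib_left mult.assoc power_Suc2)
    moreover have "qweyl_to_fps (s (Suc n)) = qweyl_to_fps (s n) + fps_X ^ n * ?d"
      by (simp add: s_def qweyl_to_fps_add qweyl_to_fps_mult qweyl_to_fps_hbar_power)
    ultimately show ?case using Suc by (simp only: add.assoc)
  qed
  have "fps_nth (qweyl_to_fps (s i)) n = fps_nth F n" if "n < i" for i n
    by (subst F[of i]) (simp add: fps_X_power_mult_nth that)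
  hence "represents s F"
    unfolding represents_def by (intro allI, rule_tac x = N in exI) simp
  hence "represents (SOME s. represents s F) F" by (rule someI[of "\<lambda>s. represents s F"])
  thus "hat_to_fps (abs_qweyl_hat (SOME s. represents s F)) = F" by (rule hat_to_fps_abs)
qed

lemma bij_hat_to_fps: "bij hat_to_fps"
  using inj_hat_to_fps surj_hat_to_fps by (simp add: bij_def)

definition fps_to_hat :: "'k::field_char_0 weyl fps \<Rightarrow> 'k qweyl_hat" where
  "fps_to_hat = inv_into UNIV hat_to_fps"

lemma fps_to_hat_inverse [simp]: "hat_to_fps (fps_to_hat F) = F" "fps_to_hat (hat_to_fps z) = z"
  by (simp_all add: fps_to_hat_def surj_f_inv_f[OF surj_hat_to_fps] inv_f_f[OF inj_hat_to_fps])

lemma fps_to_hat_eqI: "hat_to_fps z = F \<Longrightarrow> fps_to_hat F = z"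
  by auto

lemma algebra_iso_fps_to_hat: "algebra_iso weyl_fps_scalar qweyl_hat_scalar fps_to_hat"
  unfolding algebra_iso_def
proof
  have "bij fps_to_hat" unfolding fps_to_hat_def by (rule bij_imp_bij_inv[OF bij_hat_to_fps])
  thus "fps_to_hat \<in> ring_iso ring_of_type_algebra ring_of_type_algebra"
    unfolding ring_iso_def ring_hom_def
    by (auto simp: ring_of_type_algebra_def hat_to_fps_add hat_to_fps_mult hat_to_fps_1 intro!: fps_to_hat_eqI)
  show "\<forall>r. fps_to_hat (weyl_fps_scalar r) = qweyl_hat_scalar r"
    by (auto intro: fps_to_hat_eqI hat_to_fps_scalar)
qed

section \<open>Vanishing for the completed algebras\<close>

interpretation WF: central_scalars "weyl_fps_scalar :: 'k::comm_ring_1 fps \<Rightarrow> _"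
  by standard (rule weyl_fps_scalar_central)

text \<open>
  Multilinearity over \<open>k[[\<hbar>]]\<close> makes cochains continuous for the adic topology without any
  further assumption, so they are determined on a dense subset.
\<close>

lemma fps_cochain_eq_0:
  fixes f :: "'k::comm_ring_1 weyl fps list \<Rightarrow> 'k weyl fps"
  assumes f: "f \<in> cochains weyl_fps_scalar"
    and dense: "\<And>a. \<exists>d\<in>D. \<exists>b. a = d + fps_X * b"
    and zero: "\<And>xs. set xs \<subseteq> D \<Longrightarrow> f xs = 0"
  shows "f = (\<lambda>_. 0)"
proof -
  have lin: "multilinear weyl_fps_scalar f" using f by (simp add: cochains_iff)
  have "\<forall>xs. \<forall>n<N. fps_nth (f xs) n = 0" for N
  proof (induction N)
    case (Suc N)
    \<comment> \<open>The arguments are replaced by elements of \<open>D\<close> one at a time, from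
      the left. Each replacement leaves an error \<open>fps_X * f _\<close>, whose coefficients
      below \<open>Suc N\<close> vanish as those of \<open>f\<close> below \<open>N\<close> do at
      all arguments.\<close>
    have "set us \<subseteq> D \<Longrightarrow> \<forall>n<Suc N. fps_nth (f (us @ vs)) n = 0" for us vs
    proof (induction vs arbitrary: us)
      case (Cons v vs)
      obtain d b where d: "d \<in> D" "v = d + fps_X * b" using dense by blast
      have "f (us @ v # vs) = f ((us @ [d]) @ vs) + fps_X * f (us @ b # vs)"
        unfolding d(2) multilinear_app(1)[OF lin]
        using multilinear_app(2)[OF lin, of us fps_X b vs] by (simp add: weyl_fps_scalar_X)
      moreover have "\<forall>n<Suc N. fps_nth (f ((us @ [d]) @ vs)) n = 0"
        using Cons d by (intro Cons.IH) simp
      ultimately show ?case using Suc.IH by auto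
    qed (simp add: zero)
    from this[of "[]"] show ?case by simp
  qed simp
  hence "f xs = 0" for xs by (intro fps_ext) (metis fps_zero_nth lessI)
  thus ?thesis by blast
qed

section \<open>Coefficients of cochains, and cochains assembled from them\<close>

definition coefficient_cochain ::
  "('k::comm_ring_1 weyl fps list \<Rightarrow> 'k weyl fps) \<Rightarrow> nat \<Rightarrow> 'k weyl list \<Rightarrow> 'k weyl" where
  "coefficient_cochain f m as = fps_nth (f (map fps_const as)) m"

text \<open>The constant series form a subalgebra, and taking a coefficient commutes with
  multiplication by constants on either side.\<close>

lemma coboundary_coefficient_cochain:
  "coboundary (coefficient_cochain f m) = coefficient_cochain (coboundary f) m"
proof
  fix as
  have "rmul (coefficient_cochain f m) as = fps_nth (rmul f (map fps_const as)) m" for as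
  proof (induction as arbitrary: f rule: induct_list012)
    case (3 a b cs)
    show ?case using 3(2)[of "\<lambda>xs. f (fps_const a # xs)"]
      by (simp add: coefficient_cochain_def[abs_def])
  qed (simp_all add: coefficient_cochain_def)
  thus "coboundary (coefficient_cochain f m) as = coefficient_cochain (coboundary f) m as"
    by (cases as) (simp_all add: coboundary_Cons coefficient_cochain_def)
qed

lemma bounded_coefficient_cochain: "bounded_cochain N f \<Longrightarrow> bounded_cochain N (coefficient_cochain f m)"
  by (simp add: bounded_cochain_def coefficient_cochain_def)

lemma cochains_coefficient_cochain:
  assumes f: "f \<in> cochains weyl_fps_scalar"
  shows "coefficient_cochain f m \<in> cochains weyl_scalar"
proof -
  have lin: "multilinear weyl_fps_scalar f" using f by (simp add: cochains_iff)
  have const: "weyl_fps_scalar (fps_const r) = fps_const (weyl_scalar r)" for r :: 'a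
    by (rule fps_ext) simp
  have "multilinear weyl_scalar (coefficient_cochain f m)"
  proof (rule multilinearI)
    show "coefficient_cochain f m (us @ (a + b) # vs)
        = coefficient_cochain f m (us @ a # vs) + coefficient_cochain f m (us @ b # vs)" for us vs a b
      using multilinear_app(1)[OF lin, of "map fps_const us" "fps_const a" "fps_const b" "map fps_const vs"]
      by (simp add: coefficient_cochain_def)
    show "coefficient_cochain f m (us @ (weyl_scalar r * a) # vs)
        = weyl_scalar r * coefficient_cochain f m (us @ a # vs)" for us vs r a
      using multilinear_app(2)[OF lin, of "map fps_const us" "fps_const r" "fps_const a" "map fps_const vs"]
      by (simp add: coefficient_cochain_def const)
  qed
  thus ?thesis using f bounded_coefficient_cochain by (auto simp: cochains_iff)
qed

text \<open>Coefficient \<open>m\<close> at arguments \<open>a1, ..., ar\<close> is the sum, over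
  \<open>l1 + ... + lr + k = m\<close>, of \<open>g k\<close> at the coefficients of the arguments
  of degrees \<open>l1, ..., lr\<close>. Multilinearity over the power series forces this formula
  once the values on constants are given.\<close>

primrec assemble :: "(nat \<Rightarrow> 'k::comm_ring_1 weyl list \<Rightarrow> 'k weyl) \<Rightarrow> 'k weyl fps list \<Rightarrow> 'k weyl fps" where
  "assemble g [] = Abs_fps (\<lambda>m. g m [])"
| "assemble g (a # as) = Abs_fps (\<lambda>m. \<Sum>l=0..m.
     fps_nth (assemble (\<lambda>k bs. g k (fps_nth a l # bs)) as) (m - l))"

lemma assemble_add: "assemble (\<lambda>k bs. g k bs + h k bs) as = assemble g as + assemble h as"
  by (induction as arbitrary: g h) (simp_all add: fps_eq_iff sum.distrib)

lemma assemble_scale: "assemble (\<lambda>k bs. weyl_scalar r * g k bs) as = fps_const (weyl_scalar r) * assemble g as"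
  by (induction as arbitrary: g) (simp_all add: fps_eq_iff sum_distrib_left)

lemma assemble_eq_0: "(\<And>k bs. length bs = length as \<Longrightarrow> g k bs = 0) \<Longrightarrow> assemble g as = 0"
  by (induction as arbitrary: g) (simp_all add: fps_eq_iff)

lemma assemble_sum:
  "assemble (\<lambda>k bs. \<Sum>i\<in>I. g i k bs) as = (\<Sum>i\<in>I. assemble (g i) as)"
  by (induction I rule: infinite_finite_induct) (simp_all add: assemble_eq_0 assemble_add)

lemma multilinear_assemble:
  assumes "\<And>k. multilinear weyl_scalar (g k)"
  shows "multilinear weyl_fps_scalar (assemble g)"
proof (rule multilinearI)
  show "assemble g (us @ (a + b) # vs) = assemble g (us @ a # vs) + assemble g (us @ b # vs)" for us vs a b
    using assms
  proof (induction us arbitrary: g)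
    case Nil
    thus ?case
      by (simp add: fps_eq_iff multilinear_hd(1)[OF Nil] assemble_add sum.distrib)
  next
    case (Cons c us)
    have "assemble (\<lambda>k bs. g k (fps_nth c l # bs)) (us @ (a + b) # vs)
        = assemble (\<lambda>k bs. g k (fps_nth c l # bs)) (us @ a # vs)
          + assemble (\<lambda>k bs. g k (fps_nth c l # bs)) (us @ b # vs)" for l
      by (rule Cons.IH) (rule multilinear_tl[OF Cons.prems])
    thus ?case by (simp add: fps_eq_iff sum.distrib)
  qed
  show "assemble g (us @ (weyl_fps_scalar s * a) # vs) = weyl_fps_scalar s * assemble g (us @ a # vs)"
    for us vs s a
    using assms
  proof (induction us arbitrary: g)
    case Nil
    define E where "E c = assemble (\<lambda>k bs. g k (c # bs)) vs" for c
    have E_sum: "E (\<Sum>i\<in>I. h i) = (\<Sum>i\<in>I. E (h i))" for I :: "nat set" and h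
      unfolding E_def multilinear_sum_hd[OF Nil] by (rule assemble_sum)
    have E_scale: "E (weyl_scalar r * c) = fps_const (weyl_scalar r) * E c" for r c
      unfolding E_def multilinear_hd(2)[OF Nil] by (rule assemble_scale)
    show ?case
    proof (rule fps_ext)
      fix m
      have "fps_nth (assemble g ((weyl_fps_scalar s * a) # vs)) m
          = (\<Sum>l=0..m. \<Sum>i=0..l. weyl_scalar (fps_nth s i) * fps_nth (E (fps_nth a (l - i))) (m - l))"
        by (simp add: E_def[symmetric] fps_mult_nth[of "weyl_fps_scalar s"] E_sum E_scale fps_sum_nth)
      \<comment> \<open>A reindexing of a sum over triples with total \<open>m\<close>, by the
        identity behind the associativity of the Cauchy product.\<close>
      also have "\<dots> = (\<Sum>l=0..m. \<Sum>i=0..m - l. weyl_scalar (fps_nth s l) * fps_nth (E (fps_nth a i)) (m - l - i))"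
        by (rule fps_mult_assoc_lemma)
      also have "\<dots> = fps_nth (weyl_fps_scalar s * assemble g (a # vs)) m"
        by (simp add: E_def[symmetric] fps_mult_nth[of "weyl_fps_scalar s"] sum_distrib_left)
      finally show "fps_nth (assemble g ([] @ (weyl_fps_scalar s * a) # vs)) m
          = fps_nth (weyl_fps_scalar s * assemble g ([] @ a # vs)) m" by simp
    qed
  next
    case (Cons c us)
    define E where "E l = assemble (\<lambda>k bs. g k (fps_nth c l # bs)) (us @ a # vs)" for l
    have IH: "assemble (\<lambda>k bs. g k (fps_nth c l # bs)) (us @ (weyl_fps_scalar s * a) # vs)
        = weyl_fps_scalar s * E l" for l
      unfolding E_def by (rule Cons.IH) (rule multilinear_tl[OF Cons.prems])
    show ?case
    proof (rule fps_ext)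
      fix m
      have "fps_nth (assemble g ((c # us) @ (weyl_fps_scalar s * a) # vs)) m
          = (\<Sum>l=0..m. \<Sum>i=0..m - l. weyl_scalar (fps_nth s i) * fps_nth (E l) (m - l - i))"
        by (simp add: IH fps_mult_nth[of "weyl_fps_scalar s"])
      \<comment> \<open>The same identity, used backwards and then forwards with a reversal of the
        inner sum in between, exchanges the degree taken from \<open>c\<close> with the one taken
        from \<open>s\<close>.\<close>
      also have "\<dots> = (\<Sum>l=0..m. \<Sum>i=0..l. weyl_scalar (fps_nth s (l - i)) * fps_nth (E i) (m - l))"
        by (rule fps_mult_assoc_lemma[symmetric])
      also have "\<dots> = (\<Sum>l=0..m. \<Sum>i=0..l. weyl_scalar (fps_nth s i) * fps_nth (E (l - i)) (m - l))"
        by (rule sum.cong[OF refl], subst sum.atLeastAtMost_rev) simp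
      also have "\<dots> = (\<Sum>l=0..m. \<Sum>i=0..m - l. weyl_scalar (fps_nth s l) * fps_nth (E i) (m - l - i))"
        by (rule fps_mult_assoc_lemma)
      also have "\<dots> = fps_nth (weyl_fps_scalar s * assemble g ((c # us) @ a # vs)) m"
        by (simp add: E_def fps_mult_nth[of "weyl_fps_scalar s"] sum_distrib_left)
      finally show "fps_nth (assemble g ((c # us) @ (weyl_fps_scalar s * a) # vs)) m
          = fps_nth (weyl_fps_scalar s * assemble g ((c # us) @ a # vs)) m" .
    qed
  qed
qed

lemma coefficient_cochain_assemble:
  assumes "\<And>k. multilinear weyl_scalar (g k)"
  shows "coefficient_cochain (assemble g) m = g m"
proof
  fix as
  have "assemble g (map fps_const as) = Abs_fps (\<lambda>m. g m as)"
    using assms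
  proof (induction as arbitrary: g)
    case (Cons a as)
    show ?case
    proof (rule fps_ext)
      fix m
      have zero: "assemble (\<lambda>k bs. g k (0 # bs)) (map fps_const as) = 0"
        by (rule assemble_eq_0) (rule multilinear_zero_hd[OF Cons.prems])
      have "fps_nth (assemble (\<lambda>k bs. g k (fps_nth (fps_const a) l # bs)) (map fps_const as)) (m - l)
          = (if l = 0 then fps_nth (assemble (\<lambda>k bs. g k (a # bs)) (map fps_const as)) m else 0)" for l
        by (cases l) (simp_all add: zero)
      hence "fps_nth (assemble g (map fps_const (a # as))) m
          = (\<Sum>l=0..m. if l = 0 then fps_nth (assemble (\<lambda>k bs. g k (a # bs)) (map fps_const as)) m else 0)"
        by (simp only: list.map assemble.simps fps_nth_Abs_fps)
      also have "\<dots> = g m (a # as)"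
        using Cons.IH[of "\<lambda>k bs. g k (a # bs)"] multilinear_tl[OF Cons.prems] by simp
      finally show "fps_nth (assemble g (map fps_const (a # as))) m = fps_nth (Abs_fps (\<lambda>m. g m (a # as))) m"
        by simp
    qed
  qed simp
  thus "coefficient_cochain (assemble g) m as = g m as" by (simp add: coefficient_cochain_def)
qed

lemma coboundary_cong:
  assumes "\<And>ys. Suc (length ys) = length xs \<Longrightarrow> f ys = g ys"
  shows "coboundary f xs = coboundary g xs"
proof -
  have "rmul f xs = rmul g xs"
    using assms
  proof (induction xs arbitrary: f g rule: induct_list012)
    case (3 a b cs)
    have "rmul (\<lambda>xs. f (a # xs)) (b # cs) = rmul (\<lambda>xs. g (a # xs)) (b # cs)"
      by (rule 3(2)) (use 3(3) in simp)
    thus ?case using 3(3)[of "(a * b) # cs"] by simp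
  qed simp_all
  thus ?thesis using assms by (cases xs) (simp_all add: coboundary_Cons)
qed

text \<open>A cochain assembled from infinitely many primitives needs one degree bound for all of
  them. Cutting a primitive off above degree \<open>N\<close> keeps its coboundary: lists of length
  up to \<open>Suc N\<close> only see values that are kept, and on longer lists both sides
  vanish.\<close>

lemma weyl_cocycle_is_bounded_coboundary:
  fixes f :: "'k::field_char_0 weyl list \<Rightarrow> 'k weyl"
  assumes f: "f \<in> W.cocycles" "f [] = 0" "bounded_cochain N f"
  obtains g where "multilinear weyl_scalar g" "bounded_cochain N g" "f = coboundary g"
proof -
  obtain g where g: "g \<in> cochains weyl_scalar" "f = coboundary g"
    using weyl_cocycle_is_coboundary[OF f(1,2)] by blast
  define g' where "g' = (\<lambda>xs. if length xs \<le> N then g xs else 0)"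
  have g': "bounded_cochain N g'" "multilinear weyl_scalar g'"
    using g(1) by (auto simp: g'_def bounded_cochain_def cochains_iff multilinear_def)
  have "f xs = coboundary g' xs" for xs
  proof (cases "length xs \<le> Suc N")
    case True
    thus ?thesis unfolding g(2) by (intro coboundary_cong) (simp add: g'_def)
  next
    case False
    thus ?thesis using bounded_coboundary[OF g'(1)] f(3) by (simp add: bounded_cochain_def)
  qed
  thus ?thesis using that g' by blast
qed

theorem weyl_fps_cocycle_is_coboundary:
  fixes f :: "'k::field_char_0 weyl fps list \<Rightarrow> 'k weyl fps"
  assumes f: "f \<in> WF.cocycles" "f [] = 0"
  obtains g where "g \<in> cochains weyl_fps_scalar" "f = coboundary g"
proof -
  obtain N where N: "bounded_cochain N f" using f by (auto simp: cochains_iff)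
  have "\<exists>g. multilinear weyl_scalar g \<and> bounded_cochain N g \<and> coefficient_cochain f m = coboundary g" for m
  proof -
    have "coboundary (coefficient_cochain f m) = (\<lambda>_. 0)"
      using f(1) by (simp add: coboundary_coefficient_cochain) (simp add: coefficient_cochain_def fun_eq_iff)
    hence "coefficient_cochain f m \<in> W.cocycles" "coefficient_cochain f m [] = 0"
      using f by (simp_all add: cochains_coefficient_cochain) (simp add: coefficient_cochain_def)
    from weyl_cocycle_is_bounded_coboundary[OF this bounded_coefficient_cochain[OF N]]
    show ?thesis by blast
  qed
  then obtain g where g: "\<And>m. multilinear weyl_scalar (g m)" "\<And>m. bounded_cochain N (g m)"
    "\<And>m. coefficient_cochain f m = coboundary (g m)" by metis
  have "bounded_cochain N (assemble g)"
    using g(2) by (auto simp: bounded_cochain_def intro: assemble_eq_0)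
  hence G: "assemble g \<in> cochains weyl_fps_scalar"
    using multilinear_assemble[OF g(1)] by (auto simp: cochains_iff)
  define h where "h = (\<lambda>xs. f xs - coboundary (assemble g) xs)"
  \<comment> \<open>On constants the two cochains agree coefficient by coefficient, and modulo
    \<open>fps_X\<close> every series is a constant.\<close>
  have "h = (\<lambda>_. 0)"
  proof (rule fps_cochain_eq_0[of _ "range fps_const"])
    show "h \<in> cochains weyl_fps_scalar"
      using f G WF.cochains_coboundary[OF G] by (simp add: h_def cochains_diff)
    show "\<exists>d\<in>range fps_const. \<exists>b. a = d + fps_X * b" for a :: "'k weyl fps"
      by (intro bexI[of _ "fps_const (fps_nth a 0)"] exI[of _ "fps_shift 1 a"]) (auto simp: fps_eq_iff)
    fix xs :: "'k weyl fps list" assume "set xs \<subseteq> range fps_const"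
    then obtain as where as: "xs = map fps_const as" by (metis ex_map_conv subsetD imageE)
    have "coefficient_cochain f m as = coefficient_cochain (coboundary (assemble g)) m as" for m
      by (simp add: coboundary_coefficient_cochain[symmetric] coefficient_cochain_assemble g)
    thus "h xs = 0" by (simp add: h_def as fps_eq_iff coefficient_cochain_def)
  qed
  hence "f = coboundary (assemble g)" by (simp add: h_def fun_eq_iff)
  thus ?thesis using that G by blast
qed

section \<open>Transport to the completed q-Weyl algebra\<close>

lemma qweyl_hat_scalar_central: "qweyl_hat_scalar r * (a :: 'k::field_char_0 qweyl_hat) = a * qweyl_hat_scalar r"
  by (rule injD[OF inj_hat_to_fps]) (simp add: hat_to_fps_mult hat_to_fps_scalar weyl_fps_scalar_central)

interpretation H: central_scalars "qweyl_hat_scalar :: 'k::field_char_0 fps \<Rightarrow> _"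
  by standard (rule qweyl_hat_scalar_central)

lemma fps_to_hat_add: "fps_to_hat (a + b) = fps_to_hat a + fps_to_hat b"
  and fps_to_hat_mult: "fps_to_hat (a * b) = fps_to_hat a * fps_to_hat b"
  and fps_to_hat_scalar: "fps_to_hat (weyl_fps_scalar r) = qweyl_hat_scalar r"
  by (simp_all add: fps_to_hat_eqI hat_to_fps_add hat_to_fps_mult hat_to_fps_scalar)

definition cochain_to_fps ::
  "('k::field_char_0 qweyl_hat list \<Rightarrow> 'k qweyl_hat) \<Rightarrow> 'k weyl fps list \<Rightarrow> 'k weyl fps" where
  "cochain_to_fps f xs = hat_to_fps (f (map fps_to_hat xs))"

definition cochain_to_hat ::
  "('k::field_char_0 weyl fps list \<Rightarrow> 'k weyl fps) \<Rightarrow> 'k qweyl_hat list \<Rightarrow> 'k qweyl_hat" where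
  "cochain_to_hat f xs = fps_to_hat (f (map hat_to_fps xs))"

lemma hat_to_fps_0 [simp]: "hat_to_fps 0 = 0"
  using hat_to_fps_add[of 0 0] by simp

lemma hat_to_fps_diff: "hat_to_fps (a - b) = hat_to_fps a - hat_to_fps b"
  using hat_to_fps_add[of "a - b" b] by simp

lemma fps_to_hat_0 [simp]: "fps_to_hat 0 = 0"
  by (rule fps_to_hat_eqI) simp

lemma cochain_to_hat_inverse [simp]: "cochain_to_hat (cochain_to_fps f) = f"
  by (simp add: cochain_to_hat_def cochain_to_fps_def fun_eq_iff o_def)

lemma cochains_cochain_to_fps:
  assumes "f \<in> cochains qweyl_hat_scalar"
  shows "cochain_to_fps f \<in> cochains weyl_fps_scalar"
proof -
  have "bounded_cochain N f \<Longrightarrow> bounded_cochain N (cochain_to_fps f)" for N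
    by (simp add: bounded_cochain_def cochain_to_fps_def)
  moreover have "multilinear qweyl_hat_scalar f \<Longrightarrow> multilinear weyl_fps_scalar (cochain_to_fps f)"
    by (simp add: multilinear_def cochain_to_fps_def fps_to_hat_add fps_to_hat_mult fps_to_hat_scalar
        hat_to_fps_add hat_to_fps_mult hat_to_fps_scalar)
  ultimately show ?thesis using assms by (auto simp: cochains_iff)
qed

lemma cochains_cochain_to_hat:
  assumes "f \<in> cochains weyl_fps_scalar"
  shows "cochain_to_hat f \<in> cochains qweyl_hat_scalar"
proof -
  have "bounded_cochain N f \<Longrightarrow> bounded_cochain N (cochain_to_hat f)" for N
    by (simp add: bounded_cochain_def cochain_to_hat_def)
  moreover have "multilinear weyl_fps_scalar f \<Longrightarrow> multilinear qweyl_hat_scalar (cochain_to_hat f)"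
    by (simp add: multilinear_def cochain_to_hat_def fps_to_hat_add fps_to_hat_mult fps_to_hat_scalar
        hat_to_fps_add hat_to_fps_mult hat_to_fps_scalar)
  ultimately show ?thesis using assms by (auto simp: cochains_iff)
qed

lemma coboundary_cochain_to_fps: "coboundary (cochain_to_fps f) = cochain_to_fps (coboundary f)"
proof
  fix as
  have "rmul (cochain_to_fps f) as = hat_to_fps (rmul f (map fps_to_hat as))" for as
  proof (induction as arbitrary: f rule: induct_list012)
    case (3 a b cs)
    show ?case using 3(2)[of "\<lambda>xs. f (fps_to_hat a # xs)"]
      by (simp add: cochain_to_fps_def[abs_def] fps_to_hat_mult hat_to_fps_diff)
  qed (simp_all add: cochain_to_fps_def hat_to_fps_mult)
  thus "coboundary (cochain_to_fps f) as = cochain_to_fps (coboundary f) as"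
    by (cases as) (simp_all add: coboundary_Cons cochain_to_fps_def hat_to_fps_mult hat_to_fps_diff)
qed

lemma coboundary_cochain_to_hat: "coboundary (cochain_to_hat f) = cochain_to_hat (coboundary f)"
proof -
  have "cochain_to_fps (cochain_to_hat f) = f" for f :: "'a weyl fps list \<Rightarrow> 'a weyl fps"
    by (simp add: cochain_to_hat_def cochain_to_fps_def fun_eq_iff o_def)
  hence "cochain_to_fps (coboundary (cochain_to_hat f)) = coboundary f"
    by (simp add: coboundary_cochain_to_fps[symmetric])
  from arg_cong[OF this, of cochain_to_hat] show ?thesis by simp
qed

theorem qweyl_hat_cocycle_is_coboundary:
  fixes f :: "'k::field_char_0 qweyl_hat list \<Rightarrow> 'k qweyl_hat"
  assumes f: "f \<in> H.cocycles" "f [] = 0"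
  obtains g where "g \<in> cochains qweyl_hat_scalar" "f = coboundary g"
proof -
  have "cochain_to_fps f \<in> WF.cocycles" "cochain_to_fps f [] = 0"
    using f by (simp_all add: cochains_cochain_to_fps coboundary_cochain_to_fps)
      (simp_all add: cochain_to_fps_def fun_eq_iff)
  then obtain g where g: "g \<in> cochains weyl_fps_scalar" "cochain_to_fps f = coboundary g"
    by (rule weyl_fps_cocycle_is_coboundary)
  have "f = coboundary (cochain_to_hat g)"
    by (simp add: coboundary_cochain_to_hat g(2)[symmetric])
  thus ?thesis using that cochains_cochain_to_hat[OF g(1)] by blast
qed

text \<open>W_q is dense in its completion: modulo \<open>fps_X\<close>, a series is the image of
  the lift of its constant coefficient.\<close>

lemma hat_cochain_eq_0:
  fixes f :: "'k::field_char_0 qweyl_hat list \<Rightarrow> 'k qweyl_hat"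
  assumes f: "f \<in> cochains qweyl_hat_scalar" "\<And>xs. f (map to_hat xs) = 0"
  shows "f = (\<lambda>_. 0)"
proof -
  have "cochain_to_fps f = (\<lambda>_. 0)"
  proof (rule fps_cochain_eq_0[OF cochains_cochain_to_fps[OF f(1)], of "range qweyl_to_fps"])
    show "\<exists>d\<in>range qweyl_to_fps. \<exists>b. a = d + fps_X * b" for a :: "'k weyl fps"
      by (rule bexI[of _ "qweyl_to_fps (weyl_lift (fps_nth a 0))"],
          rule exI[of _ "fps_shift 1 (a - qweyl_to_fps (weyl_lift (fps_nth a 0)))"])
        (auto simp: fps_eq_iff weyl_lift_nth_0)
    fix xs :: "'k weyl fps list" assume "set xs \<subseteq> range qweyl_to_fps"
    then obtain as where as: "xs = map qweyl_to_fps as" by (metis ex_map_conv subsetD imageE)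
    have "fps_to_hat (qweyl_to_fps a) = to_hat a" for a :: "'k qweyl"
      by (rule fps_to_hat_eqI) (rule hat_to_fps_to_hat)
    thus "cochain_to_fps f xs = 0" using f(2)[of as] by (simp add: cochain_to_fps_def as o_def)
  qed
  from arg_cong[OF this, of cochain_to_hat] show ?thesis
    by (simp add: cochain_to_hat_def[of "\<lambda>_. 0"] fun_eq_iff)
qed

section \<open>Fragile classes\<close>

context central_scalars
begin

lemma carrier_cocycle_ring [simp]: "carrier (cocycle_ring \<eta>) = cocycles"
  by (simp add: cocycle_ring_def)

lemma HH_class_hom: "HH_class \<eta> \<in> ring_hom (cocycle_ring \<eta>) (HH \<eta>)"
  using ideal.rcos_ring_hom[OF ideal_coboundaries] by (simp add: HH_class_def[abs_def] HH_def)

lemma ring_HH: "ring (HH \<eta>)"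
  unfolding HH_def by (rule ideal.quotient_is_ring[OF ideal_coboundaries])

lemma carrier_HH: "carrier (HH \<eta>) = HH_class \<eta> ` cocycles"
  by (auto simp: HH_def HH_class_def FactRing_def A_RCOSETS_def' image_iff)

lemma HH_class_eq_iff:
  assumes "f \<in> cocycles" "g \<in> cocycles"
  shows "HH_class \<eta> f = HH_class \<eta> g \<longleftrightarrow> (\<lambda>xs. f xs - g xs) \<in> coboundaries \<eta>"
proof -
  interpret ring "cocycle_ring \<eta>" by (rule ring_cocycle_ring)
  have "f \<ominus>\<^bsub>cocycle_ring \<eta>\<^esub> g = (\<lambda>xs. f xs - g xs)"
    using assms by (simp add: a_minus_def a_inv_cocycle_ring) (simp add: cocycle_ring_def)
  thus ?thesis
    using quotient_eq_iff_same_a_r_cos[OF ideal_coboundaries, of f g] assms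
    by (simp add: HH_class_def)
qed

lemma HH_class_eq_zero_iff:
  assumes "f \<in> cocycles"
  shows "HH_class \<eta> f = \<zero>\<^bsub>HH \<eta>\<^esub> \<longleftrightarrow> f \<in> coboundaries \<eta>"
proof -
  interpret ring "cocycle_ring \<eta>" by (rule ring_cocycle_ring)
  have "\<zero>\<^bsub>HH \<eta>\<^esub> = HH_class \<eta> (\<lambda>_. 0)"
    using a_rcos_zero[OF ideal_coboundaries coboundaries_0] by (simp add: HH_class_def HH_def FactRing_def)
  thus ?thesis using HH_class_eq_iff[OF assms, of "\<lambda>_. 0"] by (simp add: cochains_0)
qed

text \<open>Coboundaries vanish on the empty list, so the value there is an invariant of the
  class.\<close>

lemma mem_HH_class:
  assumes "f \<in> cocycles" "g \<in> HH_class \<eta> f"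
  shows "g \<in> cocycles" "g [] = f []"
proof -
  interpret ring "cocycle_ring \<eta>" by (rule ring_cocycle_ring)
  obtain h where h: "h \<in> coboundaries \<eta>" "g = h \<oplus>\<^bsub>cocycle_ring \<eta>\<^esub> f"
    using assms(2) by (auto simp: HH_class_def a_r_coset_def')
  have hc: "h \<in> cocycles" using coboundaries_subset h(1) by auto
  show "g \<in> cocycles" using h(2) hc assms(1) a_closed[of h f] by simp
  have "h [] = 0" using h(1) by (auto simp: coboundaries_def)
  thus "g [] = f []" by (simp add: h(2)) (simp add: cocycle_ring_def)
qed

lemma HH_class_self:
  assumes "f \<in> cocycles"
  shows "f \<in> HH_class \<eta> f"
  unfolding HH_class_def
  by (rule abelian_subgroup.a_rcos_self[OF abelian_subgroupI3[OF ideal.axioms(1)[OF ideal_coboundaries]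
        ring.is_abelian_group[OF ring_cocycle_ring]]]) (use assms in simp)

lemma HH_class_add:
  assumes "f \<in> cocycles" "g \<in> cocycles"
  shows "HH_class \<eta> f \<oplus>\<^bsub>HH \<eta>\<^esub> HH_class \<eta> g = HH_class \<eta> (\<lambda>xs. f xs + g xs)"
  using ring_hom_memE(3)[OF HH_class_hom, of f g] assms by simp (simp add: cocycle_ring_def)

lemma HH_class_mult:
  assumes "f \<in> cocycles" "g \<in> cocycles"
  shows "HH_class \<eta> f \<otimes>\<^bsub>HH \<eta>\<^esub> HH_class \<eta> g = HH_class \<eta> (cup f g)"
  using ring_hom_memE(2)[OF HH_class_hom, of f g] assms by simp (simp add: cocycle_ring_def)

lemma const_cocycle:
  assumes "\<And>a. c * a = a * c"
  shows "const_cochain c \<in> cocycles"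
proof -
  have "coboundary (const_cochain c) xs = 0" for xs
  proof (induction xs rule: induct_list012)
    case (3 a b cs)
    have "(\<lambda>xs. const_cochain c (a # xs)) = (\<lambda>_. 0)" by (simp add: const_cochain_def fun_eq_iff)
    thus ?case by (simp add: coboundary_Cons) (simp add: const_cochain_def)
  qed (simp_all add: coboundary_Cons const_cochain_def assms)
  thus ?thesis by (simp add: cochains_const fun_eq_iff)
qed

text \<open>The first hypothesis is the vanishing in all positive degrees at once, for cocycles that
  may mix degrees. The zero cochain counts as homogeneous of every degree, so the summand is not
  empty.\<close>

lemma HH_deg_pos:
  assumes "\<And>f. f \<in> cocycles \<Longrightarrow> f [] = 0 \<Longrightarrow> f \<in> coboundaries \<eta>" "n > 0"
  shows "HH_deg \<eta> n = {\<zero>\<^bsub>HH \<eta>\<^esub>}"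
proof -
  have zero: "(\<lambda>_. 0) \<in> cocycles" by (simp add: cochains_0)
  have "HH_class \<eta> f = \<zero>\<^bsub>HH \<eta>\<^esub>" if "f \<in> cocycles" "homogeneous n f" for f
  proof -
    have "f [] = 0" using that(2) assms(2) by (simp add: homogeneous_def)
    thus ?thesis using HH_class_eq_zero_iff[OF that(1)] assms(1) that(1) by blast
  qed
  moreover have "homogeneous n (\<lambda>_. 0)" by (simp add: homogeneous_def)
  ultimately show ?thesis using zero unfolding HH_deg_def carrier_cocycle_ring by blast
qed

end

lemma (in quantum_weyl) scalar_eq_0D: "\<eta> c = 0 \<Longrightarrow> c = 0"
  using act_scalar[of c "\<lambda>_. 1"] act_0[of "\<lambda>_. 1"] by (auto dest: fun_cong[of _ _ 0])

section \<open>The extension of cochains to the completion\<close>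

lemma to_hat_add: "to_hat (a + b) = to_hat a + to_hat (b :: 'k::field_char_0 qweyl)"
  and to_hat_mult: "to_hat (a * b) = to_hat a * to_hat b"
  by (rule injD[OF inj_hat_to_fps], simp add: hat_to_fps_to_hat hat_to_fps_add hat_to_fps_mult
      qweyl_to_fps_add qweyl_to_fps_mult)+

lemma to_hat_0 [simp]: "to_hat 0 = 0"
  by (simp add: to_hat_def zero_qweyl_hat_def)

lemma to_hat_diff: "to_hat (a - b) = to_hat a - to_hat (b :: 'k::field_char_0 qweyl)"
  using to_hat_add[of "a - b" b] by simp

text \<open>Multilinearity over k[\<hbar>] makes a cochain continuous: changing one argument by a
  multiple of \<open>hbar ^ N\<close> changes the value by such a multiple. The arguments are
  exchanged one after the other.\<close>

lemma cochain_hbar_dvd: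
  fixes f :: "'k::field_char_0 qweyl list \<Rightarrow> 'k qweyl"
  assumes f: "f \<in> cochains qweyl_scalar" and dvd: "list_all2 (\<lambda>a b. hbar ^ N dvd a - b) xs ys"
  shows "hbar ^ N dvd f xs - f ys"
proof -
  have lin: "multilinear qweyl_scalar f" using f by (simp add: cochains_iff)
  have scalar: "hbar ^ N = (qweyl_scalar ([:0, 1:] ^ N) :: 'k qweyl)"
    by (induction N) (simp_all add: hbar_def qweyl_scalar_one qweyl_scalar_mult del: mult_pCons_left)
  have "hbar ^ N dvd f (us @ xs) - f (us @ ys)" for us
    using dvd
  proof (induction arbitrary: us rule: list_all2_induct)
    case Nil
    show ?case by (simp add: hbar_dvd_0)
  next
    case (Cons a as b bs)
    obtain c where c: "a = b + hbar ^ N * c" using Cons(1) by (auto simp: dvd_def algebra_simps)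
    have "f (us @ a # as) - f (us @ b # bs)
        = hbar ^ N * f (us @ c # as) + (f ((us @ [b]) @ as) - f ((us @ [b]) @ bs))"
      unfolding c multilinear_app(1)[OF lin] unfolding scalar multilinear_app(2)[OF lin] by simp
    moreover have "hbar ^ N dvd hbar ^ N * f (us @ c # as)" by (auto simp: dvd_def)
    ultimately show ?case using hbar_dvd_add Cons(3) by metis
  qed
  from this[of "[]"] show ?thesis by simp
qed

lemma cochain_Cauchy:
  fixes f :: "'k::field_char_0 qweyl list \<Rightarrow> 'k qweyl"
  assumes f: "f \<in> cochains qweyl_scalar" and ss: "\<forall>s\<in>set ss. hbar_Cauchy s"
  shows "hbar_Cauchy (\<lambda>n. f (map (\<lambda>s. s n) ss))"
  unfolding hbar_Cauchy_def
proof
  fix N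
  have "\<exists>m. \<forall>i\<ge>m. \<forall>j\<ge>m. list_all2 (\<lambda>a b. hbar ^ N dvd a - b) (map (\<lambda>s. s i) ss) (map (\<lambda>s. s j) ss)"
    using ss
  proof (induction ss)
    case (Cons s ss)
    obtain m1 where "\<forall>i\<ge>m1. \<forall>j\<ge>m1. list_all2 (\<lambda>a b. hbar ^ N dvd a - b) (map (\<lambda>s. s i) ss) (map (\<lambda>s. s j) ss)"
      using Cons by auto
    moreover obtain m2 where "\<forall>i\<ge>m2. \<forall>j\<ge>m2. hbar ^ N dvd s i - s j"
      using Cons.prems unfolding hbar_Cauchy_def by (meson list.set_intros(1))
    ultimately show ?case by (intro exI[of _ "max m1 m2"]) simp
  qed simp
  thus "\<exists>m. \<forall>i\<ge>m. \<forall>j\<ge>m. hbar ^ N dvd f (map (\<lambda>s. s i) ss) - f (map (\<lambda>s. s j) ss)"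
    using cochain_hbar_dvd[OF f] by blast
qed

lemma qweyl_hat_list_cases:
  obtains ss where "xs = map abs_qweyl_hat ss" "\<forall>s\<in>set ss. hbar_Cauchy s"
proof -
  have "\<exists>ss. xs = map abs_qweyl_hat ss \<and> (\<forall>s\<in>set ss. hbar_Cauchy s)"
  proof (induction xs)
    case (Cons z xs)
    then obtain ss where "xs = map abs_qweyl_hat ss" "\<forall>s\<in>set ss. hbar_Cauchy s" by blast
    moreover obtain s where "z = abs_qweyl_hat s" "hbar_Cauchy s" by (rule qweyl_hat_cases)
    ultimately show ?case by (intro exI[of _ "s # ss"]) simp
  qed simp
  thus ?thesis using that by blast
qed

lemma cochains_extend_cochain:
  fixes f :: "'k::field_char_0 qweyl list \<Rightarrow> 'k qweyl"
  assumes f: "f \<in> cochains qweyl_scalar"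
  shows "extend_cochain f \<in> cochains qweyl_hat_scalar"
proof -
  have lin: "multilinear qweyl_scalar f" using f by (simp add: cochains_iff)
  note abs = extend_cochain_abs[OF f]
  note C = hbar_rel_refl[OF cochain_Cauchy[OF f]]
  have "bounded_cochain N f \<Longrightarrow> bounded_cochain N (extend_cochain f)" for N
    by (simp add: bounded_cochain_def extend_cochain_def zero_qweyl_hat_def)
  moreover have "multilinear qweyl_hat_scalar (extend_cochain f)"
  proof (rule multilinearI)
    fix us vs :: "'k qweyl_hat list" and a b :: "'k qweyl_hat" and r :: "'k fps"
    obtain us' where us: "us = map abs_qweyl_hat us'" "\<forall>s\<in>set us'. hbar_Cauchy s"
      by (rule qweyl_hat_list_cases)
    obtain vs' where vs: "vs = map abs_qweyl_hat vs'" "\<forall>s\<in>set vs'. hbar_Cauchy s"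
      by (rule qweyl_hat_list_cases)
    obtain s where s: "a = abs_qweyl_hat s" "hbar_Cauchy s" by (rule qweyl_hat_cases)
    obtain t where t: "b = abs_qweyl_hat t" "hbar_Cauchy t" by (rule qweyl_hat_cases)
    define p where "p n = Poly (map (fps_nth r) [0..<n])" for n
    have r: "qweyl_hat_scalar r = abs_qweyl_hat (\<lambda>n. qweyl_scalar (p n))"
      by (simp add: qweyl_hat_scalar_def p_def)
    have p: "hbar_Cauchy (\<lambda>n. qweyl_scalar (p n))"
      unfolding p_def by (rule represents_Cauchy[OF represents_truncations])
    have app: "extend_cochain f (us @ abs_qweyl_hat s # vs)
        = abs_qweyl_hat (\<lambda>n. f (map (\<lambda>s. s n) us' @ s n # map (\<lambda>s. s n) vs'))"
      if "hbar_Cauchy s" for s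
      using abs[of "us' @ s # vs'"] us vs that by auto
    have C': "hbar_rel (\<lambda>n. f (map (\<lambda>s. s n) us' @ s n # map (\<lambda>s. s n) vs'))
        (\<lambda>n. f (map (\<lambda>s. s n) us' @ s n # map (\<lambda>s. s n) vs'))" if "hbar_Cauchy s" for s
      using C[of "us' @ s # vs'"] us vs that by auto
    have "a + b = abs_qweyl_hat (\<lambda>n. s n + t n)"
      unfolding s(1) t(1) by (rule plus_qweyl_hat.abs_eq) (intro hbar_rel_refl s t)+
    thus "extend_cochain f (us @ (a + b) # vs) = extend_cochain f (us @ a # vs) + extend_cochain f (us @ b # vs)"
      by (simp add: app hbar_Cauchy_add s t multilinear_app(1)[OF lin] plus_qweyl_hat.abs_eq C')
    have "qweyl_hat_scalar r * a = abs_qweyl_hat (\<lambda>n. qweyl_scalar (p n) * s n)"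
      unfolding r s(1) by (rule times_qweyl_hat.abs_eq) (intro hbar_rel_refl s p)+
    moreover have "hbar_Cauchy (\<lambda>n. qweyl_scalar (p n) * s n)" by (intro hbar_Cauchy_mult s p)
    ultimately show "extend_cochain f (us @ (qweyl_hat_scalar r * a) # vs)
        = qweyl_hat_scalar r * extend_cochain f (us @ a # vs)"
      by (simp add: app s r multilinear_app(2)[OF lin] times_qweyl_hat.abs_eq C' hbar_rel_refl p)
  qed
  ultimately show ?thesis using f by (auto simp: cochains_iff)
qed

text \<open>By density it suffices to look at arguments from W_q. There the extension restricts to
  \<open>f\<close>, and its coboundary to that of \<open>f\<close>.\<close>

lemma coboundary_extend_cochain:
  fixes f :: "'k::field_char_0 qweyl list \<Rightarrow> 'k qweyl"
  assumes f: "f \<in> Q.cocycles"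
  shows "coboundary (extend_cochain f) = (\<lambda>_. 0)"
proof (rule hat_cochain_eq_0)
  have f': "f \<in> cochains qweyl_scalar" using f by simp
  show "coboundary (extend_cochain f) \<in> cochains qweyl_hat_scalar"
    by (intro H.cochains_coboundary cochains_extend_cochain f')
  have rmul: "rmul F (map to_hat as) = to_hat (rmul f as)"
    if "\<And>xs. F (map to_hat xs) = to_hat (f xs)"
    for F and f :: "'k qweyl list \<Rightarrow> 'k qweyl" and as
    using that
  proof (induction as arbitrary: F f rule: induct_list012)
    case (2 a)
    thus ?case using 2[of "[]"] by (simp add: to_hat_mult)
  next
    case (3 a b cs)
    have "rmul (\<lambda>xs. F (to_hat a # xs)) (map to_hat (b # cs)) = to_hat (rmul (\<lambda>xs. f (a # xs)) (b # cs))"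
      by (rule 3(2)) (use 3(3)[of "a # _"] in simp)
    thus ?case using 3(3)[of "(a * b) # cs"] by (simp add: to_hat_mult to_hat_diff)
  qed simp
  fix xs :: "'k qweyl list"
  note ext = extend_cochain_to_hat[OF f']
  have "coboundary (extend_cochain f) (map to_hat xs) = to_hat (coboundary f xs)"
    using rmul[of "extend_cochain f" f xs, OF ext]
    by (cases xs) (simp_all add: coboundary_Cons to_hat_diff to_hat_mult ext)
  thus "coboundary (extend_cochain f) (map to_hat xs) = 0" using f by simp
qed

lemma extend_cocycle: "f \<in> Q.cocycles \<Longrightarrow> extend_cochain f \<in> H.cocycles"
  by (simp add: cochains_extend_cochain coboundary_extend_cochain)

lemma extend_cochain_Nil: "extend_cochain f [] = to_hat (f [])"
  by (simp add: extend_cochain_def to_hat_def)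

section \<open>Fragile classes as those that vanish in degree zero\<close>

lemma qweyl_hat_coboundary_iff:
  fixes f :: "'k::field_char_0 qweyl_hat list \<Rightarrow> 'k qweyl_hat"
  assumes f: "f \<in> H.cocycles"
  shows "f \<in> coboundaries qweyl_hat_scalar \<longleftrightarrow> f [] = 0"
proof
  assume "f [] = 0"
  then obtain g where "g \<in> cochains qweyl_hat_scalar" "f = coboundary g"
    using qweyl_hat_cocycle_is_coboundary[OF f] by blast
  thus "f \<in> coboundaries qweyl_hat_scalar" by (simp add: coboundaries_def)
qed (auto simp: coboundaries_def)

lemma qweyl_hat_class_eq_iff:
  fixes f g :: "'k::field_char_0 qweyl_hat list \<Rightarrow> 'k qweyl_hat"
  assumes "f \<in> H.cocycles" "g \<in> H.cocycles"
  shows "HH_class qweyl_hat_scalar f = HH_class qweyl_hat_scalar g \<longleftrightarrow> f [] = g []"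
proof -
  have "(\<lambda>xs. f xs - g xs) \<in> H.cocycles"
    using assms by (auto simp: cochains_diff coboundary_diff intro!: ext)
  thus ?thesis using H.HH_class_eq_iff[OF assms] qweyl_hat_coboundary_iff by fastforce
qed

text \<open>\<open>HH_extend\<close> is a union over representatives. It is a single coset because a
  class of the completion is determined by its value on the empty list, and there all
  representatives agree.\<close>

lemma HH_extend_class:
  fixes f :: "'k::field_char_0 qweyl list \<Rightarrow> 'k qweyl"
  assumes f: "f \<in> Q.cocycles"
  shows "HH_extend (HH_class qweyl_scalar f) = HH_class qweyl_hat_scalar (extend_cochain f)"
proof -
  have "HH_class qweyl_hat_scalar (extend_cochain g) = HH_class qweyl_hat_scalar (extend_cochain f)"
    if "g \<in> HH_class qweyl_scalar f" for g
    using qweyl_hat_class_eq_iff[OF extend_cocycle extend_cocycle[OF f]] Q.mem_HH_class[OF f that]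
    by (simp add: extend_cochain_Nil)
  thus ?thesis using Q.HH_class_self[OF f] unfolding HH_extend_def by blast
qed

lemma cocycle_Nil_scalar:
  fixes f :: "'k::field_char_0 qweyl list \<Rightarrow> 'k qweyl"
  assumes "f \<in> Q.cocycles"
  obtains p where "f [] = qweyl_scalar p"
proof -
  have "coboundary f = (\<lambda>_. 0)" using assms by simp
  from fun_cong[OF this, of "[_]"] have "a * f [] = f [] * a" for a by (simp add: coboundary_Cons)
  thus ?thesis using Q.center_scalar[of "f []"] that by metis
qed

text \<open>In positive degrees the image is zero already, as the groups of the completion vanish.
  In degree zero it is a polynomial in \<hbar>, on which multiplication by a power of \<hbar> is
  injective.\<close>

lemma fragile_class_iff:
  fixes f :: "'k::field_char_0 qweyl list \<Rightarrow> 'k qweyl"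
  assumes f: "f \<in> Q.cocycles"
  shows "HH_class qweyl_scalar f \<in> fragile \<longleftrightarrow> f [] = 0"
proof -
  have central: "const_cochain (qweyl_hat_scalar r) \<in> H.cocycles" for r :: "'k fps"
    by (rule H.const_cocycle) (rule qweyl_hat_scalar_central)
  have "HH_scalar qweyl_hat_scalar (fps_X ^ m) \<otimes>\<^bsub>HH qweyl_hat_scalar\<^esub> HH_extend (HH_class qweyl_scalar f)
      = \<zero>\<^bsub>HH qweyl_hat_scalar\<^esub> \<longleftrightarrow> f [] = 0" for m
  proof -
    let ?g = "cup (const_cochain (qweyl_hat_scalar (fps_X ^ m))) (extend_cochain f)"
    have g: "?g \<in> H.cocycles" by (intro H.cocycles_cup central extend_cocycle f)
    have "HH_scalar qweyl_hat_scalar (fps_X ^ m) \<otimes>\<^bsub>HH qweyl_hat_scalar\<^esub> HH_extend (HH_class qweyl_scalar f)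
        = HH_class qweyl_hat_scalar ?g"
      unfolding HH_scalar_def HH_extend_class[OF f] by (rule H.HH_class_mult[OF central extend_cocycle[OF f]])
    hence "?thesis \<longleftrightarrow> (?g [] = 0 \<longleftrightarrow> f [] = 0)"
      using H.HH_class_eq_zero_iff[OF g] qweyl_hat_coboundary_iff[OF g] by simp
    also have "?g [] = 0 \<longleftrightarrow> fps_X ^ m * qweyl_to_fps (f []) = 0"
    proof -
      have "hat_to_fps (?g []) = fps_X ^ m * qweyl_to_fps (f [])"
        by (simp add: const_cochain_def extend_cochain_Nil hat_to_fps_mult hat_to_fps_scalar
            weyl_fps_scalar_X_power hat_to_fps_to_hat)
      thus ?thesis by (metis injD[OF inj_hat_to_fps] hat_to_fps_0)
    qed
    also have "\<dots> \<longleftrightarrow> f [] = 0"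
    proof
      assume eq: "fps_X ^ m * qweyl_to_fps (f []) = 0"
      have "fps_nth (qweyl_to_fps (f [])) n = 0" for n
        using arg_cong[OF eq, of "\<lambda>F. fps_nth F (n + m)"] by (simp add: fps_X_power_mult_nth)
      moreover obtain p where p: "f [] = qweyl_scalar p" using cocycle_Nil_scalar[OF f] by blast
      ultimately have "coeff p n = 0" for n
        by (intro W.scalar_eq_0D) (simp add: qweyl_to_fps_scalar)
      hence "p = 0" by (intro poly_eqI) simp
      thus "f [] = 0" using p by simp
    qed (simp add: qweyl_to_fps_0)
    finally show ?thesis by simp
  qed
  thus ?thesis using f by (auto simp: fragile_def Q.carrier_HH)
qed

lemma fragile_eq: "fragile = HH_class qweyl_scalar ` {f \<in> Q.cocycles. f [] = (0 :: 'k::field_char_0 qweyl)}"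
proof -
  have "c \<in> HH_class qweyl_scalar ` {f \<in> Q.cocycles. f [] = (0 :: 'k qweyl)}" if c: "c \<in> fragile" for c
  proof -
    obtain f where "f \<in> Q.cocycles" "c = HH_class qweyl_scalar f"
      using c by (auto simp: fragile_def Q.carrier_HH)
    thus ?thesis using c fragile_class_iff by blast
  qed
  thus ?thesis using fragile_class_iff by blast
qed

lemma HH_deg_fragile:
  assumes "n > 0"
  shows "HH_deg (qweyl_scalar :: 'k::field_char_0 poly \<Rightarrow> 'k qweyl) n \<subseteq> fragile"
proof -
  have "f [] = 0" if "homogeneous n f" for f :: "'k qweyl list \<Rightarrow> 'k qweyl"
    using that assms by (simp add: homogeneous_def)
  thus ?thesis by (auto simp: HH_deg_def fragile_eq)
qed

text \<open>Evaluation on the empty list respects sums and cup products, and the fragile classes are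
  those on which it vanishes.\<close>

lemma ideal_fragile: "ideal fragile (HH (qweyl_scalar :: 'k::field_char_0 poly \<Rightarrow> 'k qweyl))"
proof (rule idealI[OF Q.ring_HH])
  let ?R = "HH (qweyl_scalar :: 'k poly \<Rightarrow> 'k qweyl)"
  interpret R: ring ?R by (rule Q.ring_HH)
  show "subgroup fragile (add_monoid ?R)"
  proof (rule group.subgroupI[OF R.a_group])
    show "fragile \<subseteq> carrier (add_monoid ?R)" by (auto simp: fragile_def)
    have "(\<lambda>_. 0) \<in> {f \<in> Q.cocycles. f [] = (0 :: 'k qweyl)}" by (simp add: cochains_0)
    thus "fragile \<noteq> ({} :: ('k qweyl list \<Rightarrow> 'k qweyl) set set)" unfolding fragile_eq by blast
    fix c d :: "('k qweyl list \<Rightarrow> 'k qweyl) set" assume "c \<in> fragile" "d \<in> fragile"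
    then obtain f g where f: "f \<in> Q.cocycles" "f [] = 0" "c = HH_class qweyl_scalar f"
      and g: "g \<in> Q.cocycles" "g [] = 0" "d = HH_class qweyl_scalar g"
      unfolding fragile_eq by blast
    have sum: "(\<lambda>xs. f xs + g xs) \<in> Q.cocycles"
      using f g by (auto simp: cochains_add coboundary_add intro!: ext)
    show "c \<otimes>\<^bsub>add_monoid ?R\<^esub> d \<in> fragile"
      using f(2,3) g(2,3) Q.HH_class_add[OF f(1) g(1)] fragile_class_iff[OF sum] by simp
    have neg: "(\<lambda>xs. - f xs) \<in> Q.cocycles"
      using f by (auto simp: cochains_uminus coboundary_uminus intro!: ext)
    have "HH_class qweyl_scalar (\<lambda>_. 0 :: 'k qweyl) = \<zero>\<^bsub>?R\<^esub>"
      using Q.HH_class_eq_zero_iff[of "\<lambda>_. 0"] by (simp add: cochains_0 Q.coboundaries_0)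
    hence "HH_class qweyl_scalar (\<lambda>xs. - f xs) \<oplus>\<^bsub>?R\<^esub> c = \<zero>\<^bsub>?R\<^esub>"
      unfolding f(3) Q.HH_class_add[OF neg f(1)] by simp
    hence "\<ominus>\<^bsub>?R\<^esub> c = HH_class qweyl_scalar (\<lambda>xs. - f xs)"
      by (rule R.minus_equality) (use f neg in \<open>auto simp: Q.carrier_HH\<close>)
    thus "inv\<^bsub>add_monoid ?R\<^esub> c \<in> fragile"
      using fragile_class_iff[OF neg] f(2) by (simp add: a_inv_def)
  qed
  fix c d :: "('k qweyl list \<Rightarrow> 'k qweyl) set" assume "c \<in> fragile" "d \<in> carrier ?R"
  then obtain f g where f: "f \<in> Q.cocycles" "f [] = 0" "c = HH_class qweyl_scalar f"
    and g: "g \<in> Q.cocycles" "d = HH_class qweyl_scalar g"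
    unfolding fragile_eq Q.carrier_HH by blast
  show "d \<otimes>\<^bsub>?R\<^esub> c \<in> fragile" "c \<otimes>\<^bsub>?R\<^esub> d \<in> fragile"
    unfolding f(3) g(2) Q.HH_class_mult[OF g(1) f(1)] Q.HH_class_mult[OF f(1) g(1)]
    using fragile_class_iff[OF Q.cocycles_cup[OF g(1) f(1)]]
      fragile_class_iff[OF Q.cocycles_cup[OF f(1) g(1)]] f(2) by simp_all
qed

section \<open>The scalars in the resilient cohomology\<close>

lemma scalar_cocycle: "const_cochain (qweyl_scalar p) \<in> Q.cocycles"
  by (rule Q.const_cocycle) (rule qweyl_scalar_central)

lemma resilient_scalar_hom:
  "resilient_scalar \<in> ring_hom (ring_of_type_algebra :: 'k::field_char_0 poly ring) resilient"
proof -
  have "(\<lambda>p. const_cochain (qweyl_scalar p)) \<in>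
      ring_hom (ring_of_type_algebra :: 'k poly ring) (cocycle_ring qweyl_scalar)"
  proof (rule ring_hom_memI)
    fix p q :: "'k poly"
    show "const_cochain (qweyl_scalar p) \<in> carrier (cocycle_ring qweyl_scalar)"
      using scalar_cocycle by simp
    show "const_cochain (qweyl_scalar (p \<oplus>\<^bsub>ring_of_type_algebra\<^esub> q))
        = const_cochain (qweyl_scalar p) \<oplus>\<^bsub>cocycle_ring qweyl_scalar\<^esub> const_cochain (qweyl_scalar q)"
      by (simp add: ring_of_type_algebra_def cocycle_ring_def const_cochain_def qweyl_scalar_add fun_eq_iff)
    have "cup (const_cochain a) (const_cochain b) xs = const_cochain (a * b) xs" for a b :: "'k qweyl" and xs
    proof (cases xs)
      case (Cons c cs)
      have "(\<lambda>xs. const_cochain a (c # xs)) = (\<lambda>_. 0)" by (simp add: const_cochain_def)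
      thus ?thesis by (simp add: Cons) (simp add: const_cochain_def)
    qed (simp add: const_cochain_def)
    thus "const_cochain (qweyl_scalar (p \<otimes>\<^bsub>ring_of_type_algebra\<^esub> q))
        = const_cochain (qweyl_scalar p) \<otimes>\<^bsub>cocycle_ring qweyl_scalar\<^esub> const_cochain (qweyl_scalar q)"
      by (simp add: ring_of_type_algebra_def cocycle_ring_def qweyl_scalar_mult fun_eq_iff)
    show "const_cochain (qweyl_scalar \<one>\<^bsub>ring_of_type_algebra\<^esub>) = \<one>\<^bsub>cocycle_ring qweyl_scalar\<^esub>"
      by (simp add: ring_of_type_algebra_def cocycle_ring_def qweyl_scalar_one)
  qed
  \<comment> \<open>The map is a composite of three homomorphisms: scalars to constant cocycles,
    cocycles to classes, classes to the quotient by the fragile ideal.\<close>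
  from ring_hom_trans[OF ring_hom_trans[OF this Q.HH_class_hom] ideal.rcos_ring_hom[OF ideal_fragile]]
  show ?thesis
    by (simp add: resilient_def resilient_scalar_def[abs_def] HH_scalar_def o_def)
qed

lemma resilient_scalar_iso:
  "resilient_scalar \<in> ring_iso (ring_of_type_algebra :: 'k::field_char_0 poly ring) resilient"
proof -
  let ?R = "HH (qweyl_scalar :: 'k poly \<Rightarrow> 'k qweyl)"
  interpret R: ring ?R by (rule Q.ring_HH)
  interpret S: ring "resilient :: ('k qweyl list \<Rightarrow> 'k qweyl) set set ring"
    unfolding resilient_def by (rule ideal.quotient_is_ring[OF ideal_fragile])
  note hom = resilient_scalar_hom[where ?'k = 'k]
  have carrier: "resilient_scalar p \<in> carrier resilient" for p :: "'k poly"
    using ring_hom_memE(1)[OF hom] by (simp add: ring_of_type_algebra_def)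
  have add: "resilient_scalar (p + q) = resilient_scalar p \<oplus>\<^bsub>resilient\<^esub> resilient_scalar q" for p q :: "'k poly"
    using ring_hom_memE(3)[OF hom, of p q] by (simp add: ring_of_type_algebra_def)
  have "inj (resilient_scalar :: 'k poly \<Rightarrow> _)"
  proof (rule injI)
    fix p q :: "'k poly" assume eq: "resilient_scalar p = resilient_scalar q"
    have "resilient_scalar (p - q) \<oplus>\<^bsub>resilient\<^esub> resilient_scalar q = \<zero>\<^bsub>resilient\<^esub> \<oplus>\<^bsub>resilient\<^esub> resilient_scalar q"
      using add[of "p - q" q] eq carrier by simp
    hence "resilient_scalar (p - q) = \<zero>\<^bsub>resilient\<^esub>"
      using carrier by (simp only: S.add.right_cancel S.zero_closed)
    hence "fragile +>\<^bsub>?R\<^esub> HH_scalar qweyl_scalar (p - q) = fragile"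
      by (simp add: resilient_scalar_def resilient_def FactRing_def)
    hence "HH_scalar qweyl_scalar (p - q) \<in> fragile"
      by (rule ideal.rcos_const_imp_mem[OF ideal_fragile, rotated])
        (use scalar_cocycle in \<open>auto simp: HH_scalar_def Q.carrier_HH\<close>)
    hence "qweyl_scalar (p - q) = 0"
      using fragile_class_iff[OF scalar_cocycle[of "p - q"]] by (simp add: HH_scalar_def) (simp add: const_cochain_def)
    hence "p - q = 0" by (rule Q.scalar_eq_0D)
    thus "p = q" by simp
  qed
  moreover have "C \<in> range resilient_scalar" if C: "C \<in> carrier (resilient :: ('k qweyl list \<Rightarrow> 'k qweyl) set set ring)" for C
  proof -
    obtain f where f: "f \<in> Q.cocycles" "C = fragile +>\<^bsub>?R\<^esub> HH_class qweyl_scalar f"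
      using C by (auto simp: resilient_def FactRing_def A_RCOSETS_def' Q.carrier_HH)
    obtain p where p: "f [] = qweyl_scalar p" by (rule cocycle_Nil_scalar[OF f(1)])
    \<comment> \<open>A cocycle differs from the constant cochain of its central degree zero part by
      one that vanishes on the empty list, and the class of the latter is fragile.\<close>
    define h where "h = (\<lambda>xs. f xs - const_cochain (qweyl_scalar p) xs)"
    have h: "h \<in> Q.cocycles"
      unfolding h_def using f(1) scalar_cocycle[of p] by (auto simp: cochains_diff coboundary_diff intro!: ext)
    have "h [] = 0" by (simp add: h_def p const_cochain_def)
    hence hf: "HH_class qweyl_scalar h \<in> fragile" using fragile_class_iff[OF h] by simp
    have mem: "HH_class qweyl_scalar h \<in> carrier ?R" "HH_scalar qweyl_scalar p \<in> carrier ?R"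
      using h scalar_cocycle[of p] unfolding Q.carrier_HH HH_scalar_def by blast+
    have "HH_class qweyl_scalar f = HH_class qweyl_scalar h \<oplus>\<^bsub>?R\<^esub> HH_scalar qweyl_scalar p"
      unfolding HH_scalar_def Q.HH_class_add[OF h scalar_cocycle] by (simp add: h_def)
    hence "C = (fragile +>\<^bsub>?R\<^esub> HH_class qweyl_scalar h) \<oplus>\<^bsub>resilient\<^esub> resilient_scalar p"
      using ring_hom_memE(3)[OF ideal.rcos_ring_hom[OF ideal_fragile] mem]
      by (simp only: f(2) resilient_def resilient_scalar_def)
    also have "fragile +>\<^bsub>?R\<^esub> HH_class qweyl_scalar h = \<zero>\<^bsub>resilient\<^esub>"
      using R.a_rcos_zero[OF ideal_fragile hf] by (simp add: resilient_def FactRing_def)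
    finally show ?thesis using carrier by simp
  qed
  ultimately have "bij_betw (resilient_scalar :: 'k poly \<Rightarrow> _) UNIV (carrier resilient)"
    using carrier by (auto simp: bij_betw_def)
  thus ?thesis using hom by (simp add: ring_iso_def) (simp add: ring_of_type_algebra_def)
qed

theorem theorem4:
  shows "(\<exists>\<phi> :: 'k::field_char_0 weyl fps \<Rightarrow> 'k qweyl_hat.
           algebra_iso weyl_fps_scalar qweyl_hat_scalar \<phi>)
    \<and> (\<forall>n>0. HH_deg (qweyl_hat_scalar :: 'k fps \<Rightarrow> 'k qweyl_hat) n
               = {\<zero>\<^bsub>HH (qweyl_hat_scalar :: 'k fps \<Rightarrow> 'k qweyl_hat)\<^esub>})
    \<and> (\<forall>n>0. HH_deg (weyl_scalar :: 'k \<Rightarrow> 'k weyl) n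
               = {\<zero>\<^bsub>HH (weyl_scalar :: 'k \<Rightarrow> 'k weyl)\<^esub>})
    \<and> (\<forall>n>0. HH_deg (qweyl_scalar :: 'k poly \<Rightarrow> 'k qweyl) n \<subseteq> fragile)
    \<and> resilient_scalar \<in> ring_iso (ring_of_type_algebra :: 'k poly ring) resilient"
proof (intro conjI allI impI)
  show "\<exists>\<phi> :: 'k weyl fps \<Rightarrow> 'k qweyl_hat. algebra_iso weyl_fps_scalar qweyl_hat_scalar \<phi>"
    using algebra_iso_fps_to_hat by blast
  fix n :: nat assume n: "n > 0"
  show "HH_deg (qweyl_hat_scalar :: 'k fps \<Rightarrow> 'k qweyl_hat) n
      = {\<zero>\<^bsub>HH (qweyl_hat_scalar :: 'k fps \<Rightarrow> 'k qweyl_hat)\<^esub>}"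
    by (rule H.HH_deg_pos[OF _ n]) (simp add: qweyl_hat_coboundary_iff)
  show "HH_deg (weyl_scalar :: 'k \<Rightarrow> 'k weyl) n = {\<zero>\<^bsub>HH (weyl_scalar :: 'k \<Rightarrow> 'k weyl)\<^esub>}"
  proof (rule W.HH_deg_pos[OF _ n])
    fix f :: "'k weyl list \<Rightarrow> 'k weyl" assume "f \<in> W.cocycles" "f [] = 0"
    then obtain g where "g \<in> cochains weyl_scalar" "f = coboundary g"
      by (rule weyl_cocycle_is_coboundary)
    thus "f \<in> coboundaries weyl_scalar" by (simp add: coboundaries_def)
  qed
  show "HH_deg (qweyl_scalar :: 'k poly \<Rightarrow> 'k qweyl) n \<subseteq> fragile" by (rule HH_deg_fragile[OF n])
qed (rule resilient_scalar_iso)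

end
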